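(* The theory $\mathsf{ACA}_0^{\omega}$ proves that the statement "every upper semi-continuous function $f:[0,1]\to\mathbb R$ is Baire 1" implies both (1) $\mathsf{BCT}_{[0,1]}$: if $(O_n)_{n\in\mathbb N}$ is a decreasing sequence of dense open subsets of $[0,1]$, then $\bigcap_{n\in\mathbb N}O_n$ is non-empty; and (2) the principle $\mathsf{open}$: open sets in the unit interval have RM-codes.
   Context: Formal setting. $\mathsf{RCA}_0^{\omega}$ is Kohlenbach's base theory of higher-order Reverse Mathematics: a classical theory in the language of all finite types (type $0$ is the natural numbers, $\sigma\to\tau$ is the type of maps from type $\sigma$ to type $\tau$ objects, $1:=0\to 0$, $n+1:=n\to 0$; equality at higher types is defined pointwise from equality at type $0$), with axioms: ordered semi-ring axioms for $0,1,<,+,\times$; combinator axioms giving $\lambda$-abstraction; primitive recursion $\mathbf R_0(f,m,0)=m$, $\mathbf R_0(f,m,n+1)=f(n,\mathbf R_0(f,m,n))$ for number-valued $f$ on numbers; extensionality $x=_\rho y\to\varphi(x)=_\tau\varphi(y)$ at all types; induction for quantifier-free formulas (parameters of any type allowed); and $\mathsf{QF\text{-}AC}^{1,0}$, where $\mathsf{QF\text{-}AC}^{\sigma,\tau}$ is the schema $(\forall x^\sigma)(\exists y^\tau)A(x,y)\to(\exists Y^{\sigma\to\tau})(\forall x^\sigma)A(x,Y(x))$ for quantifier-free $A$. $\mathsf{ACA}_0^{\omega}$ is $\mathsf{RCA}_0^{\omega}$ plus $(\exists^2)$: there is $\varphi:\mathbb N^{\mathbb N}\to\{0,1\}$ with $\varphi(f)=0\leftrightarrow(\exists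 n)(f(n)=0)$ for all $f\in\mathbb N^{\mathbb N}$. Reals are fast-converging Cauchy sequences of rationals ($|q_n-q_{n+i}|<2^{-n}$) with the usual $=_{\mathbb R},<_{\mathbb R}$; functions on reals are type $1\to1$ objects respecting $=_{\mathbb R}$. A set of reals is given by its characteristic function (a sequence of sets by a function of a real and a number). $O$ is open if for each $x\in O$ some ball $B(x,2^{-k})$ is contained in $O$ (no further representation is given), relative to $[0,1]$ for subsets of $[0,1]$. Limits superior need not exist as objects; (in)equalities involving them are shorthand for the usual formulas. Definitions. $f:[0,1]\to\mathbb R$ is upper semi-continuous if $f(x_0)\ge\limsup_{x\to x_0}f(x)$ for all $x_0\in[0,1]$. $f$ is Baire 1 if it is the pointwise limit of a sequence of continuous functions on $[0,1]$. An RM-code for an open set $O$ is a sequence of open intervals (balls) with rational endpoints (relative to $[0,1]$) whose union is $O$. *)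

theory Defs
  imports Main
begin

section \<open>Finite types, terms and formulas\<close>

datatype ty = T0 | Arr ty ty (infixr "\<^bold>\<rightarrow>" 80)

abbreviation T1 :: ty where "T1 \<equiv> T0 \<^bold>\<rightarrow> T0"
abbreviation T2 :: ty where "T2 \<equiv> T1 \<^bold>\<rightarrow> T0"

text \<open>\<open>Comb_K\<close> and \<open>Comb_S\<close> are the typed combinators, and \<open>R0\<close> is the recursor with values of type 0.\<close>

datatype cst = Zero | One | Plus | Times | Comb_K ty ty | Comb_S ty ty ty | R0

text \<open>The type is part of a variable, so \<open>Var n \<sigma>\<close> and \<open>Var n \<tau>\<close> are different
  variables whenever \<open>\<sigma> \<noteq> \<tau>\<close>.\<close>

datatype tm = Var nat ty | Cst cst | App tm tm (infixl "\<^bold>\<cdot>" 90)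

text \<open>Prime formulas are equations and inequalities between terms of type 0. The remaining
  connectives are the usual classical abbreviations.\<close>

datatype fm = FEq tm tm | FLess tm tm | FBot | FImp fm fm | FAll nat ty fm

abbreviation FNeg :: "fm \<Rightarrow> fm" where "FNeg \<phi> \<equiv> FImp \<phi> FBot"
abbreviation FEx :: "nat \<Rightarrow> ty \<Rightarrow> fm \<Rightarrow> fm" where "FEx n \<sigma> \<phi> \<equiv> FNeg (FAll n \<sigma> (FNeg \<phi>))"

fun cst_ty :: "cst \<Rightarrow> ty" where
  "cst_ty Zero = T0"
| "cst_ty One = T0"
| "cst_ty Plus = T0 \<^bold>\<rightarrow> T0 \<^bold>\<rightarrow> T0"
| "cst_ty Times = T0 \<^bold>\<rightarrow> T0 \<^bold>\<rightarrow> T0"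
| "cst_ty (Comb_K \<sigma> \<tau>) = \<sigma> \<^bold>\<rightarrow> \<tau> \<^bold>\<rightarrow> \<sigma>"
| "cst_ty (Comb_S \<rho> \<sigma> \<tau>) = (\<rho> \<^bold>\<rightarrow> \<sigma> \<^bold>\<rightarrow> \<tau>) \<^bold>\<rightarrow> (\<rho> \<^bold>\<rightarrow> \<sigma>) \<^bold>\<rightarrow> \<rho> \<^bold>\<rightarrow> \<tau>"
| "cst_ty R0 = (T0 \<^bold>\<rightarrow> T0 \<^bold>\<rightarrow> T0) \<^bold>\<rightarrow> T0 \<^bold>\<rightarrow> T0 \<^bold>\<rightarrow> T0"

inductive has_ty :: "tm \<Rightarrow> ty \<Rightarrow> bool" where
  "has_ty (Var n \<sigma>) \<sigma>"
| "has_ty (Cst c) (cst_ty c)"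
| "has_ty s (\<sigma> \<^bold>\<rightarrow> \<tau>) \<Longrightarrow> has_ty t \<sigma> \<Longrightarrow> has_ty (s \<^bold>\<cdot> t) \<tau>"

fun wff :: "fm \<Rightarrow> bool" where
  "wff (FEq s t) \<longleftrightarrow> has_ty s T0 \<and> has_ty t T0"
| "wff (FLess s t) \<longleftrightarrow> has_ty s T0 \<and> has_ty t T0"
| "wff FBot \<longleftrightarrow> True"
| "wff (FImp \<phi> \<psi>) \<longleftrightarrow> wff \<phi> \<and> wff \<psi>"
| "wff (FAll n \<sigma> \<phi>) \<longleftrightarrow> wff \<phi>"

fun qf :: "fm \<Rightarrow> bool" where
  "qf (FEq s t) \<longleftrightarrow> True"
| "qf (FLess s t) \<longleftrightarrow> True"
| "qf FBot \<longleftrightarrow> True"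
| "qf (FImp \<phi> \<psi>) \<longleftrightarrow> qf \<phi> \<and> qf \<psi>"
| "qf (FAll n \<sigma> \<phi>) \<longleftrightarrow> False"

fun tm_vars :: "tm \<Rightarrow> (nat \<times> ty) set" where
  "tm_vars (Var n \<sigma>) = {(n, \<sigma>)}"
| "tm_vars (Cst c) = {}"
| "tm_vars (s \<^bold>\<cdot> t) = tm_vars s \<union> tm_vars t"

fun fv :: "fm \<Rightarrow> (nat \<times> ty) set" where
  "fv (FEq s t) = tm_vars s \<union> tm_vars t"
| "fv (FLess s t) = tm_vars s \<union> tm_vars t"
| "fv FBot = {}"
| "fv (FImp \<phi> \<psi>) = fv \<phi> \<union> fv \<psi>"
| "fv (FAll n \<sigma> \<phi>) = fv \<phi> - {(n, \<sigma>)}"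

fun tm_subst :: "nat \<times> ty \<Rightarrow> tm \<Rightarrow> tm \<Rightarrow> tm" where
  "tm_subst v r (Var n \<sigma>) = (if (n, \<sigma>) = v then r else Var n \<sigma>)"
| "tm_subst v r (Cst c) = Cst c"
| "tm_subst v r (s \<^bold>\<cdot> t) = tm_subst v r s \<^bold>\<cdot> tm_subst v r t"

text \<open>Plain replacement of the free occurrences; it is used only where no variable of \<open>r\<close> is captured.\<close>

fun subst :: "nat \<times> ty \<Rightarrow> tm \<Rightarrow> fm \<Rightarrow> fm" where
  "subst v r (FEq s t) = FEq (tm_subst v r s) (tm_subst v r t)"
| "subst v r (FLess s t) = FLess (tm_subst v r s) (tm_subst v r t)"
| "subst v r FBot = FBot"
| "subst v r (FImp \<phi> \<psi>) = FImp (subst v r \<phi>) (subst v r \<psi>)"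
| "subst v r (FAll n \<sigma> \<phi>) = FAll n \<sigma> (if (n, \<sigma>) = v then \<phi> else subst v r \<phi>)"

fun free_for :: "tm \<Rightarrow> nat \<times> ty \<Rightarrow> fm \<Rightarrow> bool" where
  "free_for r v (FEq s t) \<longleftrightarrow> True"
| "free_for r v (FLess s t) \<longleftrightarrow> True"
| "free_for r v FBot \<longleftrightarrow> True"
| "free_for r v (FImp \<phi> \<psi>) \<longleftrightarrow> free_for r v \<phi> \<and> free_for r v \<psi>"
| "free_for r v (FAll n \<sigma> \<phi>) \<longleftrightarrow>
     v \<notin> fv (FAll n \<sigma> \<phi>) \<or> (n, \<sigma>) \<notin> tm_vars r \<and> free_for r v \<phi>"


section \<open>Derivability\<close>

text \<open>Classical natural deduction over the set \<open>A\<close> of non-logical axioms. The generalisation rule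
  restricts only the variables of the open assumptions \<open>\<Gamma>\<close>, so a member of \<open>A\<close> with free variables
  (parameters) counts as its universal closure.\<close>

inductive derives :: "fm set \<Rightarrow> fm list \<Rightarrow> fm \<Rightarrow> bool" for A :: "fm set" where
  Axiom: "\<phi> \<in> A \<Longrightarrow> wff \<phi> \<Longrightarrow> derives A \<Gamma> \<phi>"
| Assm: "\<phi> \<in> set \<Gamma> \<Longrightarrow> wff \<phi> \<Longrightarrow> derives A \<Gamma> \<phi>"
| ImpI: "wff \<phi> \<Longrightarrow> derives A (\<phi> # \<Gamma>) \<psi> \<Longrightarrow> derives A \<Gamma> (FImp \<phi> \<psi>)"
| ImpE: "derives A \<Gamma> (FImp \<phi> \<psi>) \<Longrightarrow> derives A \<Gamma> \<phi> \<Longrightarrow> derives A \<Gamma> \<psi>"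
| Raa: "wff \<phi> \<Longrightarrow> derives A (FNeg \<phi> # \<Gamma>) FBot \<Longrightarrow> derives A \<Gamma> \<phi>"
| AllI: "derives A \<Gamma> \<phi> \<Longrightarrow> (\<forall>\<psi> \<in> set \<Gamma>. (n, \<sigma>) \<notin> fv \<psi>) \<Longrightarrow> derives A \<Gamma> (FAll n \<sigma> \<phi>)"
| AllE: "derives A \<Gamma> (FAll n \<sigma> \<phi>) \<Longrightarrow> has_ty t \<sigma> \<Longrightarrow> free_for t (n, \<sigma>) \<phi> \<Longrightarrow>
           derives A \<Gamma> (subst (n, \<sigma>) t \<phi>)"

definition proves :: "fm set \<Rightarrow> fm \<Rightarrow> bool" (infix "\<turnstile>" 55) where
  "A \<turnstile> \<phi> \<longleftrightarrow> derives A [] \<phi>"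


section \<open>Notation for writing concrete formulas\<close>

text \<open>A formula scheme maps a level \<open>n\<close> to a formula whose bound variables have indices \<open>\<ge> n\<close>;
  a quantifier at level \<open>n\<close> binds the variable with index \<open>n\<close> and raises the level for its body
  (de Bruijn levels). This makes it possible to use HOL-bound variables for object variables
  without any capture: in a scheme without parameters, evaluated at level 0, every bound variable
  differs from those of the surrounding quantifiers.\<close>

type_synonym scheme = "nat \<Rightarrow> fm"

definition s_eq :: "tm \<Rightarrow> tm \<Rightarrow> scheme" (infix "\<^bold>=" 50) where "(s \<^bold>= t) = (\<lambda>n. FEq s t)"
definition s_less :: "tm \<Rightarrow> tm \<Rightarrow> scheme" (infix "\<^bold><" 50) where "(s \<^bold>< t) = (\<lambda>n. FLess s t)"
definition s_imp :: "scheme \<Rightarrow> scheme \<Rightarrow> scheme" (infixr "\<^bold>\<longrightarrow>" 25) where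
  "(F \<^bold>\<longrightarrow> G) = (\<lambda>n. FImp (F n) (G n))"
definition s_neg :: "scheme \<Rightarrow> scheme" ("\<^bold>\<not> _" [40] 40) where
  "(\<^bold>\<not> F) = (\<lambda>n. FNeg (F n))"
definition s_conj :: "scheme \<Rightarrow> scheme \<Rightarrow> scheme" (infixr "\<^bold>\<and>" 35) where
  "(F \<^bold>\<and> G) = (\<^bold>\<not> (F \<^bold>\<longrightarrow> \<^bold>\<not> G))"
definition s_disj :: "scheme \<Rightarrow> scheme \<Rightarrow> scheme" (infixr "\<^bold>\<or>" 30) where
  "(F \<^bold>\<or> G) = (\<^bold>\<not> F \<^bold>\<longrightarrow> G)"
definition s_iff :: "scheme \<Rightarrow> scheme \<Rightarrow> scheme" (infixr "\<^bold>\<longleftrightarrow>" 25) where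
  "(F \<^bold>\<longleftrightarrow> G) = ((F \<^bold>\<longrightarrow> G) \<^bold>\<and> (G \<^bold>\<longrightarrow> F))"

definition s_all :: "ty \<Rightarrow> (tm \<Rightarrow> scheme) \<Rightarrow> scheme" where
  "s_all \<sigma> F = (\<lambda>n. FAll n \<sigma> (F (Var n \<sigma>) (Suc n)))"
definition s_ex :: "ty \<Rightarrow> (tm \<Rightarrow> scheme) \<Rightarrow> scheme" where
  "s_ex \<sigma> F = (\<lambda>n. FEx n \<sigma> (F (Var n \<sigma>) (Suc n)))"

definition s_all0 :: "(tm \<Rightarrow> scheme) \<Rightarrow> scheme" (binder "\<^bold>\<forall>\<^sub>0" 10) where "s_all0 = s_all T0"
definition s_all1 :: "(tm \<Rightarrow> scheme) \<Rightarrow> scheme" (binder "\<^bold>\<forall>\<^sub>1" 10) where "s_all1 = s_all T1"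
definition s_ex0 :: "(tm \<Rightarrow> scheme) \<Rightarrow> scheme" (binder "\<^bold>\<exists>\<^sub>0" 10) where "s_ex0 = s_ex T0"
definition s_ex1 :: "(tm \<Rightarrow> scheme) \<Rightarrow> scheme" (binder "\<^bold>\<exists>\<^sub>1" 10) where "s_ex1 = s_ex T1"

definition sentence :: "scheme \<Rightarrow> fm" where "sentence F = F 0"

abbreviation t_zero :: tm ("\<^bold>0") where "\<^bold>0 \<equiv> Cst Zero"
abbreviation t_one :: tm ("\<^bold>1") where "\<^bold>1 \<equiv> Cst One"
abbreviation t_plus :: "tm \<Rightarrow> tm \<Rightarrow> tm" (infixl "\<^bold>+" 65) where "s \<^bold>+ t \<equiv> Cst Plus \<^bold>\<cdot> s \<^bold>\<cdot> t"
abbreviation t_times :: "tm \<Rightarrow> tm \<Rightarrow> tm" (infixl "\<^bold>*" 70) where "s \<^bold>* t \<equiv> Cst Times \<^bold>\<cdot> s \<^bold>\<cdot> t"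

fun eq_at :: "ty \<Rightarrow> tm \<Rightarrow> tm \<Rightarrow> scheme" where
  "eq_at T0 s t = (s \<^bold>= t)"
| "eq_at (\<sigma> \<^bold>\<rightarrow> \<tau>) s t = s_all \<sigma> (\<lambda>z. eq_at \<tau> (s \<^bold>\<cdot> z) (t \<^bold>\<cdot> z))"


section \<open>The axioms\<close>

definition equality_axioms :: "fm set" where
  "equality_axioms = sentence ` {
     \<^bold>\<forall>\<^sub>0x. x \<^bold>= x,
     \<^bold>\<forall>\<^sub>0x. \<^bold>\<forall>\<^sub>0y. x \<^bold>= y \<^bold>\<longrightarrow> y \<^bold>= x,
     \<^bold>\<forall>\<^sub>0x. \<^bold>\<forall>\<^sub>0y. \<^bold>\<forall>\<^sub>0z. x \<^bold>= y \<^bold>\<longrightarrow> y \<^bold>= z \<^bold>\<longrightarrow> x \<^bold>= z,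
     \<^bold>\<forall>\<^sub>0x. \<^bold>\<forall>\<^sub>0y. \<^bold>\<forall>\<^sub>0u. \<^bold>\<forall>\<^sub>0v. x \<^bold>= y \<^bold>\<longrightarrow> u \<^bold>= v \<^bold>\<longrightarrow> x \<^bold>< u \<^bold>\<longrightarrow> y \<^bold>< v}"

text \<open>The non-negative part of a discretely ordered ring.\<close>

definition semiring_axioms :: "fm set" where
  "semiring_axioms = sentence ` {
     \<^bold>\<forall>\<^sub>0x. \<^bold>\<forall>\<^sub>0y. \<^bold>\<forall>\<^sub>0z. (x \<^bold>+ y) \<^bold>+ z \<^bold>= x \<^bold>+ (y \<^bold>+ z),
     \<^bold>\<forall>\<^sub>0x. \<^bold>\<forall>\<^sub>0y. x \<^bold>+ y \<^bold>= y \<^bold>+ x,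
     \<^bold>\<forall>\<^sub>0x. x \<^bold>+ \<^bold>0 \<^bold>= x,
     \<^bold>\<forall>\<^sub>0x. \<^bold>\<forall>\<^sub>0y. \<^bold>\<forall>\<^sub>0z. (x \<^bold>* y) \<^bold>* z \<^bold>= x \<^bold>* (y \<^bold>* z),
     \<^bold>\<forall>\<^sub>0x. \<^bold>\<forall>\<^sub>0y. x \<^bold>* y \<^bold>= y \<^bold>* x,
     \<^bold>\<forall>\<^sub>0x. x \<^bold>* \<^bold>1 \<^bold>= x,
     \<^bold>\<forall>\<^sub>0x. x \<^bold>* \<^bold>0 \<^bold>= \<^bold>0,
     \<^bold>\<forall>\<^sub>0x. \<^bold>\<forall>\<^sub>0y. \<^bold>\<forall>\<^sub>0z. x \<^bold>* (y \<^bold>+ z) \<^bold>= x \<^bold>* y \<^bold>+ x \<^bold>* z,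
     \<^bold>\<forall>\<^sub>0x. \<^bold>\<not> x \<^bold>< x,
     \<^bold>\<forall>\<^sub>0x. \<^bold>\<forall>\<^sub>0y. \<^bold>\<forall>\<^sub>0z. x \<^bold>< y \<^bold>\<longrightarrow> y \<^bold>< z \<^bold>\<longrightarrow> x \<^bold>< z,
     \<^bold>\<forall>\<^sub>0x. \<^bold>\<forall>\<^sub>0y. x \<^bold>< y \<^bold>\<or> x \<^bold>= y \<^bold>\<or> y \<^bold>< x,
     \<^bold>\<forall>\<^sub>0x. \<^bold>\<forall>\<^sub>0y. \<^bold>\<forall>\<^sub>0z. x \<^bold>< y \<^bold>\<longrightarrow> x \<^bold>+ z \<^bold>< y \<^bold>+ z,
     \<^bold>\<forall>\<^sub>0x. \<^bold>\<forall>\<^sub>0y. \<^bold>\<forall>\<^sub>0z. \<^bold>0 \<^bold>< z \<^bold>\<longrightarrow> x \<^bold>< y \<^bold>\<longrightarrow> x \<^bold>* z \<^bold>< y \<^bold>* z,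
     \<^bold>\<forall>\<^sub>0x. \<^bold>\<forall>\<^sub>0y. x \<^bold>< y \<^bold>\<longrightarrow> (\<^bold>\<exists>\<^sub>0z. x \<^bold>+ z \<^bold>= y),
     \<^bold>0 \<^bold>< \<^bold>1,
     \<^bold>\<forall>\<^sub>0x. \<^bold>\<not> x \<^bold>< \<^bold>0,
     \<^bold>\<forall>\<^sub>0x. \<^bold>0 \<^bold>< x \<^bold>\<longrightarrow> x \<^bold>= \<^bold>1 \<^bold>\<or> \<^bold>1 \<^bold>< x}"

definition K_axiom :: "ty \<Rightarrow> ty \<Rightarrow> fm" where
  "K_axiom \<sigma> \<tau> = sentence (s_all \<sigma> (\<lambda>x. s_all \<tau> (\<lambda>y. eq_at \<sigma> (Cst (Comb_K \<sigma> \<tau>) \<^bold>\<cdot> x \<^bold>\<cdot> y) x)))"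

definition S_axiom :: "ty \<Rightarrow> ty \<Rightarrow> ty \<Rightarrow> fm" where
  "S_axiom \<rho> \<sigma> \<tau> = sentence
     (s_all (\<rho> \<^bold>\<rightarrow> \<sigma> \<^bold>\<rightarrow> \<tau>) (\<lambda>x. s_all (\<rho> \<^bold>\<rightarrow> \<sigma>) (\<lambda>y. s_all \<rho> (\<lambda>z.
        eq_at \<tau> (Cst (Comb_S \<rho> \<sigma> \<tau>) \<^bold>\<cdot> x \<^bold>\<cdot> y \<^bold>\<cdot> z) (x \<^bold>\<cdot> z \<^bold>\<cdot> (y \<^bold>\<cdot> z))))))"

definition R0_axioms :: "fm set" where
  "R0_axioms = sentence ` {
     s_all (T0 \<^bold>\<rightarrow> T0 \<^bold>\<rightarrow> T0) (\<lambda>f. \<^bold>\<forall>\<^sub>0m. Cst R0 \<^bold>\<cdot> f \<^bold>\<cdot> m \<^bold>\<cdot> \<^bold>0 \<^bold>= m),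
     s_all (T0 \<^bold>\<rightarrow> T0 \<^bold>\<rightarrow> T0) (\<lambda>f. \<^bold>\<forall>\<^sub>0m. \<^bold>\<forall>\<^sub>0n.
       Cst R0 \<^bold>\<cdot> f \<^bold>\<cdot> m \<^bold>\<cdot> (n \<^bold>+ \<^bold>1) \<^bold>= f \<^bold>\<cdot> n \<^bold>\<cdot> (Cst R0 \<^bold>\<cdot> f \<^bold>\<cdot> m \<^bold>\<cdot> n))}"

definition ext_axiom :: "ty \<Rightarrow> ty \<Rightarrow> fm" where
  "ext_axiom \<rho> \<tau> = sentence
     (s_all \<rho> (\<lambda>x. s_all \<rho> (\<lambda>y. s_all (\<rho> \<^bold>\<rightarrow> \<tau>) (\<lambda>f.
        eq_at \<rho> x y \<^bold>\<longrightarrow> eq_at \<tau> (f \<^bold>\<cdot> x) (f \<^bold>\<cdot> y)))))"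

definition induction_axiom :: "nat \<Rightarrow> fm \<Rightarrow> fm" where
  "induction_axiom x \<phi> =
     FImp (subst (x, T0) \<^bold>0 \<phi>)
       (FImp (FAll x T0 (FImp \<phi> (subst (x, T0) (Var x T0 \<^bold>+ \<^bold>1) \<phi>)))
         (FAll x T0 \<phi>))"

definition QF_IND :: "fm set" where
  "QF_IND = {induction_axiom x \<phi> | x \<phi>. qf \<phi> \<and> wff \<phi>}"

definition choice_axiom :: "ty \<Rightarrow> ty \<Rightarrow> nat \<Rightarrow> nat \<Rightarrow> nat \<Rightarrow> fm \<Rightarrow> fm" where
  "choice_axiom \<sigma> \<tau> x y Y \<phi> =
     FImp (FAll x \<sigma> (FEx y \<tau> \<phi>))
       (FEx Y (\<sigma> \<^bold>\<rightarrow> \<tau>)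
         (FAll x \<sigma> (subst (y, \<tau>) (Var Y (\<sigma> \<^bold>\<rightarrow> \<tau>) \<^bold>\<cdot> Var x \<sigma>) \<phi>)))"

definition QF_AC :: "ty \<Rightarrow> ty \<Rightarrow> fm set" where
  "QF_AC \<sigma> \<tau> = {choice_axiom \<sigma> \<tau> x y Y \<phi> | x y Y \<phi>.
     qf \<phi> \<and> wff \<phi> \<and> (x, \<sigma>) \<noteq> (y, \<tau>) \<and> (Y, \<sigma> \<^bold>\<rightarrow> \<tau>) \<notin> fv \<phi>}"

definition RCA0_omega :: "fm set" where
  "RCA0_omega = equality_axioms \<union> semiring_axioms
     \<union> {K_axiom \<sigma> \<tau> | \<sigma> \<tau>. True} \<union> {S_axiom \<rho> \<sigma> \<tau> | \<rho> \<sigma> \<tau>. True} \<union> R0_axioms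
     \<union> {ext_axiom \<rho> \<tau> | \<rho> \<tau>. True} \<union> QF_IND \<union> QF_AC T1 T0"

definition exists2 :: fm where
  "exists2 = sentence
     (s_ex T2 (\<lambda>\<phi>. \<^bold>\<forall>\<^sub>1f. (\<phi> \<^bold>\<cdot> f \<^bold>= \<^bold>0 \<^bold>\<or> \<phi> \<^bold>\<cdot> f \<^bold>= \<^bold>1) \<^bold>\<and>
        (\<phi> \<^bold>\<cdot> f \<^bold>= \<^bold>0 \<^bold>\<longleftrightarrow> (\<^bold>\<exists>\<^sub>0n. f \<^bold>\<cdot> n \<^bold>= \<^bold>0))))"

definition ACA0_omega :: "fm set" where
  "ACA0_omega = insert exists2 RCA0_omega"


section \<open>Rational and real numbers\<close>

text \<open>A triple \<open>(a, b, c)\<close> of type 0 terms stands for the rational \<open>(a - b) / c\<close>; only \<open>c > 0\<close>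
  occurs.\<close>

type_synonym rat_tm = "tm \<times> tm \<times> tm"

fun qadd :: "rat_tm \<Rightarrow> rat_tm \<Rightarrow> rat_tm" (infixl "\<^bold>+\<^sub>q" 65) where
  "(a, b, c) \<^bold>+\<^sub>q (a', b', c') = (a \<^bold>* c' \<^bold>+ a' \<^bold>* c, b \<^bold>* c' \<^bold>+ b' \<^bold>* c, c \<^bold>* c')"

fun qless :: "rat_tm \<Rightarrow> rat_tm \<Rightarrow> scheme" (infix "\<^bold><\<^sub>q" 50) where
  "((a, b, c) \<^bold><\<^sub>q (a', b', c')) = (a \<^bold>* c' \<^bold>+ b' \<^bold>* c \<^bold>< a' \<^bold>* c \<^bold>+ b \<^bold>* c')"

definition qle :: "rat_tm \<Rightarrow> rat_tm \<Rightarrow> scheme" (infix "\<^bold>\<le>\<^sub>q" 50) where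
  "(p \<^bold>\<le>\<^sub>q q) = (\<^bold>\<not> q \<^bold><\<^sub>q p)"

text \<open>\<open>2 ^ n\<close> by primitive recursion: the step function is \<open>\<lambda>k m. m + m\<close>, where
  \<open>Comb_S Comb_K Comb_K\<close> is the identity.\<close>

definition double_step :: tm where
  "double_step = Cst (Comb_K T1 T0) \<^bold>\<cdot>
     (Cst (Comb_S T0 T0 T0) \<^bold>\<cdot> Cst Plus \<^bold>\<cdot> (Cst (Comb_S T0 T1 T0) \<^bold>\<cdot> Cst (Comb_K T0 T1) \<^bold>\<cdot> Cst (Comb_K T0 T0)))"

definition pow2 :: "tm \<Rightarrow> tm" where
  "pow2 n = Cst R0 \<^bold>\<cdot> double_step \<^bold>\<cdot> \<^bold>1 \<^bold>\<cdot> n"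

text \<open>\<open>2 ^ (- n)\<close> and \<open>2 ^ (- n + 1)\<close>.\<close>

definition eps :: "tm \<Rightarrow> rat_tm" where "eps n = (\<^bold>1, \<^bold>0, pow2 n)"
definition eps2 :: "tm \<Rightarrow> rat_tm" where "eps2 n = (\<^bold>1 \<^bold>+ \<^bold>1, \<^bold>0, pow2 n)"

definition pair :: "tm \<Rightarrow> tm \<Rightarrow> tm" where
  "pair i j = (i \<^bold>+ j) \<^bold>* (i \<^bold>+ j) \<^bold>+ i"

text \<open>The number coding \<open>(a, b, d)\<close> is a code of the rational \<open>(a - b) / (d + 1)\<close>. A rational has
  many codes, and all notions below depend only on the rational. \<open>ex_rat c G\<close> says
  that \<open>c\<close> codes a rational that satisfies \<open>G\<close>.\<close>

definition rat_code :: "tm \<Rightarrow> tm \<Rightarrow> tm \<Rightarrow> tm" where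
  "rat_code a b d = pair (pair a b) d"

definition ex_rat :: "tm \<Rightarrow> (rat_tm \<Rightarrow> scheme) \<Rightarrow> scheme" where
  "ex_rat c G = (\<^bold>\<exists>\<^sub>0a. \<^bold>\<exists>\<^sub>0b. \<^bold>\<exists>\<^sub>0d. c \<^bold>= rat_code a b d \<^bold>\<and> G (a, b, d \<^bold>+ \<^bold>1))"

text \<open>\<open>|x n - x (n + i)| < 2 ^ (- n)\<close>.\<close>

definition is_real :: "tm \<Rightarrow> scheme" where
  "is_real x = (\<^bold>\<forall>\<^sub>0n. \<^bold>\<forall>\<^sub>0i. ex_rat (x \<^bold>\<cdot> n) (\<lambda>p. ex_rat (x \<^bold>\<cdot> (n \<^bold>+ i)) (\<lambda>q.
     p \<^bold><\<^sub>q q \<^bold>+\<^sub>q eps n \<^bold>\<and> q \<^bold><\<^sub>q p \<^bold>+\<^sub>q eps n)))"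

text \<open>\<open>|x n - y n| \<le> 2 ^ (- n + 1)\<close> for all \<open>n\<close>.\<close>

definition real_eq :: "tm \<Rightarrow> tm \<Rightarrow> scheme" (infix "\<^bold>=\<^sub>\<real>" 50) where
  "(x \<^bold>=\<^sub>\<real> y) = (\<^bold>\<forall>\<^sub>0n. ex_rat (x \<^bold>\<cdot> n) (\<lambda>p. ex_rat (y \<^bold>\<cdot> n) (\<lambda>q.
     p \<^bold>\<le>\<^sub>q q \<^bold>+\<^sub>q eps2 n \<^bold>\<and> q \<^bold>\<le>\<^sub>q p \<^bold>+\<^sub>q eps2 n)))"

text \<open>\<open>x n + 2 ^ (- n + 1) < y n\<close> for some \<open>n\<close>.\<close>

definition real_less :: "tm \<Rightarrow> tm \<Rightarrow> scheme" (infix "\<^bold><\<^sub>\<real>" 50) where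
  "(x \<^bold><\<^sub>\<real> y) = (\<^bold>\<exists>\<^sub>0n. ex_rat (x \<^bold>\<cdot> n) (\<lambda>p. ex_rat (y \<^bold>\<cdot> n) (\<lambda>q.
     p \<^bold>+\<^sub>q eps2 n \<^bold><\<^sub>q q)))"

definition real_le :: "tm \<Rightarrow> tm \<Rightarrow> scheme" (infix "\<^bold>\<le>\<^sub>\<real>" 50) where
  "(x \<^bold>\<le>\<^sub>\<real> y) = (\<^bold>\<not> y \<^bold><\<^sub>\<real> x)"

text \<open>\<open>x < y + 2 ^ (- k)\<close>, i.e. \<open>real_less\<close> with \<open>y n + 2 ^ (- k)\<close> in place of \<open>y n\<close>.\<close>

definition less_plus_eps :: "tm \<Rightarrow> tm \<Rightarrow> tm \<Rightarrow> scheme" where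
  "less_plus_eps x y k = (\<^bold>\<exists>\<^sub>0n. ex_rat (x \<^bold>\<cdot> n) (\<lambda>p. ex_rat (y \<^bold>\<cdot> n) (\<lambda>q.
     p \<^bold>+\<^sub>q eps2 n \<^bold><\<^sub>q q \<^bold>+\<^sub>q eps k)))"

text \<open>\<open>|x - y| < 2 ^ (- k)\<close>.\<close>

definition near :: "tm \<Rightarrow> tm \<Rightarrow> tm \<Rightarrow> scheme" where
  "near x y k = (less_plus_eps x y k \<^bold>\<and> less_plus_eps y x k)"

text \<open>The real given by the constant sequence with value \<open>c\<close>.\<close>

definition rat_real :: "tm \<Rightarrow> tm" where "rat_real c = Cst (Comb_K T0 T0) \<^bold>\<cdot> c"

definition in_unit :: "tm \<Rightarrow> scheme" where
  "in_unit x = (is_real x \<^bold>\<and> rat_real (rat_code \<^bold>0 \<^bold>0 \<^bold>0) \<^bold>\<le>\<^sub>\<real> x \<^bold>\<and> x \<^bold>\<le>\<^sub>\<real> rat_real (rat_code \<^bold>1 \<^bold>0 \<^bold>0))"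

definition all_unit :: "(tm \<Rightarrow> scheme) \<Rightarrow> scheme" (binder "\<^bold>\<forall>\<^sub>I" 10) where
  "all_unit F = (\<^bold>\<forall>\<^sub>1x. in_unit x \<^bold>\<longrightarrow> F x)"
definition ex_unit :: "(tm \<Rightarrow> scheme) \<Rightarrow> scheme" (binder "\<^bold>\<exists>\<^sub>I" 10) where
  "ex_unit F = (\<^bold>\<exists>\<^sub>1x. in_unit x \<^bold>\<and> F x)"


section \<open>Functions on the unit interval\<close>

definition is_fun :: "tm \<Rightarrow> scheme" where
  "is_fun f = ((\<^bold>\<forall>\<^sub>Ix. is_real (f \<^bold>\<cdot> x)) \<^bold>\<and> (\<^bold>\<forall>\<^sub>Ix. \<^bold>\<forall>\<^sub>Iy. x \<^bold>=\<^sub>\<real> y \<^bold>\<longrightarrow> f \<^bold>\<cdot> x \<^bold>=\<^sub>\<real> f \<^bold>\<cdot> y))"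

definition continuous :: "tm \<Rightarrow> scheme" where
  "continuous f = (\<^bold>\<forall>\<^sub>Ix. \<^bold>\<forall>\<^sub>0k. \<^bold>\<exists>\<^sub>0N. \<^bold>\<forall>\<^sub>Iy. near x y N \<^bold>\<longrightarrow> near (f \<^bold>\<cdot> x) (f \<^bold>\<cdot> y) k)"

text \<open>\<open>c \<ge> limsup f(x)\<close> as \<open>x\<close> tends to \<open>x0\<close>, within the unit interval.\<close>

definition limsup_le :: "tm \<Rightarrow> tm \<Rightarrow> tm \<Rightarrow> scheme" where
  "limsup_le f x0 c = (\<^bold>\<forall>\<^sub>0k. \<^bold>\<exists>\<^sub>0N. \<^bold>\<forall>\<^sub>Ix.
     \<^bold>\<not> x \<^bold>=\<^sub>\<real> x0 \<^bold>\<longrightarrow> near x x0 N \<^bold>\<longrightarrow> less_plus_eps (f \<^bold>\<cdot> x) c k)"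

definition upper_semicontinuous :: "tm \<Rightarrow> scheme" where
  "upper_semicontinuous f = (\<^bold>\<forall>\<^sub>Ix0. limsup_le f x0 (f \<^bold>\<cdot> x0))"

definition converges :: "tm \<Rightarrow> tm \<Rightarrow> tm \<Rightarrow> scheme" where
  "converges F x y = (\<^bold>\<forall>\<^sub>0k. \<^bold>\<exists>\<^sub>0N. \<^bold>\<forall>\<^sub>0n. \<^bold>\<not> n \<^bold>< N \<^bold>\<longrightarrow> near (F \<^bold>\<cdot> n \<^bold>\<cdot> x) y k)"

definition baire1 :: "tm \<Rightarrow> scheme" where
  "baire1 f = s_ex (T0 \<^bold>\<rightarrow> T1 \<^bold>\<rightarrow> T1) (\<lambda>F.
     (\<^bold>\<forall>\<^sub>0n. is_fun (F \<^bold>\<cdot> n) \<^bold>\<and> continuous (F \<^bold>\<cdot> n)) \<^bold>\<and> (\<^bold>\<forall>\<^sub>Ix. converges F x (f \<^bold>\<cdot> x)))"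

definition usc_baire1 :: scheme where
  "usc_baire1 = s_all (T1 \<^bold>\<rightarrow> T1) (\<lambda>f. is_fun f \<^bold>\<longrightarrow> upper_semicontinuous f \<^bold>\<longrightarrow> baire1 f)"


section \<open>Subsets of the unit interval\<close>

definition mem :: "tm \<Rightarrow> tm \<Rightarrow> scheme" (infix "\<^bold>\<in>" 50) where
  "(x \<^bold>\<in> X) = (X \<^bold>\<cdot> x \<^bold>= \<^bold>1)"

definition is_set :: "tm \<Rightarrow> scheme" where
  "is_set X = ((\<^bold>\<forall>\<^sub>Ix. X \<^bold>\<cdot> x \<^bold>= \<^bold>0 \<^bold>\<or> X \<^bold>\<cdot> x \<^bold>= \<^bold>1) \<^bold>\<and> (\<^bold>\<forall>\<^sub>Ix. \<^bold>\<forall>\<^sub>Iy. x \<^bold>=\<^sub>\<real> y \<^bold>\<longrightarrow> X \<^bold>\<cdot> x \<^bold>= X \<^bold>\<cdot> y))"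

definition open_set :: "tm \<Rightarrow> scheme" where
  "open_set X = (\<^bold>\<forall>\<^sub>Ix. x \<^bold>\<in> X \<^bold>\<longrightarrow> (\<^bold>\<exists>\<^sub>0k. \<^bold>\<forall>\<^sub>Iy. near x y k \<^bold>\<longrightarrow> y \<^bold>\<in> X))"

definition dense_set :: "tm \<Rightarrow> scheme" where
  "dense_set X = (\<^bold>\<forall>\<^sub>Ix. \<^bold>\<forall>\<^sub>0k. \<^bold>\<exists>\<^sub>Iy. near x y k \<^bold>\<and> y \<^bold>\<in> X)"

definition BCT :: scheme where
  "BCT = s_all (T0 \<^bold>\<rightarrow> T1 \<^bold>\<rightarrow> T0) (\<lambda>X.
     (\<^bold>\<forall>\<^sub>0n. is_set (X \<^bold>\<cdot> n) \<^bold>\<and> open_set (X \<^bold>\<cdot> n) \<^bold>\<and> dense_set (X \<^bold>\<cdot> n)) \<^bold>\<longrightarrow>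
     (\<^bold>\<forall>\<^sub>0n. \<^bold>\<forall>\<^sub>Ix. x \<^bold>\<in> X \<^bold>\<cdot> (n \<^bold>+ \<^bold>1) \<^bold>\<longrightarrow> x \<^bold>\<in> X \<^bold>\<cdot> n) \<^bold>\<longrightarrow>
     (\<^bold>\<exists>\<^sub>Ix. \<^bold>\<forall>\<^sub>0n. x \<^bold>\<in> X \<^bold>\<cdot> n))"

text \<open>\<open>a\<close> and \<open>b\<close> are the sequences of left and right endpoints. An interval may lie outside the
  unit interval, so the empty set has a code.\<close>

definition RM_code :: "tm \<Rightarrow> tm \<Rightarrow> tm \<Rightarrow> scheme" where
  "RM_code a b X =
     ((\<^bold>\<forall>\<^sub>0n. ex_rat (a \<^bold>\<cdot> n) (\<lambda>p. ex_rat (b \<^bold>\<cdot> n) (\<lambda>q. p \<^bold><\<^sub>q q))) \<^bold>\<and>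
      (\<^bold>\<forall>\<^sub>Ix. x \<^bold>\<in> X \<^bold>\<longleftrightarrow>
         (\<^bold>\<exists>\<^sub>0n. rat_real (a \<^bold>\<cdot> n) \<^bold><\<^sub>\<real> x \<^bold>\<and> x \<^bold><\<^sub>\<real> rat_real (b \<^bold>\<cdot> n))))"

definition open_RM :: scheme where
  "open_RM = s_all T2 (\<lambda>X. is_set X \<^bold>\<longrightarrow> open_set X \<^bold>\<longrightarrow> (\<^bold>\<exists>\<^sub>1a. \<^bold>\<exists>\<^sub>1b. RM_code a b X))"

end

theory Submission
  imports Defs "HOL-Library.Countable" "HOL-Computational_Algebra.Fraction_Field"
begin

text \<open>By completeness it is enough to refute a Henkin term model \<open>T\<close> of the axioms in which every
  upper semi-continuous function is Baire 1 while one of the conclusions fails. The elements of \<open>T\<close>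
  of type 0 form an ordered semiring with induction for arithmetical relations, so \<open>T\<close> supports
  the elementary analysis of reals given by Cauchy sequences.

  For an open set \<open>X\<close>, the characteristic function of its complement is upper semi-continuous, hence
  a limit of continuous functions \<open>F m\<close>. The intervals of a code of \<open>X\<close> are the rational intervals
  with the following property for every \<open>k\<close>: there is a radius such that on every ball of that radius
  around a point of the interval some \<open>F m\<close> with \<open>m \<ge> k\<close> is at most 1/2. By continuity only values at
  rationals matter, so the property is arithmetical. Such an interval is contained in \<open>X\<close>, and by
  bisection every compact interval in \<open>X\<close> has the property.

  For a decreasing sequence of dense open sets \<open>X n\<close>, the function equal to \<open>2 ^ (- n)\<close> for the least
  \<open>n\<close> with \<open>x \<notin> X n\<close>, and to 0 if there is none, is upper semi-continuous and again a limit of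
  continuous functions \<open>F m\<close>. By density there are nested rational intervals, the \<open>i\<close>-th of which
  carries an \<open>F m\<close> with \<open>m \<ge> i\<close> below \<open>3/4 * 2 ^ (- i)\<close>. At their common point the limit is 0.\<close>

text \<open>Working in a model replaces formal derivations by ordinary HOL reasoning. The obstacle
  is that the model may be nonstandard. Neither recursion nor induction of HOL applies to its
  numbers, and a sequence or a limit point exists only if it is defined inside the model. Every
  induction, recursion or choice therefore comes with a proof that the relation involved has a
  characteristic term with parameters. The functional of \<open>exists2\<close> closes these
  relations under number quantifiers, and together with quantifier-free choice it yields a selector,
  hence dependent choice. Quantifiers over reals would leave this class, which is why both halves
  speak about the values of \<open>F m\<close> at rationals.

  The threshold 1/2 separates the two values of a characteristic function. The factor 3/4 does the
  same for the second function, which is at most \<open>2 ^ (- n - 1)\<close> on \<open>X n\<close>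
  and at least \<open>2 ^ (- n)\<close> off it.

  The numbers are made into a HOL type so that ordered semirings and fraction fields can be used. A
  type cannot depend on an assumption, so one countermodel is fixed in advance.\<close>

instance ty :: countable by countable_datatype
instance cst :: countable by countable_datatype
instance tm :: countable by countable_datatype
instance fm :: countable by countable_datatype

section \<open>Hilbert-style consequence\<close>

inductive_cases has_ty_VarE: "has_ty (Var n \<sigma>) \<tau>"
inductive_cases has_ty_CstE: "has_ty (Cst c) \<tau>"
inductive_cases has_ty_AppE: "has_ty (s \<^bold>\<cdot> t) \<tau>"

lemma has_ty_Var [simp]: "has_ty (Var n \<sigma>) \<tau> \<longleftrightarrow> \<tau> = \<sigma>"
  by (auto elim: has_ty_VarE intro: has_ty.intros)

lemma has_ty_Cst [simp]: "has_ty (Cst c) \<tau> \<longleftrightarrow> \<tau> = cst_ty c"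
  by (auto elim: has_ty_CstE intro: has_ty.intros)

lemma has_ty_App: "has_ty (s \<^bold>\<cdot> t) \<tau> \<longleftrightarrow> (\<exists>\<sigma>. has_ty s (\<sigma> \<^bold>\<rightarrow> \<tau>) \<and> has_ty t \<sigma>)"
  by (auto elim: has_ty_AppE intro: has_ty.intros)

lemma has_ty_tm_subst: "has_ty s \<tau> \<Longrightarrow> has_ty r (snd v) \<Longrightarrow> has_ty (tm_subst v r s) \<tau>"
  by (induction s arbitrary: \<tau>) (auto simp: has_ty_App)

lemma wff_subst: "wff \<phi> \<Longrightarrow> has_ty r (snd v) \<Longrightarrow> wff (subst v r \<phi>)"
  by (induction \<phi>) (auto simp: has_ty_tm_subst)

lemma derives_wff: "derives A \<Gamma> \<phi> \<Longrightarrow> wff \<phi>"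
  by (induction rule: derives.induct) (auto simp: wff_subst)

lemma tm_subst_Var [simp]: "tm_subst (n, \<sigma>) (Var n \<sigma>) s = s"
  by (induction s) auto

lemma subst_Var [simp]: "subst (n, \<sigma>) (Var n \<sigma>) \<phi> = \<phi>"
  by (induction \<phi>) auto

lemma free_for_Var [simp]: "free_for (Var n \<sigma>) (n, \<sigma>) \<phi>"
  by (induction \<phi>) auto

lemma finite_tm_vars [simp]: "finite (tm_vars t)"
  by (induction t) auto

lemma finite_fv [simp]: "finite (fv \<phi>)"
  by (induction \<phi>) auto

lemma tm_subst_nonfree: "v \<notin> tm_vars s \<Longrightarrow> tm_subst v t s = s"
  by (induction s) auto

lemma subst_nonfree: "v \<notin> fv \<phi> \<Longrightarrow> subst v t \<phi> = \<phi>"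
  by (induction \<phi>) (auto simp: tm_subst_nonfree)

lemma hilbert_K: "wff \<phi> \<Longrightarrow> wff \<psi> \<Longrightarrow> derives A [] (FImp \<phi> (FImp \<psi> \<phi>))"
  by (intro derives.ImpI derives.Assm) auto

lemma hilbert_S:
  assumes "wff \<phi>" "wff \<psi>" "wff \<chi>"
  shows "derives A [] (FImp (FImp \<phi> (FImp \<psi> \<chi>)) (FImp (FImp \<phi> \<psi>) (FImp \<phi> \<chi>)))"
proof (intro derives.ImpI)
  let ?\<Gamma> = "[\<phi>, FImp \<phi> \<psi>, FImp \<phi> (FImp \<psi> \<chi>)]"
  have "derives A ?\<Gamma> (FImp \<phi> (FImp \<psi> \<chi>))" "derives A ?\<Gamma> \<phi>" "derives A ?\<Gamma> (FImp \<phi> \<psi>)" "derives A ?\<Gamma> \<phi>"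
    by (rule derives.Assm; simp add: assms)+
  then show "derives A ?\<Gamma> \<chi>" by (rule derives.ImpE[OF derives.ImpE derives.ImpE])
qed (use assms in auto)

lemma hilbert_dn:
  assumes "wff \<phi>" shows "derives A [] (FImp (FNeg (FNeg \<phi>)) \<phi>)"
proof (rule derives.ImpI[OF _ derives.Raa])
  let ?\<Gamma> = "[FNeg \<phi>, FNeg (FNeg \<phi>)]"
  have "derives A ?\<Gamma> (FNeg (FNeg \<phi>))" "derives A ?\<Gamma> (FNeg \<phi>)"
    by (rule derives.Assm; simp add: assms)+
  then show "derives A ?\<Gamma> FBot" by (rule derives.ImpE)
qed (use assms in auto)

lemma hilbert_allE:
  assumes "wff \<phi>" "has_ty t \<sigma>" "free_for t (n, \<sigma>) \<phi>"
  shows "derives A [] (FImp (FAll n \<sigma> \<phi>) (subst (n, \<sigma>) t \<phi>))"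
  using assms by (intro derives.ImpI derives.AllE derives.Assm) auto

lemma hilbert_dist:
  assumes "wff \<phi>" "wff \<psi>" "(n, \<sigma>) \<notin> fv \<phi>"
  shows "derives A [] (FImp (FAll n \<sigma> (FImp \<phi> \<psi>)) (FImp \<phi> (FAll n \<sigma> \<psi>)))"
proof (intro derives.ImpI derives.AllI)
  let ?\<Gamma> = "[\<phi>, FAll n \<sigma> (FImp \<phi> \<psi>)]"
  have "derives A ?\<Gamma> (subst (n, \<sigma>) (Var n \<sigma>) (FImp \<phi> \<psi>))"
    using assms by (intro derives.AllE derives.Assm) auto
  then have "derives A ?\<Gamma> (FImp \<phi> \<psi>)" by (simp only: subst_Var)
  moreover have "derives A ?\<Gamma> \<phi>" using assms by (intro derives.Assm) auto
  ultimately show "derives A ?\<Gamma> \<psi>" by (rule derives.ImpE)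
qed (use assms in auto)

text \<open>\<open>derives\<close> keeps its assumptions in a list that its rules change. Here the
  hypotheses form a fixed, possibly infinite set and modus ponens is the only rule, the quantifier
  rules being packed into theorems without hypotheses. Inductions on derivations then have three
  cases.\<close>

inductive ent :: "fm set \<Rightarrow> fm set \<Rightarrow> fm \<Rightarrow> bool" for A S where
  prv: "derives A [] \<phi> \<Longrightarrow> ent A S \<phi>"
| hyp: "\<phi> \<in> S \<Longrightarrow> wff \<phi> \<Longrightarrow> ent A S \<phi>"
| mp: "ent A S (FImp \<phi> \<psi>) \<Longrightarrow> ent A S \<phi> \<Longrightarrow> ent A S \<psi>"

lemma ent_wff: "ent A S \<phi> \<Longrightarrow> wff \<phi>"
  by (induction rule: ent.induct) (auto simp: derives_wff)

lemma ent_mono: "ent A S \<phi> \<Longrightarrow> S \<subseteq> S' \<Longrightarrow> ent A S' \<phi>"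
  by (induction rule: ent.induct) (auto intro: ent.intros)

lemma ent_empty: "ent A {} \<phi> \<longleftrightarrow> derives A [] \<phi>"
proof
  show "ent A {} \<phi> \<Longrightarrow> derives A [] \<phi>"
    by (induction rule: ent.induct) (auto intro: derives.ImpE)
qed (rule ent.prv)

lemma ent_imp_refl: "wff \<phi> \<Longrightarrow> ent A S (FImp \<phi> \<phi>)"
  by (intro ent.prv derives.ImpI derives.Assm) auto

lemma ent_deduction:
  assumes "ent A (insert \<psi> S) \<phi>" "wff \<psi>"
  shows "ent A S (FImp \<psi> \<phi>)"
  using assms
proof (induction rule: ent.induct)
  case (prv \<phi>)
  then show ?case by (meson derives_wff ent.mp ent.prv hilbert_K)
next
  case (hyp \<phi>)
  then show ?case
    by (metis ent.hyp ent.mp ent.prv ent_imp_refl hilbert_K insertE)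
next
  case (mp \<phi> \<chi>)
  have "wff \<phi>" "wff \<chi>" using ent_wff[OF mp.hyps(1)] by auto
  then have "ent A S (FImp (FImp \<psi> (FImp \<phi> \<chi>)) (FImp (FImp \<psi> \<phi>) (FImp \<psi> \<chi>)))"
    using mp.prems by (intro ent.prv hilbert_S)
  then show ?case using mp by (meson ent.mp)
qed

text \<open>Generalisation is no rule of \<open>ent\<close> and is recovered by induction. For a
  hypothesis, the variable is not free in it, so \<open>hilbert_dist\<close> moves the quantifier of
  a generalised \<open>FImp \<phi> \<phi>\<close> inward.\<close>

lemma ent_gen:
  assumes "ent A S \<phi>" "\<forall>\<psi>\<in>S. (n, \<sigma>) \<notin> fv \<psi>"
  shows "ent A S (FAll n \<sigma> \<phi>)"
  using assms
proof (induction rule: ent.induct)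
  case (prv \<phi>)
  then show ?case by (intro ent.prv derives.AllI) auto
next
  case (hyp \<phi>)
  have "derives A [] (FAll n \<sigma> (FImp \<phi> \<phi>))"
    using hyp by (intro derives.AllI derives.ImpI derives.Assm) auto
  then have "ent A S (FImp \<phi> (FAll n \<sigma> \<phi>))"
    using hyp by (meson ent.mp ent.prv hilbert_dist)
  then show ?case using hyp by (meson ent.hyp ent.mp)
next
  case (mp \<phi> \<psi>)
  have w: "wff \<phi>" "wff \<psi>" using ent_wff[OF mp.hyps(1)] by auto
  have "derives A [FAll n \<sigma> \<phi>, FAll n \<sigma> (FImp \<phi> \<psi>)] (FAll n \<sigma> \<psi>)" (is "derives A ?\<Gamma> _")
  proof (rule derives.AllI)
    have "derives A ?\<Gamma> (FImp \<phi> \<psi>)"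
      using w derives.AllE[of A ?\<Gamma> n \<sigma> "FImp \<phi> \<psi>" "Var n \<sigma>"] by (simp add: derives.Assm)
    moreover have "derives A ?\<Gamma> \<phi>"
      using w derives.AllE[of A ?\<Gamma> n \<sigma> \<phi> "Var n \<sigma>"] by (simp add: derives.Assm)
    ultimately show "derives A ?\<Gamma> \<psi>" by (rule derives.ImpE)
  qed auto
  then have "ent A S (FImp (FAll n \<sigma> (FImp \<phi> \<psi>)) (FImp (FAll n \<sigma> \<phi>) (FAll n \<sigma> \<psi>)))"
    using w by (intro ent.prv derives.ImpI) auto
  then show ?case using mp by (meson ent.mp)
qed

lemma ent_allE:
  assumes "ent A S (FAll n \<sigma> \<phi>)" "has_ty t \<sigma>" "free_for t (n, \<sigma>) \<phi>"
  shows "ent A S (subst (n, \<sigma>) t \<phi>)"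
  by (rule ent.mp[OF ent.prv[OF hilbert_allE] assms(1)]) (use assms ent_wff[OF assms(1)] in auto)

lemma ent_dn: "ent A S (FNeg (FNeg \<phi>)) \<Longrightarrow> ent A S \<phi>"
  by (rule ent.mp[OF ent.prv[OF hilbert_dn]]) (auto dest: ent_wff)

lemma ent_raa: "ent A (insert (FNeg \<phi>) S) FBot \<Longrightarrow> wff \<phi> \<Longrightarrow> ent A S \<phi>"
  by (rule ent_dn) (simp add: ent_deduction)

section \<open>Simultaneous substitution with renaming of bound variables\<close>

fun ev :: "(nat \<times> ty \<Rightarrow> tm) \<Rightarrow> tm \<Rightarrow> tm" where
  "ev e (Var n \<sigma>) = e (n, \<sigma>)"
| "ev e (Cst c) = Cst c"
| "ev e (s \<^bold>\<cdot> t) = ev e s \<^bold>\<cdot> ev e t"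

text \<open>Substitution by \<open>e\<close> that also sends every bound index \<open>n\<close> to
  \<open>r n\<close>. If the values of \<open>e\<close> avoid the range of \<open>r\<close>, nothing
  is captured; this is how elements of the term model will be inserted.\<close>

fun nf :: "(nat \<Rightarrow> nat) \<Rightarrow> (nat \<times> ty \<Rightarrow> tm) \<Rightarrow> fm \<Rightarrow> fm" where
  "nf r e (FEq s t) = FEq (ev e s) (ev e t)"
| "nf r e (FLess s t) = FLess (ev e s) (ev e t)"
| "nf r e FBot = FBot"
| "nf r e (FImp \<phi> \<psi>) = FImp (nf r e \<phi>) (nf r e \<psi>)"
| "nf r e (FAll n \<sigma> \<phi>) = FAll (r n) \<sigma> (nf r (e((n, \<sigma>) := Var (r n) \<sigma>)) \<phi>)"

fun bv :: "fm \<Rightarrow> (nat \<times> ty) set" where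
  "bv (FEq s t) = {}"
| "bv (FLess s t) = {}"
| "bv FBot = {}"
| "bv (FImp \<phi> \<psi>) = bv \<phi> \<union> bv \<psi>"
| "bv (FAll n \<sigma> \<phi>) = insert (n, \<sigma>) (bv \<phi>)"

lemma finite_bv [simp]: "finite (bv \<phi>)"
  by (induction \<phi>) auto

definition typed_env :: "(nat \<times> ty \<Rightarrow> tm) \<Rightarrow> bool" where
  "typed_env e \<longleftrightarrow> (\<forall>n \<sigma>. has_ty (e (n, \<sigma>)) \<sigma>)"

lemma typed_env_upd: "typed_env e \<Longrightarrow> has_ty t (snd v) \<Longrightarrow> typed_env (e(v := t))"
  by (auto simp: typed_env_def)

lemma has_ty_ev: "has_ty t \<tau> \<Longrightarrow> typed_env e \<Longrightarrow> has_ty (ev e t) \<tau>"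
  by (induction rule: has_ty.induct) (auto simp: typed_env_def has_ty_App)

lemma wff_nf: "wff \<phi> \<Longrightarrow> typed_env e \<Longrightarrow> wff (nf r e \<phi>)"
  by (induction \<phi> arbitrary: e) (auto simp: has_ty_ev typed_env_upd)

lemma tm_vars_ev: "tm_vars (ev e t) = (\<Union>v\<in>tm_vars t. tm_vars (e v))"
  by (induction t) auto

lemma fv_nf: "fv (nf r e \<phi>) \<subseteq> (\<Union>v\<in>fv \<phi>. tm_vars (e v))"
proof (induction \<phi> arbitrary: e)
  case (FImp \<phi> \<psi>)
  have "fv (nf r e \<phi>) \<subseteq> (\<Union>v\<in>fv \<phi>. tm_vars (e v))" "fv (nf r e \<psi>) \<subseteq> (\<Union>v\<in>fv \<psi>. tm_vars (e v))"
    by (rule FImp)+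
  then show ?case by auto
next
  case (FAll n \<sigma> \<phi>)
  let ?e = "e((n, \<sigma>) := Var (r n) \<sigma>)"
  have "fv (nf r ?e \<phi>) \<subseteq> (\<Union>v\<in>fv \<phi>. tm_vars (?e v))" by (rule FAll)
  also have "\<dots> \<subseteq> (\<Union>v\<in>fv \<phi> - {(n, \<sigma>)}. tm_vars (e v)) \<union> {(r n, \<sigma>)}"
    by (auto split: if_splits)
  finally show ?case by auto
qed (auto simp: tm_vars_ev)

lemma ev_cong: "(\<And>v. v \<in> tm_vars t \<Longrightarrow> e v = e' v) \<Longrightarrow> ev e t = ev e' t"
  by (induction t) auto

lemma nf_cong: "(\<And>v. v \<in> fv \<phi> \<Longrightarrow> e v = e' v) \<Longrightarrow> nf r e \<phi> = nf r e' \<phi>"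
proof (induction \<phi> arbitrary: e e')
  case (FEq s t)
  then have "ev e s = ev e' s" "ev e t = ev e' t" by (auto intro!: ev_cong)
  then show ?case by simp
next
  case (FLess s t)
  then have "ev e s = ev e' s" "ev e t = ev e' t" by (auto intro!: ev_cong)
  then show ?case by simp
next
  case (FImp \<phi> \<psi>)
  have "nf r e \<phi> = nf r e' \<phi>" "nf r e \<psi> = nf r e' \<psi>"
    by ((rule FImp.IH; use FImp.prems in auto)+)
  then show ?case by simp
next
  case (FAll n \<sigma> \<phi>)
  have "nf r (e((n, \<sigma>) := Var (r n) \<sigma>)) \<phi> = nf r (e'((n, \<sigma>) := Var (r n) \<sigma>)) \<phi>"
    by (rule FAll.IH) (use FAll.prems in auto)
  then show ?case by simp
qed auto

definition id_env :: "nat \<times> ty \<Rightarrow> tm" where "id_env = (\<lambda>(n, \<sigma>). Var n \<sigma>)"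

lemma ev_id_env [simp]: "ev id_env t = t"
  by (induction t) (auto simp: id_env_def)

lemma id_env_upd [simp]: "id_env((n, \<sigma>) := Var n \<sigma>) = id_env"
  by (auto simp: id_env_def)

lemma nf_id_env [simp]: "nf id id_env \<phi> = \<phi>"
  by (induction \<phi>) auto

lemma typed_id_env [simp]: "typed_env id_env"
  by (auto simp: typed_env_def id_env_def)

lemma tm_subst_ev:
  assumes "\<And>u. u \<in> tm_vars s \<Longrightarrow> u \<noteq> v \<Longrightarrow> (i, \<sigma>) \<notin> tm_vars (e u)"
  shows "tm_subst (i, \<sigma>) t (ev (e(v := Var i \<sigma>)) s) = ev (e(v := t)) s"
  using assms by (induction s) (auto simp: tm_subst_nonfree)

text \<open>The placeholder \<open>Var i \<sigma>\<close> for \<open>v\<close> can be replaced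
  afterwards. The conditions exclude three accidents: the placeholder occurs in another value of
  \<open>e\<close>, a renamed binder captures a variable of \<open>t\<close>, or a renamed binder
  other than that of \<open>v\<close> binds the placeholder.\<close>

lemma subst_nf:
  assumes "inj r" "\<And>u. u \<in> fv \<phi> \<Longrightarrow> u \<noteq> v \<Longrightarrow> (i, \<sigma>) \<notin> tm_vars (e u)"
    "\<And>m \<tau>. (m, \<tau>) \<in> bv \<phi> \<Longrightarrow> (m, \<tau>) \<noteq> v \<Longrightarrow> (r m, \<tau>) \<notin> tm_vars t"
    "\<And>m. (m, \<sigma>) \<in> bv \<phi> \<Longrightarrow> r m = i \<Longrightarrow> (m, \<sigma>) = v"
  shows "subst (i, \<sigma>) t (nf r (e(v := Var i \<sigma>)) \<phi>) = nf r (e(v := t)) \<phi> \<and>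
         free_for t (i, \<sigma>) (nf r (e(v := Var i \<sigma>)) \<phi>)"
  using assms
proof (induction \<phi> arbitrary: e)
  case (FEq s1 s2)
  have "tm_subst (i, \<sigma>) t (ev (e(v := Var i \<sigma>)) s1) = ev (e(v := t)) s1"
    "tm_subst (i, \<sigma>) t (ev (e(v := Var i \<sigma>)) s2) = ev (e(v := t)) s2"
    by ((rule tm_subst_ev; use FEq.prems in auto)+)
  then show ?case by (simp del: fun_upd_apply)
next
  case (FLess s1 s2)
  have "tm_subst (i, \<sigma>) t (ev (e(v := Var i \<sigma>)) s1) = ev (e(v := t)) s1"
    "tm_subst (i, \<sigma>) t (ev (e(v := Var i \<sigma>)) s2) = ev (e(v := t)) s2"
    by ((rule tm_subst_ev; use FLess.prems in auto)+)
  then show ?case by (simp del: fun_upd_apply)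
next
  case (FImp \<phi> \<psi>)
  have "subst (i, \<sigma>) t (nf r (e(v := Var i \<sigma>)) \<phi>) = nf r (e(v := t)) \<phi> \<and>
         free_for t (i, \<sigma>) (nf r (e(v := Var i \<sigma>)) \<phi>)"
    by (rule FImp.IH) (use FImp.prems in auto)
  moreover have "subst (i, \<sigma>) t (nf r (e(v := Var i \<sigma>)) \<psi>) = nf r (e(v := t)) \<psi> \<and>
         free_for t (i, \<sigma>) (nf r (e(v := Var i \<sigma>)) \<psi>)"
    by (rule FImp.IH) (use FImp.prems in auto)
  ultimately show ?case by (simp del: fun_upd_apply)
next
  case (FAll m \<tau> \<phi>)
  show ?case
  proof (cases "(m, \<tau>) = v")
    case True
    let ?B = "nf r (e(v := Var (r m) \<tau>)) \<phi>"
    \<comment> \<open>The quantifier binds \<open>v\<close> itself, so the placeholder is not free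
      and the substitution is void.\<close>
    have "(i, \<sigma>) \<notin> fv (FAll (r m) \<tau> ?B)"
    proof
      assume "(i, \<sigma>) \<in> fv (FAll (r m) \<tau> ?B)"
      then have *: "(i, \<sigma>) \<in> fv ?B" "(i, \<sigma>) \<noteq> (r m, \<tau>)" by auto
      then obtain u where "u \<in> fv \<phi>" "(i, \<sigma>) \<in> tm_vars ((e(v := Var (r m) \<tau>)) u)"
        using fv_nf by blast
      with * show False using FAll.prems(2)[of u] True by (auto split: if_splits)
    qed
    then have "subst (i, \<sigma>) t (FAll (r m) \<tau> ?B) = FAll (r m) \<tau> ?B"
      "free_for t (i, \<sigma>) (FAll (r m) \<tau> ?B)" by (blast intro: subst_nonfree, simp)
    then show ?thesis using True by (simp del: subst.simps free_for.simps fun_upd_apply)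
  next
    case False
    then have ne: "(r m, \<tau>) \<noteq> (i, \<sigma>)" using FAll.prems(4)[of m] by auto
    have tw: "(e(v := x))((m, \<tau>) := y) = (e((m, \<tau>) := y))(v := x)" for x y
      using False by (auto simp: fun_upd_twist)
    have "subst (i, \<sigma>) t (nf r ((e((m, \<tau>) := Var (r m) \<tau>))(v := Var i \<sigma>)) \<phi>)
            = nf r ((e((m, \<tau>) := Var (r m) \<tau>))(v := t)) \<phi> \<and>
         free_for t (i, \<sigma>) (nf r ((e((m, \<tau>) := Var (r m) \<tau>))(v := Var i \<sigma>)) \<phi>)"
    proof (rule FAll.IH)
      fix u assume "u \<in> fv \<phi>" "u \<noteq> v"
      then show "(i, \<sigma>) \<notin> tm_vars ((e((m, \<tau>) := Var (r m) \<tau>)) u)"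
        using ne FAll.prems(2)[of u] by auto
    qed (use FAll.prems in auto)
    moreover have "(r m, \<tau>) \<notin> tm_vars t" using FAll.prems(3) False by simp
    ultimately show ?thesis using ne by (auto simp: tw simp del: fun_upd_apply)
  qed
qed auto

text \<open>A direct passage from \<open>r1 n\<close> to \<open>r2 n\<close> could collide with
  binders inside the formula. A fresh index \<open>j\<close> serves as an intermediate station:
  instantiate with \<open>j\<close>, apply the induction hypothesis, generalise over
  \<open>j\<close>, instantiate with \<open>r2 n\<close>. Both renamings are arbitrary in the
  induction because an implication swaps them in its premise.\<close>

lemma alpha:
  assumes "inj r1" "inj r2" "wff \<phi>" "typed_env e"
    "\<And>v k \<tau> m \<rho>. v \<in> fv \<phi> \<Longrightarrow> (k, \<tau>) \<in> tm_vars (e v) \<Longrightarrow> (m, \<rho>) \<in> bv \<phi> \<Longrightarrow> k \<noteq> r1 m \<and> k \<noteq> r2 m"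
  shows "ent A {} (FImp (nf r1 e \<phi>) (nf r2 e \<phi>))"
  using assms
proof (induction \<phi> arbitrary: e r1 r2)
  case (FImp \<phi> \<psi>)
  let ?a = "nf r1 e \<phi>" and ?b = "nf r1 e \<psi>" and ?c = "nf r2 e \<phi>" and ?d = "nf r2 e \<psi>"
  have "ent A {} (FImp ?c ?a)"
    by (rule FImp.IH(1)) (use FImp.prems in \<open>simp_all, blast+\<close>)
  moreover have "ent A {} (FImp ?b ?d)"
    by (rule FImp.IH(2)) (use FImp.prems in \<open>simp_all, blast+\<close>)
  ultimately have *: "ent A {?c, FImp ?a ?b} (FImp ?c ?a)" "ent A {?c, FImp ?a ?b} (FImp ?b ?d)"
    by (auto intro: ent_mono)
  have w: "wff ?c" "wff (FImp ?a ?b)"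
    using FImp.prems by (auto simp: wff_nf)
  then have "ent A {?c, FImp ?a ?b} ?d"
    by (intro ent.mp[OF *(2)] ent.mp[of _ _ ?a ?b] ent.mp[OF *(1)] ent.hyp) auto
  then show ?case using w by (simp add: ent_deduction del: wff.simps)
next
  case (FAll n \<sigma> \<phi>)
  let ?X = "(r1 \<circ> fst) ` bv (FAll n \<sigma> \<phi>) \<union> (r2 \<circ> fst) ` bv (FAll n \<sigma> \<phi>)
    \<union> fst ` (\<Union>v\<in>fv (FAll n \<sigma> \<phi>). tm_vars (e v))"
  have "finite ?X" by auto
  from ex_new_if_finite[OF infinite_UNIV_nat this] obtain j where j: "j \<notin> ?X" by (elim exE)
  have je: "(j, \<tau>) \<notin> tm_vars (e v)" if "v \<in> fv (FAll n \<sigma> \<phi>)" for v \<tau>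
  proof
    assume "(j, \<tau>) \<in> tm_vars (e v)"
    with that have "(j, \<tau>) \<in> (\<Union>v\<in>fv (FAll n \<sigma> \<phi>). tm_vars (e v))" by blast
    from imageI[OF this, of fst] j show False by simp
  qed
  have jb: "j \<noteq> r1 n" "j \<noteq> r2 n" "\<And>m \<tau>. (m, \<tau>) \<in> bv \<phi> \<Longrightarrow> j \<noteq> r1 m \<and> j \<noteq> r2 m"
    using j by (auto simp: image_iff)
  let ?L = "FAll (r1 n) \<sigma> (nf r1 (e((n, \<sigma>) := Var (r1 n) \<sigma>)) \<phi>)"
  let ?e = "e((n, \<sigma>) := Var j \<sigma>)"
  have wL: "wff ?L" using FAll.prems by (auto simp: wff_nf typed_env_upd)
  have fvL: "(j, \<sigma>) \<notin> fv ?L" "(r2 n, \<sigma>) \<notin> fv ?L"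
  proof -
    have *: "fv ?L \<subseteq> (\<Union>v\<in>fv (FAll n \<sigma> \<phi>). tm_vars (e v))"
      using fv_nf[of r1 e "FAll n \<sigma> \<phi>"] by simp
    show "(j, \<sigma>) \<notin> fv ?L" using je * by blast
    show "(r2 n, \<sigma>) \<notin> fv ?L"
    proof
      assume "(r2 n, \<sigma>) \<in> fv ?L"
      then obtain v where "v \<in> fv (FAll n \<sigma> \<phi>)" "(r2 n, \<sigma>) \<in> tm_vars (e v)" using * by blast
      then show False using FAll.prems(5)[of v "r2 n" \<sigma> n \<sigma>] by auto
    qed
  qed
  have S1: "subst (r1 n, \<sigma>) (Var j \<sigma>) (nf r1 (e((n, \<sigma>) := Var (r1 n) \<sigma>)) \<phi>) = nf r1 ?e \<phi> \<and>
       free_for (Var j \<sigma>) (r1 n, \<sigma>) (nf r1 (e((n, \<sigma>) := Var (r1 n) \<sigma>)) \<phi>)"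
  proof (rule subst_nf)
    show "(r1 n, \<sigma>) \<notin> tm_vars (e u)" if "u \<in> fv \<phi>" "u \<noteq> (n, \<sigma>)" for u
      using FAll.prems(5)[of u "r1 n" \<sigma> n \<sigma>] that by auto
    show "(r1 m, \<tau>) \<notin> tm_vars (Var j \<sigma>)" if "(m, \<tau>) \<in> bv \<phi>" for m \<tau>
      using jb(3)[OF that] by auto
  qed (use FAll.prems in \<open>auto dest: injD\<close>)
  have S2: "subst (j, \<sigma>) (Var (r2 n) \<sigma>) (nf r2 ?e \<phi>) = nf r2 (e((n, \<sigma>) := Var (r2 n) \<sigma>)) \<phi> \<and>
       free_for (Var (r2 n) \<sigma>) (j, \<sigma>) (nf r2 ?e \<phi>)"
  proof (rule subst_nf)
    show "(j, \<sigma>) \<notin> tm_vars (e u)" if "u \<in> fv \<phi>" "u \<noteq> (n, \<sigma>)" for u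
      using je that by auto
    show "(m, \<sigma>) = (n, \<sigma>)" if "(m, \<sigma>) \<in> bv \<phi>" "r2 m = j" for m
      using jb that by force
  qed (use FAll.prems in \<open>auto dest: injD\<close>)
  have "ent A {} (FImp (nf r1 ?e \<phi>) (nf r2 ?e \<phi>))"
  proof (rule FAll.IH)
    fix v k \<tau> m \<rho> assume v: "v \<in> fv \<phi>" "(k, \<tau>) \<in> tm_vars (?e v)" "(m, \<rho>) \<in> bv \<phi>"
    show "k \<noteq> r1 m \<and> k \<noteq> r2 m"
    proof (cases "v = (n, \<sigma>)")
      case True then show ?thesis using v jb by auto
    next
      case False then show ?thesis using v FAll.prems(5)[of v k \<tau> m \<rho>] by auto
    qed
  qed (use FAll.prems in \<open>simp_all add: typed_env_upd del: fun_upd_apply\<close>)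
  then have "ent A {?L} (FImp (nf r1 ?e \<phi>) (nf r2 ?e \<phi>))" by (rule ent_mono) simp
  moreover have "ent A {?L} ?L" by (rule ent.hyp[OF _ wL]) simp
  from ent_allE[OF this, of "Var j \<sigma>"] S1 have "ent A {?L} (nf r1 ?e \<phi>)"
    by (simp del: fun_upd_apply)
  ultimately have "ent A {?L} (nf r2 ?e \<phi>)" by (rule ent.mp)
  then have "ent A {?L} (FAll j \<sigma> (nf r2 ?e \<phi>))" using fvL by (intro ent_gen) auto
  from ent_allE[OF this, of "Var (r2 n) \<sigma>"] S2
  have "ent A {?L} (nf r2 (e((n, \<sigma>) := Var (r2 n) \<sigma>)) \<phi>)" by (simp del: fun_upd_apply)
  then have "ent A {?L} (FAll (r2 n) \<sigma> (nf r2 (e((n, \<sigma>) := Var (r2 n) \<sigma>)) \<phi>))"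
    using fvL by (intro ent_gen) auto
  then show ?case using wL by (simp add: ent_deduction del: wff.simps)
qed (auto intro: ent_imp_refl simp: has_ty_ev)

section \<open>Henkin completeness\<close>

text \<open>Variables with odd index serve as Henkin constants; bound variables are moved to even
  indices, so that no capture can occur.\<close>

abbreviation dbl :: "nat \<Rightarrow> nat" where "dbl \<equiv> (\<lambda>n. 2 * n)"

definition odd_fm :: "fm \<Rightarrow> bool" where
  "odd_fm \<phi> \<longleftrightarrow> wff \<phi> \<and> (\<forall>n \<sigma>. (n, \<sigma>) \<in> fv \<phi> \<longrightarrow> odd n)"

definition elts :: "ty \<Rightarrow> tm set" where
  "elts \<sigma> = {t. has_ty t \<sigma> \<and> (\<forall>n \<tau>. (n, \<tau>) \<in> tm_vars t \<longrightarrow> odd n)}"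

definition odd_env :: "(nat \<times> ty \<Rightarrow> tm) \<Rightarrow> bool" where
  "odd_env e \<longleftrightarrow> (\<forall>n \<sigma>. e (n, \<sigma>) \<in> elts \<sigma>)"

lemma odd_env_upd: "odd_env e \<Longrightarrow> t \<in> elts (snd v) \<Longrightarrow> odd_env (e(v := t))"
  by (auto simp: odd_env_def)

lemma odd_typed_env: "odd_env e \<Longrightarrow> typed_env e"
  by (auto simp: odd_env_def typed_env_def elts_def)

lemma ev_elts: "odd_env e \<Longrightarrow> has_ty t \<sigma> \<Longrightarrow> ev e t \<in> elts \<sigma>"
  unfolding elts_def by (auto simp: has_ty_ev odd_typed_env tm_vars_ev odd_env_def elts_def)

lemma inj_dbl: "inj dbl"
  by (auto intro: injI)

lemma odd_fm_nf: 
  assumes "odd_env e" "wff \<phi>" shows "odd_fm (nf dbl e \<phi>)"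
  unfolding odd_fm_def
proof (intro conjI allI impI)
  fix n \<sigma> assume "(n, \<sigma>) \<in> fv (nf dbl e \<phi>)"
  then obtain k \<tau> where "(n, \<sigma>) \<in> tm_vars (e (k, \<tau>))" using fv_nf by fastforce
  then show "odd n" using assms(1) unfolding odd_env_def elts_def by blast
qed (use assms in \<open>auto simp: wff_nf odd_typed_env\<close>)

section \<open>Maximal consistent sets with witnesses\<close>

definition con :: "fm set \<Rightarrow> fm set \<Rightarrow> bool" where
  "con A S \<longleftrightarrow> \<not> ent A S FBot"

text \<open>Lets a generalisation over the fresh variable \<open>m\<close> be turned back into one
  over the original \<open>n\<close>.\<close>

lemma rename_witness:
  assumes "(m, \<tau>) \<notin> bv \<psi>" "(m, \<tau>) \<notin> fv \<psi>"
  shows "subst (m, \<tau>) (Var n \<tau>) (subst (n, \<tau>) (Var m \<tau>) \<psi>) = \<psi> \<and>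
    free_for (Var n \<tau>) (m, \<tau>) (subst (n, \<tau>) (Var m \<tau>) \<psi>)"
  using assms
proof (induction \<psi>)
  case (FAll k \<rho> \<psi>)
  show ?case
  proof (cases "(k, \<rho>) = (n, \<tau>)")
    case True
    then have "(m, \<tau>) \<notin> fv (FAll k \<rho> \<psi>)" using FAll.prems by simp
    then have "subst (m, \<tau>) (Var n \<tau>) (FAll k \<rho> \<psi>) = FAll k \<rho> \<psi>"
      "free_for (Var n \<tau>) (m, \<tau>) (FAll k \<rho> \<psi>)" by (blast intro: subst_nonfree, simp)
    then show ?thesis using True by simp
  next
    case False
    then show ?thesis using FAll by auto
  qed
next
  case (FEq s t)
  have *: "(m, \<tau>) \<notin> tm_vars u \<Longrightarrow> tm_subst (m, \<tau>) (Var n \<tau>) (tm_subst (n, \<tau>) (Var m \<tau>) u) = u" for u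
    by (induction u) auto
  show ?case using FEq by (simp add: *)
next
  case (FLess s t)
  have *: "(m, \<tau>) \<notin> tm_vars u \<Longrightarrow> tm_subst (m, \<tau>) (Var n \<tau>) (tm_subst (n, \<tau>) (Var m \<tau>) u) = u" for u
    by (induction u) auto
  show ?case using FLess by (simp add: *)
qed auto

text \<open>Otherwise \<open>S\<close> proves the instance with the fresh variable. Generalising and
  renaming back gives \<open>\<psi>\<close>, and the even variable \<open>n\<close> is not free in
  the odd formulas of \<open>S\<close>, so \<open>FAll n \<sigma> \<psi>\<close> follows.\<close>

lemma con_witness:
  assumes "con A S" "FNeg (FAll n \<sigma> \<psi>) \<in> S" "even n" "\<And>\<phi>. \<phi> \<in> S \<Longrightarrow> odd_fm \<phi>"
    "\<And>\<phi>. \<phi> \<in> S \<Longrightarrow> (m, \<sigma>) \<notin> fv \<phi>" "(m, \<sigma>) \<notin> bv \<psi>" "(m, \<sigma>) \<notin> fv \<psi>"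
  shows "con A (insert (FNeg (subst (n, \<sigma>) (Var m \<sigma>) \<psi>)) S)"
  unfolding con_def
proof
  let ?\<psi> = "subst (n, \<sigma>) (Var m \<sigma>) \<psi>"
  have "wff (FNeg (FAll n \<sigma> \<psi>))" using assms(4)[OF assms(2)] by (auto simp: odd_fm_def)
  then have w: "wff ?\<psi>" by (auto simp: wff_subst)
  assume "ent A (insert (FNeg ?\<psi>) S) FBot"
  then have "ent A S ?\<psi>" using w by (rule ent_raa)
  then have "ent A S (FAll m \<sigma> ?\<psi>)" using assms(5) by (intro ent_gen) auto
  from ent_allE[OF this, of "Var n \<sigma>"] rename_witness[OF assms(6,7), of n]
  have "ent A S \<psi>" by simp
  then have "ent A S (FAll n \<sigma> \<psi>)" using assms(3,4) by (intro ent_gen) (auto simp: odd_fm_def)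
  moreover have "ent A S (FNeg (FAll n \<sigma> \<psi>))"
    using assms(2) assms(4)[OF assms(2)] by (intro ent.hyp) (auto simp: odd_fm_def)
  ultimately show False using assms(1) unfolding con_def by (blast intro: ent.mp)
qed

definition fresh_for :: "nat \<Rightarrow> ty \<Rightarrow> fm set \<Rightarrow> fm \<Rightarrow> bool" where
  "fresh_for m \<sigma> S \<psi> \<longleftrightarrow> odd m \<and> (\<forall>\<phi>\<in>S. (m, \<sigma>) \<notin> fv \<phi>) \<and> (m, \<sigma>) \<notin> bv \<psi> \<and> (m, \<sigma>) \<notin> fv \<psi>"

lemma ex_fresh_for:
  assumes "finite S" shows "\<exists>m. fresh_for m \<sigma> S \<psi>"
proof -
  have "infinite {m::nat. odd m}"
    unfolding infinite_iff_countable_subset by (rule exI[of _ "\<lambda>n. 2 * n + 1"]) (auto intro: injI)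
  moreover have "finite (fst ` ((\<Union>\<phi>\<in>S. fv \<phi>) \<union> bv \<psi> \<union> fv \<psi>))" using assms by auto
  ultimately have "\<not> {m. odd m} \<subseteq> fst ` ((\<Union>\<phi>\<in>S. fv \<phi>) \<union> bv \<psi> \<union> fv \<psi>)"
    using finite_subset by blast
  then obtain m where "odd m" "m \<notin> fst ` ((\<Union>\<phi>\<in>S. fv \<phi>) \<union> bv \<psi> \<union> fv \<psi>)" by blast
  then show ?thesis unfolding fresh_for_def by (force simp: image_iff)
qed

text \<open>Evenness of \<open>n\<close> matches the images under \<open>nf dbl\<close>, whose bound
  indices are all even; the witness itself has an odd index.\<close>

fun witness :: "fm set \<Rightarrow> fm \<Rightarrow> fm set" where
  "witness S (FImp (FAll n \<sigma> \<psi>) FBot) =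
    (if even n then {FNeg (subst (n, \<sigma>) (Var (SOME m. fresh_for m \<sigma> S \<psi>) \<sigma>) \<psi>)} else {})"
| "witness S _ = {}"

lemma finite_witness [simp]: "finite (witness S \<phi>)"
  by (cases "(S, \<phi>)" rule: witness.cases) auto

fun extend :: "fm set \<Rightarrow> fm set \<Rightarrow> nat \<Rightarrow> fm set" where
  "extend A S 0 = S"
| "extend A S (Suc i) = (let S' = extend A S i; \<phi> = from_nat i in
     if odd_fm \<phi> \<and> con A (insert \<phi> S') then witness (insert \<phi> S') \<phi> \<union> insert \<phi> S' else S')"

lemma extend_props:
  assumes "finite S" "con A S" "\<And>\<phi>. \<phi> \<in> S \<Longrightarrow> odd_fm \<phi>"
  shows "finite (extend A S i) \<and> con A (extend A S i) \<and> (\<forall>\<phi>\<in>extend A S i. odd_fm \<phi>)"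
proof (induction i)
  case (Suc i)
  let ?S = "extend A S i" and ?\<phi> = "from_nat i :: fm"
  show ?case
  proof (cases "odd_fm ?\<phi> \<and> con A (insert ?\<phi> ?S)")
    case True
    have fin: "finite (insert ?\<phi> ?S)" and o: "\<And>\<phi>. \<phi> \<in> insert ?\<phi> ?S \<Longrightarrow> odd_fm \<phi>"
      using Suc True by auto
    have "con A (witness (insert ?\<phi> ?S) ?\<phi> \<union> insert ?\<phi> ?S) \<and>
      (\<forall>\<phi>\<in>witness (insert ?\<phi> ?S) ?\<phi>. odd_fm \<phi>)"
    proof (cases "\<exists>n \<sigma> \<psi>. ?\<phi> = FNeg (FAll n \<sigma> \<psi>) \<and> even n")
      case w: True
      then obtain n \<sigma> \<psi> where \<phi>: "?\<phi> = FNeg (FAll n \<sigma> \<psi>)" "even n" by blast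
      define m where "m = (SOME m. fresh_for m \<sigma> (insert ?\<phi> ?S) \<psi>)"
      have m: "fresh_for m \<sigma> (insert ?\<phi> ?S) \<psi>"
        unfolding m_def by (rule someI_ex) (rule ex_fresh_for[OF fin])
      have "witness (insert ?\<phi> ?S) ?\<phi> = {FNeg (subst (n, \<sigma>) (Var m \<sigma>) \<psi>)}"
        using \<phi> by (simp add: m_def)
      moreover have "con A (insert (FNeg (subst (n, \<sigma>) (Var m \<sigma>) \<psi>)) (insert ?\<phi> ?S))"
        by (rule con_witness) (use \<phi> m True o in \<open>auto simp: fresh_for_def\<close>)
      moreover have "odd_fm (FNeg (subst (n, \<sigma>) (Var m \<sigma>) \<psi>))"
      proof -
        have "fv (subst (n, \<sigma>) (Var m \<sigma>) \<psi>) \<subseteq> (fv \<psi> - {(n, \<sigma>)}) \<union> {(m, \<sigma>)}" for \<psi>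
        proof (induction \<psi>)
          have *: "tm_vars (tm_subst (n, \<sigma>) (Var m \<sigma>) t) \<subseteq> (tm_vars t - {(n, \<sigma>)}) \<union> {(m, \<sigma>)}" for t
            by (induction t) auto
          case (FEq s t) then show ?case using *[of s] *[of t] by auto
        next
          have *: "tm_vars (tm_subst (n, \<sigma>) (Var m \<sigma>) t) \<subseteq> (tm_vars t - {(n, \<sigma>)}) \<union> {(m, \<sigma>)}" for t
            by (induction t) auto
          case (FLess s t) then show ?case using *[of s] *[of t] by auto
        qed auto
        from this[of \<psi>] m o[of ?\<phi>] show ?thesis
          unfolding \<phi> odd_fm_def fresh_for_def by (auto simp: wff_subst)
      qed
      ultimately show ?thesis by (simp add: insert_commute)
    next
      case False
      then have "witness (insert ?\<phi> ?S) ?\<phi> = {}"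
        by (cases "(insert ?\<phi> ?S, ?\<phi>)" rule: witness.cases) auto
      then show ?thesis using True by simp
    qed
    then show ?thesis using True fin o by (auto simp: Let_def)
  next
    case False
    then show ?thesis using Suc by (auto simp: Let_def)
  qed
qed (use assms in auto)

lemma extend_mono: "i \<le> j \<Longrightarrow> extend A S i \<subseteq> extend A S j"
  by (rule lift_Suc_mono_le[of "extend A S"]) (auto simp: Let_def)

locale henkin =
  fixes A T :: "fm set"
  assumes odd_T: "\<phi> \<in> T \<Longrightarrow> odd_fm \<phi>"
    and closed_T: "ent A T \<phi> \<Longrightarrow> odd_fm \<phi> \<Longrightarrow> \<phi> \<in> T"
    and con_T: "FBot \<notin> T"
    and complete_T: "odd_fm \<phi> \<Longrightarrow> \<phi> \<notin> T \<Longrightarrow> FNeg \<phi> \<in> T"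
    and witness_T: "FNeg (FAll n \<sigma> \<psi>) \<in> T \<Longrightarrow> even n \<Longrightarrow>
      \<exists>m. odd m \<and> FNeg (subst (n, \<sigma>) (Var m \<sigma>) \<psi>) \<in> T"

lemma ex_henkin:
  assumes "finite S" "con A S" "\<And>\<phi>. \<phi> \<in> S \<Longrightarrow> odd_fm \<phi>"
  shows "\<exists>T. henkin A T \<and> S \<subseteq> T"
proof -
  define T where "T = (\<Union>i. extend A S i)"
  note props = extend_props[OF assms]
  \<comment> \<open>A derivation from the union uses finitely many hypotheses, so it is a derivation
    from some stage.\<close>
  have fin: "ent A T \<phi> \<Longrightarrow> \<exists>i. ent A (extend A S i) \<phi>" for \<phi>
  proof (induction rule: ent.induct)
    case (mp \<phi> \<psi>)
    then obtain i j where "ent A (extend A S i) (FImp \<phi> \<psi>)" "ent A (extend A S j) \<phi>" by blast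
    then have "ent A (extend A S (max i j)) (FImp \<phi> \<psi>)" "ent A (extend A S (max i j)) \<phi>"
      by (auto elim!: ent_mono intro!: extend_mono)
    then show ?case by (blast intro: ent.mp)
  qed (auto simp: T_def intro: ent.prv ent.hyp)
  then have conT: "con A T" using props unfolding con_def by blast
  have max: "\<phi> \<in> T" if "odd_fm \<phi>" "con A (insert \<phi> T)" for \<phi>
  proof -
    have "con A (insert \<phi> (extend A S (to_nat \<phi>)))"
      using that(2) ent_mono[of A "insert \<phi> (extend A S (to_nat \<phi>))" FBot "insert \<phi> T"]
      unfolding con_def T_def by blast
    then have "\<phi> \<in> extend A S (Suc (to_nat \<phi>))" using that(1) by (simp add: Let_def)
    then show ?thesis unfolding T_def by blast
  qed
  have clo: "\<phi> \<in> T" if "ent A T \<phi>" "odd_fm \<phi>" for \<phi>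
  proof (rule max)
    show "con A (insert \<phi> T)" unfolding con_def
    proof
      assume "ent A (insert \<phi> T) FBot"
      then have "ent A T (FNeg \<phi>)" using that(2) by (intro ent_deduction) (auto simp: odd_fm_def)
      then show False using that(1) conT unfolding con_def by (blast intro: ent.mp)
    qed
  qed fact
  have "henkin A T"
  proof
    show "odd_fm \<phi>" if "\<phi> \<in> T" for \<phi> using that props unfolding T_def by blast
    show "FBot \<notin> T" using conT unfolding con_def by (auto intro: ent.hyp)
    show "FNeg \<phi> \<in> T" if "odd_fm \<phi>" "\<phi> \<notin> T" for \<phi>
    proof (rule clo)
      have "ent A (insert \<phi> T) FBot" using that max unfolding con_def by blast
      then show "ent A T (FNeg \<phi>)" using that by (intro ent_deduction) (auto simp: odd_fm_def)
      show "odd_fm (FNeg \<phi>)" using that by (auto simp: odd_fm_def)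
    qed
    show "\<exists>m. odd m \<and> FNeg (subst (n, \<sigma>) (Var m \<sigma>) \<psi>) \<in> T"
      if T: "FNeg (FAll n \<sigma> \<psi>) \<in> T" and "even n" for n \<sigma> \<psi>
    proof -
      let ?\<phi> = "FNeg (FAll n \<sigma> \<psi>)" let ?S = "extend A S (to_nat ?\<phi>)"
      have o: "odd_fm ?\<phi>" using T props unfolding T_def by blast
      have "con A (insert ?\<phi> ?S)"
        using conT T ent_mono[of A "insert ?\<phi> ?S" FBot T]
        unfolding con_def T_def by blast
      then have "witness (insert ?\<phi> ?S) ?\<phi> \<subseteq> extend A S (Suc (to_nat ?\<phi>))"
        using o by (auto simp: Let_def)
      moreover define m where "m = (SOME m. fresh_for m \<sigma> (insert ?\<phi> ?S) \<psi>)"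
      moreover have "fresh_for m \<sigma> (insert ?\<phi> ?S) \<psi>"
        unfolding m_def by (rule someI_ex) (rule ex_fresh_for, use props in auto)
      ultimately have "odd m" "FNeg (subst (n, \<sigma>) (Var m \<sigma>) \<psi>) \<in> extend A S (Suc (to_nat ?\<phi>))"
        using \<open>even n\<close> by (auto simp: fresh_for_def simp del: extend.simps)
      then show ?thesis unfolding T_def by blast
    qed
  qed (use clo in auto)
  moreover have "S \<subseteq> T" unfolding T_def using extend.simps(1) by blast
  ultimately show ?thesis by blast
qed

section \<open>Truth in the term model\<close>

fun sat :: "fm set \<Rightarrow> (nat \<times> ty \<Rightarrow> tm) \<Rightarrow> fm \<Rightarrow> bool" where
  "sat T e (FEq s t) \<longleftrightarrow> FEq (ev e s) (ev e t) \<in> T"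
| "sat T e (FLess s t) \<longleftrightarrow> FLess (ev e s) (ev e t) \<in> T"
| "sat T e FBot \<longleftrightarrow> False"
| "sat T e (FImp \<phi> \<psi>) \<longleftrightarrow> (sat T e \<phi> \<longrightarrow> sat T e \<psi>)"
| "sat T e (FAll n \<sigma> \<phi>) \<longleftrightarrow> (\<forall>a\<in>elts \<sigma>. sat T (e((n, \<sigma>) := a)) \<phi>)"

context henkin
begin

lemma imp_T:
  assumes "odd_fm \<phi>" "odd_fm \<psi>"
  shows "FImp \<phi> \<psi> \<in> T \<longleftrightarrow> (\<phi> \<in> T \<longrightarrow> \<psi> \<in> T)"
proof -
  have w: "wff \<phi>" "wff \<psi>" "odd_fm (FImp \<phi> \<psi>)" using assms by (auto simp: odd_fm_def)
  have "\<psi> \<in> T" if "FImp \<phi> \<psi> \<in> T" "\<phi> \<in> T"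
    by (rule closed_T[OF ent.mp[of _ _ \<phi>]]) (use that w assms in \<open>auto intro: ent.hyp\<close>)
  moreover have "FImp \<phi> \<psi> \<in> T" if "\<psi> \<in> T"
    by (rule closed_T[OF ent_deduction]) (use that w in \<open>auto intro: ent.hyp\<close>)
  moreover have "FImp \<phi> \<psi> \<in> T" if "\<phi> \<notin> T"
  proof (rule closed_T[OF ent_deduction])
    let ?S = "insert (FNeg \<psi>) (insert \<phi> T)"
    have "FNeg \<phi> \<in> T" using complete_T that assms by blast
    then have "ent A ?S (FNeg \<phi>)" "ent A ?S \<phi>" using w by (auto intro: ent.hyp)
    then have "ent A ?S FBot" by (rule ent.mp)
    then show "ent A (insert \<phi> T) \<psi>" by (rule ent_raa) (use w in auto)
  qed (use w in auto)
  ultimately show ?thesis by blast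
qed

text \<open>Elements contain odd variables only and \<open>nf dbl\<close> binds even ones, so
  inserting an element into the body never captures. Maximality turns a missing universal formula
  into its negation, and \<open>witness_T\<close> supplies an element refuting it.\<close>

lemma truth:
  assumes "wff \<phi>" "odd_env e"
  shows "sat T e \<phi> \<longleftrightarrow> nf dbl e \<phi> \<in> T"
  using assms
proof (induction \<phi> arbitrary: e)
  case FBot then show ?case using con_T by simp
next
  case (FImp \<phi> \<psi>) then show ?case by (simp add: imp_T odd_fm_nf)
next
  case (FAll n \<sigma> \<phi>)
  let ?B = "nf dbl (e((n, \<sigma>) := Var (2 * n) \<sigma>)) \<phi>"
  have B: "odd_fm (FAll (2 * n) \<sigma> ?B)" using odd_fm_nf[OF FAll.prems(2,1)] by simp
  have S: "subst (2 * n, \<sigma>) t ?B = nf dbl (e((n, \<sigma>) := t)) \<phi> \<and> free_for t (2 * n, \<sigma>) ?B"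
    if "t \<in> elts \<sigma>" for t
  proof (rule subst_nf[OF inj_dbl])
    show "(2 * n, \<sigma>) \<notin> tm_vars (e u)" for u
    proof
      assume "(2 * n, \<sigma>) \<in> tm_vars (e u)"
      moreover have "e u \<in> elts (snd u)" using FAll.prems(2) by (cases u) (simp add: odd_env_def)
      ultimately have "odd (2 * n)" unfolding elts_def by blast
      then show False by simp
    qed
  qed (use that in \<open>auto simp: elts_def\<close>)
  have *: "sat T (e((n, \<sigma>) := t)) \<phi> \<longleftrightarrow> subst (2 * n, \<sigma>) t ?B \<in> T" if "t \<in> elts \<sigma>" for t
    using FAll S[OF that] that by (simp add: odd_env_upd)
  show ?case
  proof
    assume L: "sat T e (FAll n \<sigma> \<phi>)"
    show "nf dbl e (FAll n \<sigma> \<phi>) \<in> T"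
    proof (rule ccontr)
      assume "nf dbl e (FAll n \<sigma> \<phi>) \<notin> T"
      then have "FNeg (FAll (2 * n) \<sigma> ?B) \<in> T" using complete_T B by simp
      then obtain m where m: "odd m" "FNeg (subst (2 * n, \<sigma>) (Var m \<sigma>) ?B) \<in> T"
        using witness_T by (metis dvd_triv_left)
      then have d: "Var m \<sigma> \<in> elts \<sigma>" by (auto simp: elts_def)
      then have "subst (2 * n, \<sigma>) (Var m \<sigma>) ?B \<in> T" using L *[OF d] by simp
      then show False using m imp_T[of "subst (2 * n, \<sigma>) (Var m \<sigma>) ?B" FBot] con_T odd_T
        by (auto simp: odd_fm_def)
    qed
  next
    assume "nf dbl e (FAll n \<sigma> \<phi>) \<in> T"
    then have R: "FAll (2 * n) \<sigma> ?B \<in> T" by simp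
    show "sat T e (FAll n \<sigma> \<phi>)"
      unfolding sat.simps
    proof
      fix a assume a: "a \<in> elts \<sigma>"
      have "subst (2 * n, \<sigma>) a ?B \<in> T"
      proof (rule closed_T[OF ent_allE])
        show "ent A T (FAll (2 * n) \<sigma> ?B)" using R B by (intro ent.hyp) (auto simp: odd_fm_def)
        show "odd_fm (subst (2 * n, \<sigma>) a ?B)"
          using S[OF a] FAll.prems a by (simp add: odd_fm_nf odd_env_upd)
      qed (use S[OF a] a in \<open>auto simp: elts_def\<close>)
      then show "sat T (e((n, \<sigma>) := a)) \<phi>" using *[OF a] by simp
    qed
  qed
qed auto

text \<open>A derivable sentence may bind odd indices, so \<open>alpha\<close> first moves its
  binders to even ones. The environment does not affect a sentence.\<close>

lemma sat_closed:
  assumes "derives A [] \<phi>" "fv \<phi> = {}" "odd_env e"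
  shows "sat T e \<phi>"
proof -
  have w: "wff \<phi>" using assms derives_wff by blast
  have "ent A {} (FImp (nf id id_env \<phi>) (nf dbl id_env \<phi>))"
    by (rule alpha) (use w assms inj_dbl in auto)
  then have "ent A {} (nf dbl id_env \<phi>)" using assms by (auto intro: ent.mp ent.prv)
  then have "ent A T (nf dbl e \<phi>)" using nf_cong[of \<phi> id_env e dbl] assms by (auto intro: ent_mono)
  then have "nf dbl e \<phi> \<in> T" using w assms(3) by (intro closed_T odd_fm_nf)
  then show ?thesis using truth[OF w assms(3)] by blast
qed

text \<open>For schemata with parameters: the formula obtained by renaming the binders and inserting
  elements for the parameters has to be an axiom again.\<close>

lemma sat_schema:
  assumes "nf dbl e \<phi> \<in> A" "wff \<phi>" "odd_env e"
  shows "sat T e \<phi>"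
proof -
  have "odd_fm (nf dbl e \<phi>)" using assms by (simp add: odd_fm_nf)
  then have "nf dbl e \<phi> \<in> T"
    using assms(1) by (intro closed_T ent.prv derives.Axiom) (auto simp: odd_fm_def)
  then show ?thesis using truth[OF assms(2,3)] by blast
qed

end

lemma completeness:
  assumes "wff \<phi>" "fv \<phi> = {}" "\<not> derives A [] \<phi>"
  shows "\<exists>T. henkin A T \<and> (\<forall>e. odd_env e \<longrightarrow> \<not> sat T e \<phi>)"
proof -
  define e0 where "e0 = (\<lambda>(n::nat, \<sigma>). Var 1 \<sigma>)"
  have e0: "odd_env e0" by (auto simp: odd_env_def elts_def e0_def)
  have nfeq: "nf dbl e \<phi> = nf dbl e0 \<phi>" for e using assms by (intro nf_cong) auto
  have o: "odd_fm (FNeg (nf dbl e0 \<phi>))" using odd_fm_nf[OF e0 assms(1)] by (auto simp: odd_fm_def)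
  have "con A {FNeg (nf dbl e0 \<phi>)}" unfolding con_def
  proof
    assume "ent A {FNeg (nf dbl e0 \<phi>)} FBot"
    then have "ent A {} (nf dbl id_env \<phi>)" unfolding nfeq[of id_env]
      by (rule ent_raa) (use o in \<open>auto simp: odd_fm_def\<close>)
    moreover have "ent A {} (FImp (nf dbl id_env \<phi>) (nf id id_env \<phi>))"
      by (rule alpha) (use assms inj_dbl in auto)
    ultimately have "ent A {} \<phi>" by (auto intro: ent.mp)
    then show False using assms ent_empty by blast
  qed
  then have "\<exists>T. henkin A T \<and> {FNeg (nf dbl e0 \<phi>)} \<subseteq> T"
    by (rule ex_henkin[rotated]) (use o in auto)
  then obtain T where T: "henkin A T" "FNeg (nf dbl e0 \<phi>) \<in> T" by blast
  interpret henkin A T by fact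
  have "\<not> sat T e \<phi>" if "odd_env e" for e
    using T(2) truth[OF _ that, of "FNeg \<phi>"] assms(1) nfeq[of e] by simp
  then show ?thesis using T by blast
qed

section \<open>The axioms hold in Henkin models\<close>

lemmas scheme_defs = s_eq_def s_less_def s_imp_def s_neg_def s_conj_def s_disj_def s_iff_def
  s_all_def s_ex_def s_all0_def s_all1_def s_ex0_def s_ex1_def sentence_def

lemma elts_App [intro, simp]: "s \<in> elts (\<sigma> \<^bold>\<rightarrow> \<tau>) \<Longrightarrow> t \<in> elts \<sigma> \<Longrightarrow> s \<^bold>\<cdot> t \<in> elts \<tau>"
  by (auto simp: elts_def has_ty_App)

lemma elts_Cst: "cst_ty c = \<sigma> \<Longrightarrow> Cst c \<in> elts \<sigma>"
  by (auto simp: elts_def)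

lemma elts_ops [simp]:
  "\<^bold>0 \<in> elts T0" "\<^bold>1 \<in> elts T0" "Cst Plus \<in> elts (T0 \<^bold>\<rightarrow> T0 \<^bold>\<rightarrow> T0)" "Cst Times \<in> elts (T0 \<^bold>\<rightarrow> T0 \<^bold>\<rightarrow> T0)"
  "Cst (Comb_K \<sigma> \<tau>) \<in> elts (\<sigma> \<^bold>\<rightarrow> \<tau> \<^bold>\<rightarrow> \<sigma>)" "Cst R0 \<in> elts ((T0 \<^bold>\<rightarrow> T0 \<^bold>\<rightarrow> T0) \<^bold>\<rightarrow> T0 \<^bold>\<rightarrow> T0 \<^bold>\<rightarrow> T0)"
  "Cst (Comb_S \<rho> \<sigma> \<tau>) \<in> elts ((\<rho> \<^bold>\<rightarrow> \<sigma> \<^bold>\<rightarrow> \<tau>) \<^bold>\<rightarrow> (\<rho> \<^bold>\<rightarrow> \<sigma>) \<^bold>\<rightarrow> \<rho> \<^bold>\<rightarrow> \<tau>)"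
  by (auto intro: elts_Cst)

lemma elts_plus [simp]: "s \<in> elts T0 \<Longrightarrow> t \<in> elts T0 \<Longrightarrow> s \<^bold>+ t \<in> elts T0"
  and elts_times [simp]: "s \<in> elts T0 \<Longrightarrow> t \<in> elts T0 \<Longrightarrow> s \<^bold>* t \<in> elts T0"
  by (rule elts_App[OF elts_App]; simp)+

lemma has_ty_plus [simp]: "has_ty (s \<^bold>+ t) \<tau> \<longleftrightarrow> \<tau> = T0 \<and> has_ty s T0 \<and> has_ty t T0"
  and has_ty_times [simp]: "has_ty (s \<^bold>* t) \<tau> \<longleftrightarrow> \<tau> = T0 \<and> has_ty s T0 \<and> has_ty t T0"
  by (auto simp: has_ty_App)

lemma wff_eq_at: "has_ty s \<sigma> \<Longrightarrow> has_ty t \<sigma> \<Longrightarrow> wff (eq_at \<sigma> s t n)"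
  by (induction \<sigma> arbitrary: s t n) (auto simp: scheme_defs has_ty_App)

lemma fv_eq_at: "fv (eq_at \<sigma> s t n) \<subseteq> tm_vars s \<union> tm_vars t"
proof (induction \<sigma> arbitrary: s t n)
  case (Arr \<sigma> \<tau>)
  show ?case using Arr(2)[of "s \<^bold>\<cdot> Var n \<sigma>" "t \<^bold>\<cdot> Var n \<sigma>" "Suc n"] by (auto simp: scheme_defs)
qed (auto simp: scheme_defs)

definition closed_ax :: "fm set" where
  "closed_ax = insert exists2 (equality_axioms \<union> semiring_axioms
     \<union> {K_axiom \<sigma> \<tau> | \<sigma> \<tau>. True} \<union> {S_axiom \<rho> \<sigma> \<tau> | \<rho> \<sigma> \<tau>. True} \<union> R0_axioms
     \<union> {ext_axiom \<rho> \<tau> | \<rho> \<tau>. True})"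

lemma ACA0_omega_split: "ACA0_omega = closed_ax \<union> QF_IND \<union> QF_AC T1 T0"
  by (auto simp: ACA0_omega_def RCA0_omega_def closed_ax_def)

lemma equality_axioms_closed: "\<phi> \<in> equality_axioms \<Longrightarrow> wff \<phi> \<and> fv \<phi> = {}"
  by (auto simp: equality_axioms_def scheme_defs)

lemma semiring_axioms_closed: "\<phi> \<in> semiring_axioms \<Longrightarrow> wff \<phi> \<and> fv \<phi> = {}"
  unfolding semiring_axioms_def image_insert image_empty by (elim insertE emptyE) (auto simp: scheme_defs)

lemma R0_axioms_closed: "\<phi> \<in> R0_axioms \<Longrightarrow> wff \<phi> \<and> fv \<phi> = {}"
  by (auto simp: R0_axioms_def scheme_defs has_ty_App)

lemma exists2_closed: "wff exists2 \<and> fv exists2 = {}"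
  by (auto simp: exists2_def scheme_defs has_ty_App)

lemma K_axiom_closed: "wff (K_axiom \<sigma> \<tau>) \<and> fv (K_axiom \<sigma> \<tau>) = {}"
  using fv_eq_at[of \<sigma> "Cst (Comb_K \<sigma> \<tau>) \<^bold>\<cdot> Var 0 \<sigma> \<^bold>\<cdot> Var 1 \<tau>" "Var 0 \<sigma>" 2]
  by (auto simp: K_axiom_def scheme_defs has_ty_App numeral_2_eq_2 intro!: wff_eq_at)

lemma S_axiom_closed: "wff (S_axiom \<rho> \<sigma> \<tau>) \<and> fv (S_axiom \<rho> \<sigma> \<tau>) = {}"
  using fv_eq_at[of \<tau> "Cst (Comb_S \<rho> \<sigma> \<tau>) \<^bold>\<cdot> Var 0 (\<rho> \<^bold>\<rightarrow> \<sigma> \<^bold>\<rightarrow> \<tau>) \<^bold>\<cdot> Var (Suc 0) (\<rho> \<^bold>\<rightarrow> \<sigma>) \<^bold>\<cdot> Var (Suc (Suc 0)) \<rho>"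
     "Var 0 (\<rho> \<^bold>\<rightarrow> \<sigma> \<^bold>\<rightarrow> \<tau>) \<^bold>\<cdot> Var (Suc (Suc 0)) \<rho> \<^bold>\<cdot> (Var (Suc 0) (\<rho> \<^bold>\<rightarrow> \<sigma>) \<^bold>\<cdot> Var (Suc (Suc 0)) \<rho>)" "Suc (Suc (Suc 0))"]
  by (auto simp: S_axiom_def scheme_defs has_ty_App intro!: wff_eq_at)

lemma ext_axiom_closed: "wff (ext_axiom \<rho> \<tau>) \<and> fv (ext_axiom \<rho> \<tau>) = {}"
  using fv_eq_at[of \<rho> "Var 0 \<rho>" "Var (Suc 0) \<rho>" "Suc (Suc (Suc 0))"]
    fv_eq_at[of \<tau> "Var (Suc (Suc 0)) (\<rho> \<^bold>\<rightarrow> \<tau>) \<^bold>\<cdot> Var 0 \<rho>" "Var (Suc (Suc 0)) (\<rho> \<^bold>\<rightarrow> \<tau>) \<^bold>\<cdot> Var (Suc 0) \<rho>" "Suc (Suc (Suc 0))"]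
  by (auto simp: ext_axiom_def scheme_defs has_ty_App intro!: wff_eq_at)

lemma closed_ax_closed: "\<phi> \<in> closed_ax \<Longrightarrow> wff \<phi> \<and> fv \<phi> = {}"
  unfolding closed_ax_def using equality_axioms_closed semiring_axioms_closed R0_axioms_closed
    exists2_closed K_axiom_closed S_axiom_closed ext_axiom_closed by blast

lemma ev_tm_subst: "ev e (tm_subst v t s) = ev (e(v := ev e t)) s"
  by (induction s) auto

lemma nf_subst_qf: "qf \<phi> \<Longrightarrow> nf r e (subst v t \<phi>) = nf r (e(v := ev e t)) \<phi>"
  by (induction \<phi>) (auto simp: ev_tm_subst simp del: fun_upd_apply)

lemma bv_qf: "qf \<phi> \<Longrightarrow> bv \<phi> = {}"
  by (induction \<phi>) auto

lemma qf_nf: "qf \<phi> \<Longrightarrow> qf (nf r e \<phi>)"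
  by (induction \<phi> arbitrary: e) auto

lemma subst_nf_qf:
  assumes "qf \<phi>" "\<And>u. u \<noteq> (x, \<sigma>) \<Longrightarrow> (2 * x, \<sigma>) \<notin> tm_vars (e u)"
  shows "subst (2 * x, \<sigma>) t (nf dbl (e((x, \<sigma>) := Var (2 * x) \<sigma>)) \<phi>) = nf dbl (e((x, \<sigma>) := t)) \<phi>"
  by (rule conjunct1[OF subst_nf[OF inj_dbl]]) (use assms in \<open>simp_all add: bv_qf\<close>)

lemma odd_env_even: "odd_env e \<Longrightarrow> (2 * x, \<sigma>) \<notin> tm_vars (e u)"
proof
  assume "odd_env e" "(2 * x, \<sigma>) \<in> tm_vars (e u)"
  moreover from this have "e u \<in> elts (snd u)" by (cases u) (simp add: odd_env_def)
  ultimately have "odd (2 * x)" unfolding elts_def by blast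
  then show False by simp
qed

text \<open>The schema is closed under renaming of binders and insertion of elements, as
  \<open>sat_schema\<close> demands; \<open>QF_AC_nf\<close> does the same for choice.\<close>

lemma QF_IND_nf:
  assumes "\<phi> \<in> QF_IND" "odd_env e"
  shows "wff \<phi> \<and> nf dbl e \<phi> \<in> QF_IND"
proof -
  obtain x \<psi> where \<phi>: "\<phi> = induction_axiom x \<psi>" "qf \<psi>" "wff \<psi>" using assms unfolding QF_IND_def by blast
  let ?e = "e((x, T0) := Var (2 * x) T0)"
  have "nf dbl e \<phi> = induction_axiom (2 * x) (nf dbl ?e \<psi>)"
    unfolding \<phi> induction_axiom_def using subst_nf_qf[OF \<phi>(2), of x T0 e] odd_env_even[OF assms(2)] \<phi>(2)
    by (simp add: nf_subst_qf del: fun_upd_apply) simp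
  moreover have "qf (nf dbl ?e \<psi>)" "wff (nf dbl ?e \<psi>)"
    using \<phi> assms by (auto intro!: qf_nf wff_nf typed_env_upd simp: odd_typed_env simp del: fun_upd_apply)
  moreover have "wff \<phi>" using \<phi> by (auto simp: induction_axiom_def wff_subst)
  ultimately show ?thesis unfolding QF_IND_def by blast
qed

text \<open>Ensures in \<open>QF_AC_nf\<close> that the choice function is a different variable from
  its argument and its value, even if the indices coincide.\<close>

lemma ty_neq_Arr [simp]: "\<sigma> \<noteq> \<sigma> \<^bold>\<rightarrow> \<tau>" "\<tau> \<noteq> \<sigma> \<^bold>\<rightarrow> \<tau>" "\<sigma> \<^bold>\<rightarrow> \<tau> \<noteq> \<sigma>" "\<sigma> \<^bold>\<rightarrow> \<tau> \<noteq> \<tau>"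
  by (auto dest: arg_cong[of _ _ size])

lemma QF_AC_nf:
  assumes "\<phi> \<in> QF_AC \<sigma> \<tau>" "odd_env e"
  shows "wff \<phi> \<and> nf dbl e \<phi> \<in> QF_AC \<sigma> \<tau>"
proof -
  obtain x y Y \<psi> where \<phi>: "\<phi> = choice_axiom \<sigma> \<tau> x y Y \<psi>" "qf \<psi>" "wff \<psi>" "(x, \<sigma>) \<noteq> (y, \<tau>)"
    "(Y, \<sigma> \<^bold>\<rightarrow> \<tau>) \<notin> fv \<psi>" using assms unfolding QF_AC_def by blast
  let ?Y = "(Y, \<sigma> \<^bold>\<rightarrow> \<tau>)"
  let ?e = "e((x, \<sigma>) := Var (2 * x) \<sigma>)"
  let ?\<psi> = "nf dbl (?e((y, \<tau>) := Var (2 * y) \<tau>)) \<psi>"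
  let ?t = "Var (2 * Y) (\<sigma> \<^bold>\<rightarrow> \<tau>) \<^bold>\<cdot> Var (2 * x) \<sigma>"
  have "nf dbl ((e(?Y := Var (2 * Y) (\<sigma> \<^bold>\<rightarrow> \<tau>)))((x, \<sigma>) := Var (2 * x) \<sigma>, (y, \<tau>) := ?t)) \<psi>
     = nf dbl (?e((y, \<tau>) := ?t)) \<psi>"
    by (rule nf_cong) (use \<phi>(5) in auto)
  moreover have "subst (2 * y, \<tau>) ?t ?\<psi> = nf dbl (?e((y, \<tau>) := ?t)) \<psi>"
    by (rule subst_nf_qf[OF \<phi>(2)]) (use odd_env_even[OF assms(2)] \<phi>(4) in auto)
  ultimately have "nf dbl e \<phi> = choice_axiom \<sigma> \<tau> (2 * x) (2 * y) (2 * Y) ?\<psi>"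
    unfolding \<phi> choice_axiom_def using \<phi>(2) by (simp add: nf_subst_qf del: fun_upd_apply) (simp add: fun_upd_def)
  moreover have "qf ?\<psi>" "wff ?\<psi>"
    using \<phi> assms by (auto intro!: qf_nf wff_nf typed_env_upd simp: odd_typed_env simp del: fun_upd_apply)
  moreover have "wff \<phi>" using \<phi> by (auto simp: choice_axiom_def wff_subst has_ty_App)
  moreover have "(2 * x, \<sigma>) \<noteq> (2 * y, \<tau>)" using \<phi>(4) by auto
  moreover have "(2 * Y, \<sigma> \<^bold>\<rightarrow> \<tau>) \<notin> fv ?\<psi>"
  proof
    assume "(2 * Y, \<sigma> \<^bold>\<rightarrow> \<tau>) \<in> fv ?\<psi>"
    then obtain u where "(2 * Y, \<sigma> \<^bold>\<rightarrow> \<tau>) \<in> tm_vars ((?e((y, \<tau>) := Var (2 * y) \<tau>)) u)"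
      using fv_nf by blast
    then show False using odd_env_even[OF assms(2)] by (auto split: if_splits)
  qed
  ultimately show ?thesis unfolding QF_AC_def by blast
qed

lemma (in henkin) sat_ax:
  assumes "A = ACA0_omega" "\<phi> \<in> A" "odd_env e"
  shows "sat T e \<phi>"
proof -
  consider "\<phi> \<in> closed_ax" | "\<phi> \<in> QF_IND" | "\<phi> \<in> QF_AC T1 T0" using assms ACA0_omega_split by auto
  then show ?thesis
  proof cases
    case 1
    then show ?thesis using closed_ax_closed[OF 1] assms by (intro sat_closed derives.Axiom) auto
  next
    case 2
    then show ?thesis using QF_IND_nf[OF 2 assms(3)] assms ACA0_omega_split by (intro sat_schema) auto
  next
    case 3
    then show ?thesis using QF_AC_nf[OF 3 assms(3)] assms ACA0_omega_split by (intro sat_schema) auto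
  qed
qed

section \<open>The numbers of a countermodel as a type\<close>

definition counter :: "fm set \<Rightarrow> bool" where
  "counter T \<longleftrightarrow> henkin ACA0_omega T \<and> (\<forall>e. odd_env e \<longrightarrow> sat T e (sentence usc_baire1) \<and>
     \<not> (sat T e (sentence BCT) \<and> sat T e (sentence open_RM)))"

text \<open>Fixed once and for all, since the type of numbers defined below cannot depend on a local
  assumption. Whether a countermodel was really found is recorded by \<open>mdl\<close>.\<close>

definition TM :: "fm set" where "TM = (SOME T. counter T)"

definition mdl :: bool where "mdl \<longleftrightarrow> counter TM"

text \<open>Terms that are equal in the model need not be identical. The least number of a term in
  the class is a canonical name of the class, so the carrier becomes a set of natural
  numbers.\<close>

definition code :: "tm \<Rightarrow> nat" where
  "code t = (LEAST k. \<exists>s\<in>elts T0. to_nat s = k \<and> FEq s t \<in> TM)"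

definition dec :: "nat \<Rightarrow> tm" where "dec k = (SOME t. t \<in> elts T0 \<and> code t = k)"

text \<open>If there is no countermodel, the carrier is the standard model, so that the type exists anyway.\<close>

definition carrierN :: "nat set" where "carrierN = (if mdl then code ` elts T0 else UNIV)"
definition zeroN :: nat where "zeroN = (if mdl then code \<^bold>0 else 0)"
definition oneN :: nat where "oneN = (if mdl then code \<^bold>1 else 1)"
definition plusN :: "nat \<Rightarrow> nat \<Rightarrow> nat" where
  "plusN a b = (if mdl then code (dec a \<^bold>+ dec b) else a + b)"
definition timesN :: "nat \<Rightarrow> nat \<Rightarrow> nat" where
  "timesN a b = (if mdl then code (dec a \<^bold>* dec b) else a * b)"
definition lessN :: "nat \<Rightarrow> nat \<Rightarrow> bool" where
  "lessN a b \<longleftrightarrow> (if mdl then FLess (dec a) (dec b) \<in> TM else a < b)"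

definition oenv0 :: "nat \<times> ty \<Rightarrow> tm" where "oenv0 = (\<lambda>(n, \<sigma>). Var 1 \<sigma>)"

lemma odd_oenv0: "odd_env oenv0"
  by (auto simp: odd_env_def elts_def oenv0_def)

lemma sat_TM: "mdl \<Longrightarrow> \<phi> \<in> ACA0_omega \<Longrightarrow> odd_env e \<Longrightarrow> sat TM e \<phi>"
  by (rule henkin.sat_ax) (auto simp: mdl_def counter_def)

lemma sat_eqax: "mdl \<Longrightarrow> \<phi> \<in> equality_axioms \<union> semiring_axioms \<Longrightarrow> sat TM oenv0 \<phi>"
  by (rule sat_TM) (auto simp: odd_oenv0 ACA0_omega_def RCA0_omega_def)

lemma FEq_TM:
  assumes mdl
  shows FEq_refl: "\<And>x. x \<in> elts T0 \<Longrightarrow> FEq x x \<in> TM"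
    and FEq_sym: "\<And>x y. x \<in> elts T0 \<Longrightarrow> y \<in> elts T0 \<Longrightarrow> FEq x y \<in> TM \<Longrightarrow> FEq y x \<in> TM"
    and FEq_trans: "\<And>x y z. x \<in> elts T0 \<Longrightarrow> y \<in> elts T0 \<Longrightarrow> z \<in> elts T0 \<Longrightarrow> FEq x y \<in> TM \<Longrightarrow> FEq y z \<in> TM \<Longrightarrow> FEq x z \<in> TM"
    and FLess_cong: "\<And>x y u v. x \<in> elts T0 \<Longrightarrow> y \<in> elts T0 \<Longrightarrow> u \<in> elts T0 \<Longrightarrow> v \<in> elts T0 \<Longrightarrow>
       FEq x y \<in> TM \<Longrightarrow> FEq u v \<in> TM \<Longrightarrow> FLess x u \<in> TM \<Longrightarrow> FLess y v \<in> TM"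
proof -
  have "sat TM oenv0 (sentence (\<^bold>\<forall>\<^sub>0x. x \<^bold>= x))"
    by (rule sat_eqax[OF assms]) (simp add: equality_axioms_def)
  then have "\<forall>x\<in>elts T0. FEq x x \<in> TM" by (simp (no_asm_use) add: scheme_defs)
  then show "FEq x x \<in> TM" if "x \<in> elts T0" for x using that by blast
  have "sat TM oenv0 (sentence (\<^bold>\<forall>\<^sub>0x. \<^bold>\<forall>\<^sub>0y. x \<^bold>= y \<^bold>\<longrightarrow> y \<^bold>= x))"
    by (rule sat_eqax[OF assms]) (simp add: equality_axioms_def)
  then have "\<forall>x\<in>elts T0. \<forall>y\<in>elts T0. FEq x y \<in> TM \<longrightarrow> FEq y x \<in> TM" by (simp (no_asm_use) add: scheme_defs)
  then show "FEq y x \<in> TM" if "x \<in> elts T0" "y \<in> elts T0" "FEq x y \<in> TM" for x y using that by blast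
  have "sat TM oenv0 (sentence (\<^bold>\<forall>\<^sub>0x. \<^bold>\<forall>\<^sub>0y. \<^bold>\<forall>\<^sub>0z. x \<^bold>= y \<^bold>\<longrightarrow> y \<^bold>= z \<^bold>\<longrightarrow> x \<^bold>= z))"
    by (rule sat_eqax[OF assms]) (simp add: equality_axioms_def)
  then have "\<forall>x\<in>elts T0. \<forall>y\<in>elts T0. \<forall>z\<in>elts T0. FEq x y \<in> TM \<longrightarrow> FEq y z \<in> TM \<longrightarrow> FEq x z \<in> TM"
    by (simp (no_asm_use) add: scheme_defs)
  then show "FEq x z \<in> TM" if "x \<in> elts T0" "y \<in> elts T0" "z \<in> elts T0" "FEq x y \<in> TM" "FEq y z \<in> TM" for x y z
    using that by blast
  have "sat TM oenv0 (sentence (\<^bold>\<forall>\<^sub>0x. \<^bold>\<forall>\<^sub>0y. \<^bold>\<forall>\<^sub>0u. \<^bold>\<forall>\<^sub>0v. x \<^bold>= y \<^bold>\<longrightarrow> u \<^bold>= v \<^bold>\<longrightarrow> x \<^bold>< u \<^bold>\<longrightarrow> y \<^bold>< v))"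
    by (rule sat_eqax[OF assms]) (simp add: equality_axioms_def)
  then have "\<forall>x\<in>elts T0. \<forall>y\<in>elts T0. \<forall>u\<in>elts T0. \<forall>v\<in>elts T0.
      FEq x y \<in> TM \<longrightarrow> FEq u v \<in> TM \<longrightarrow> FLess x u \<in> TM \<longrightarrow> FLess y v \<in> TM"
    by (simp (no_asm_use) add: scheme_defs)
  then show "FLess y v \<in> TM" if "x \<in> elts T0" "y \<in> elts T0" "u \<in> elts T0" "v \<in> elts T0"
     "FEq x y \<in> TM" "FEq u v \<in> TM" "FLess x u \<in> TM" for x y u v
    using that by blast
qed

lemma code_eq: 
  assumes mdl "s \<in> elts T0" "t \<in> elts T0"
  shows "code s = code t \<longleftrightarrow> FEq s t \<in> TM"
proof
  have ex: "\<exists>s\<in>elts T0. to_nat s = code t \<and> FEq s t \<in> TM" if "t \<in> elts T0" for t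
    unfolding code_def by (rule LeastI_ex) (use FEq_refl[OF assms(1)] that in blast)
  assume "code s = code t"
  then obtain u where "u \<in> elts T0" "FEq u s \<in> TM" "FEq u t \<in> TM"
    using ex[OF assms(2)] ex[OF assms(3)] by (metis to_nat_split)
  then show "FEq s t \<in> TM" using FEq_sym[OF assms(1)] FEq_trans[OF assms(1)] assms by blast
next
  assume "FEq s t \<in> TM"
  then have "FEq u s \<in> TM \<longleftrightarrow> FEq u t \<in> TM" if "u \<in> elts T0" for u
    using FEq_sym[OF assms(1)] FEq_trans[OF assms(1)] assms that by blast
  then show "code s = code t" unfolding code_def by (metis (no_types, lifting))
qed

lemma dec_code:
  assumes "mdl" "t \<in> elts T0"
  shows "dec (code t) \<in> elts T0" "code (dec (code t)) = code t" "FEq (dec (code t)) t \<in> TM"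
proof -
  have "dec (code t) \<in> elts T0 \<and> code (dec (code t)) = code t"
    unfolding dec_def by (rule someI[of _ t]) (use assms in auto)
  then show "dec (code t) \<in> elts T0" "code (dec (code t)) = code t" "FEq (dec (code t)) t \<in> TM"
    using code_eq assms by auto
qed

lemma sat_TM2:
  assumes mdl "\<phi> \<in> ACA0_omega" shows "sat TM oenv0 \<phi>"
  using assms by (rule sat_TM[OF _ _ odd_oenv0])

text \<open>Extensionality is used twice: with values of type 1 for the first argument, with values
  of type 0 for the second.\<close>

lemma K_cong_sat:
  assumes mdl "f \<in> elts (T0 \<^bold>\<rightarrow> T0 \<^bold>\<rightarrow> T0)" "x \<in> elts T0" "y \<in> elts T0" "u \<in> elts T0" "v \<in> elts T0"
    "FEq x y \<in> TM" "FEq u v \<in> TM"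
  shows "FEq (f \<^bold>\<cdot> x \<^bold>\<cdot> u) (f \<^bold>\<cdot> y \<^bold>\<cdot> v) \<in> TM"
proof -
  have "sat TM oenv0 (ext_axiom T0 (T0 \<^bold>\<rightarrow> T0))" "sat TM oenv0 (ext_axiom T0 T0)"
    by (rule sat_TM2[OF assms(1)]; auto simp: ACA0_omega_def RCA0_omega_def)+
  then have "\<forall>x\<in>elts T0. \<forall>y\<in>elts T0. \<forall>f\<in>elts (T0 \<^bold>\<rightarrow> T0 \<^bold>\<rightarrow> T0). FEq x y \<in> TM \<longrightarrow>
      (\<forall>z\<in>elts T0. FEq (f \<^bold>\<cdot> x \<^bold>\<cdot> z) (f \<^bold>\<cdot> y \<^bold>\<cdot> z) \<in> TM)"
    and "\<forall>x\<in>elts T0. \<forall>y\<in>elts T0. \<forall>f\<in>elts (T0 \<^bold>\<rightarrow> T0). FEq x y \<in> TM \<longrightarrow> FEq (f \<^bold>\<cdot> x) (f \<^bold>\<cdot> y) \<in> TM"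
    by (simp_all (no_asm_use) add: scheme_defs ext_axiom_def)
  then have "FEq (f \<^bold>\<cdot> x \<^bold>\<cdot> u) (f \<^bold>\<cdot> y \<^bold>\<cdot> u) \<in> TM" "FEq (f \<^bold>\<cdot> y \<^bold>\<cdot> u) (f \<^bold>\<cdot> y \<^bold>\<cdot> v) \<in> TM"
    using assms by (blast, blast intro: elts_App)
  then show ?thesis using assms by (meson FEq_trans elts_App)
qed

lemma N_ops_code:
  assumes mdl "s \<in> elts T0" "t \<in> elts T0"
  shows "plusN (code s) (code t) = code (s \<^bold>+ t)" "timesN (code s) (code t) = code (s \<^bold>* t)"
    "lessN (code s) (code t) \<longleftrightarrow> FLess s t \<in> TM"
proof -
  note d = dec_code[OF assms(1,2)] dec_code[OF assms(1,3)]
  show "plusN (code s) (code t) = code (s \<^bold>+ t)" "timesN (code s) (code t) = code (s \<^bold>* t)"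
    unfolding plusN_def timesN_def using assms d by (simp_all add: code_eq K_cong_sat)
  show "lessN (code s) (code t) \<longleftrightarrow> FLess s t \<in> TM"
    unfolding lessN_def using assms d FEq_sym[OF assms(1) d(1) assms(2) d(3)] FEq_sym[OF assms(1) d(4) assms(3) d(6)]
      FLess_cong[OF assms(1) d(1) assms(2) d(4) assms(3)] FLess_cong[OF assms(1) assms(2) d(1) assms(3) d(4)]
    by auto
qed

lemma zeroN_mem: "zeroN \<in> carrierN" and oneN_mem: "oneN \<in> carrierN"
  by (auto simp: zeroN_def oneN_def carrierN_def)

lemma plusN_mem: "a \<in> carrierN \<Longrightarrow> b \<in> carrierN \<Longrightarrow> plusN a b \<in> carrierN"
  and timesN_mem: "a \<in> carrierN \<Longrightarrow> b \<in> carrierN \<Longrightarrow> timesN a b \<in> carrierN"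
  by (cases mdl; force simp: carrierN_def N_ops_code)+

typedef N = carrierN
  using zeroN_mem by blast

setup_lifting type_definition_N

definition nm :: "tm \<Rightarrow> N" where "nm t = Abs_N (if mdl then code t else 0)"

instantiation N :: "{zero, one, plus, times, ord}"
begin
lift_definition zero_N :: N is zeroN by (rule zeroN_mem)
lift_definition one_N :: N is oneN by (rule oneN_mem)
lift_definition plus_N :: "N \<Rightarrow> N \<Rightarrow> N" is plusN by (rule plusN_mem)
lift_definition times_N :: "N \<Rightarrow> N \<Rightarrow> N" is timesN by (rule timesN_mem)
lift_definition less_N :: "N \<Rightarrow> N \<Rightarrow> bool" is lessN .
definition less_eq_N :: "N \<Rightarrow> N \<Rightarrow> bool" where "less_eq_N a b \<longleftrightarrow> a < b \<or> a = b"
instance ..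
end

lifting_update N.lifting
lifting_forget N.lifting

lemma N_cases:
  assumes mdl obtains t where "t \<in> elts T0" "x = nm t"
proof -
  have "Rep_N x \<in> code ` elts T0" using Rep_N[of x] assms by (simp add: carrierN_def)
  then obtain t where "t \<in> elts T0" "Rep_N x = code t" by blast
  then show ?thesis using that[of t] assms by (metis Rep_N_inverse nm_def)
qed

lemma Rep_nm: "mdl \<Longrightarrow> t \<in> elts T0 \<Longrightarrow> Rep_N (nm t) = code t"
  by (simp add: nm_def Abs_N_inverse carrierN_def)

lemma nm_sem:
  assumes mdl "s \<in> elts T0" "t \<in> elts T0"
  shows "nm s = nm t \<longleftrightarrow> FEq s t \<in> TM" "nm s < nm t \<longleftrightarrow> FLess s t \<in> TM"
    "nm (s \<^bold>+ t) = nm s + nm t" "nm (s \<^bold>* t) = nm s * nm t"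
proof -
  show "nm s = nm t \<longleftrightarrow> FEq s t \<in> TM" using assms by (metis Rep_nm Rep_N_inject code_eq)
  show "nm s < nm t \<longleftrightarrow> FLess s t \<in> TM" using assms by (simp add: less_N.rep_eq Rep_nm N_ops_code)
  show "nm (s \<^bold>+ t) = nm s + nm t" "nm (s \<^bold>* t) = nm s * nm t"
    using assms by (simp_all flip: Rep_N_inject add: plus_N.rep_eq times_N.rep_eq Rep_nm N_ops_code)
qed

lemma nm_const: "mdl \<Longrightarrow> nm \<^bold>0 = 0" "mdl \<Longrightarrow> nm \<^bold>1 = 1"
  by (simp_all flip: Rep_N_inject add: Rep_nm zero_N.rep_eq one_N.rep_eq zeroN_def oneN_def)

text \<open>The class instances for \<open>N\<close> hold without assumption, so the laws are also
  checked for the standard carrier.\<close>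

lemma N_std:
  assumes "\<not> mdl"
  shows "Rep_N 0 = 0" "Rep_N 1 = 1" "Rep_N (a + b) = Rep_N a + Rep_N b" "Rep_N (a * b) = Rep_N a * Rep_N b"
    "a < b \<longleftrightarrow> Rep_N a < Rep_N b"
  using assms by (simp_all add: zero_N.rep_eq one_N.rep_eq plus_N.rep_eq times_N.rep_eq less_N.rep_eq
      zeroN_def oneN_def plusN_def timesN_def lessN_def)

lemma N_std_surj: "\<not> mdl \<Longrightarrow> \<exists>a. Rep_N a = n"
  by (metis Abs_N_inverse UNIV_I carrierN_def)

lemma N_semiring:
  fixes x y z :: N
  shows "(x + y) + z = x + (y + z)" "x + y = y + x" "x + 0 = x" "(x * y) * z = x * (y * z)" "x * y = y * x"
    "x * 1 = x" "x * 0 = 0" "x * (y + z) = x * y + x * z" "\<not> x < x" "x < y \<Longrightarrow> y < z \<Longrightarrow> x < z"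
    "x < y \<or> x = y \<or> y < x" "x < y \<Longrightarrow> x + z < y + z" "0 < z \<Longrightarrow> x < y \<Longrightarrow> x * z < y * z"
    "x < y \<Longrightarrow> \<exists>z. x + z = y" "(0::N) < 1" "\<not> x < 0" "0 < x \<Longrightarrow> x = 1 \<or> 1 < x"
proof -
  have S: "\<forall>\<phi>\<in>semiring_axioms. sat TM oenv0 \<phi>" if mdl using sat_eqax[OF that] by blast
  \<comment> \<open>The bounded quantifiers over \<open>X\<close> let the simplifier match the laws
    with the truth conditions of the axioms, whose quantifiers range over \<open>elts T0\<close>.
    Disjunctions appear as implications, the way \<open>s_disj\<close> defines them.\<close>
  have L: "(\<forall>x\<in>X. \<forall>y\<in>X. \<forall>z\<in>X. (x + y) + z = x + (y + z)) \<and> (\<forall>x\<in>X. \<forall>y\<in>X. x + y = y + x) \<and> (\<forall>x\<in>X. x + 0 = x) \<and>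
    (\<forall>x\<in>X. \<forall>y\<in>X. \<forall>z\<in>X. (x * y) * z = x * (y * z)) \<and> (\<forall>x\<in>X. \<forall>y\<in>X. x * y = y * x) \<and> (\<forall>x\<in>X. x * 1 = x) \<and> (\<forall>x\<in>X. x * 0 = 0) \<and>
    (\<forall>x\<in>X. \<forall>y\<in>X. \<forall>z\<in>X. x * (y + z) = x * y + x * z) \<and> (\<forall>x\<in>X. \<not> x < x) \<and> (\<forall>x\<in>X. \<forall>y\<in>X. \<forall>z\<in>X. x < y \<longrightarrow> y < z \<longrightarrow> x < z) \<and>
    (\<forall>x\<in>X. \<forall>y\<in>X. \<not> x < y \<longrightarrow> x \<noteq> y \<longrightarrow> y < x) \<and> (\<forall>x\<in>X. \<forall>y\<in>X. \<forall>z\<in>X. x < y \<longrightarrow> x + z < y + z) \<and>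
    (\<forall>x\<in>X. \<forall>y\<in>X. \<forall>z\<in>X. 0 < z \<longrightarrow> x < y \<longrightarrow> x * z < y * z) \<and> (\<forall>x\<in>X. \<forall>y\<in>X. x < y \<longrightarrow> (\<exists>z\<in>X. x + z = y)) \<and>
    (0::N) < 1 \<and> (\<forall>x\<in>X. \<not> x < 0) \<and> (\<forall>x\<in>X. 0 < x \<longrightarrow> x \<noteq> 1 \<longrightarrow> 1 < x)" (is "?L X") if X: "X = UNIV" for X :: "N set"
  proof (cases mdl)
    case True
    have ops: "FEq s t \<in> TM \<longleftrightarrow> nm s = nm t" "FLess s t \<in> TM \<longleftrightarrow> nm s < nm t" if "s \<in> elts T0" "t \<in> elts T0" for s t
      using nm_sem[OF True that] by auto
    have Y: "nm ` elts T0 = X" using N_cases[OF True] X by blast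
    have "?L (nm ` elts T0)"
      using S[OF True] unfolding semiring_axioms_def ball_simps image_insert image_empty
      by (simp (no_asm_use) add: scheme_defs ops nm_sem(3,4)[OF True] nm_const[OF True] cong: ball_cong)
    then show ?thesis unfolding Y .
  next
    case False
    have "\<exists>z. x + z = y" if "x < y" for x y :: N
    proof -
      from N_std_surj[OF False] obtain z where "Rep_N z = Rep_N y - Rep_N x" by blast
      then show ?thesis using that False by (intro exI[of _ z]) (simp add: N_std flip: Rep_N_inject)
    qed
    then show ?thesis using False X
      by (simp add: N_std algebra_simps flip: Rep_N_inject)
  qed
  note c1 = L[OF refl, unfolded ball_UNIV bex_UNIV]
  note c2 = c1[THEN conjunct2]
  note c3 = c2[THEN conjunct2]
  note c4 = c3[THEN conjunct2]
  note c5 = c4[THEN conjunct2]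
  note c6 = c5[THEN conjunct2]
  note c7 = c6[THEN conjunct2]
  note c8 = c7[THEN conjunct2]
  note c9 = c8[THEN conjunct2]
  note c10 = c9[THEN conjunct2]
  note c11 = c10[THEN conjunct2]
  note c12 = c11[THEN conjunct2]
  note c13 = c12[THEN conjunct2]
  note c14 = c13[THEN conjunct2]
  note c15 = c14[THEN conjunct2]
  note c16 = c15[THEN conjunct2]
  note c17 = c16[THEN conjunct2]
  show "(x + y) + z = x + (y + z)" by (rule c1[THEN conjunct1, rule_format])
  show "x + y = y + x" by (rule c2[THEN conjunct1, rule_format])
  show "x + 0 = x" by (rule c3[THEN conjunct1, rule_format])
  show "(x * y) * z = x * (y * z)" by (rule c4[THEN conjunct1, rule_format])
  show "x * y = y * x" by (rule c5[THEN conjunct1, rule_format])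
  show "x * 1 = x" by (rule c6[THEN conjunct1, rule_format])
  show "x * 0 = 0" by (rule c7[THEN conjunct1, rule_format])
  show "x * (y + z) = x * y + x * z" by (rule c8[THEN conjunct1, rule_format])
  show "\<not> x < x" by (rule c9[THEN conjunct1, rule_format])
  show "x < y \<Longrightarrow> y < z \<Longrightarrow> x < z" by (rule c10[THEN conjunct1, rule_format])
  show "x < y \<or> x = y \<or> y < x" using c11[THEN conjunct1, rule_format] by blast
  show "x < y \<Longrightarrow> x + z < y + z" by (rule c12[THEN conjunct1, rule_format])
  show "0 < z \<Longrightarrow> x < y \<Longrightarrow> x * z < y * z" by (rule c13[THEN conjunct1, rule_format])
  show "x < y \<Longrightarrow> \<exists>z. x + z = y" by (rule c14[THEN conjunct1, rule_format])
  show "(0::N) < 1" by (rule c15[THEN conjunct1, rule_format])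
  show "\<not> x < 0" by (rule c16[THEN conjunct1, rule_format])
  show "0 < x \<Longrightarrow> x = 1 \<or> 1 < x" using c17[rule_format] by blast
qed

lemma N_less_antisym: "(x::N) < y \<Longrightarrow> \<not> y < x"
  using N_semiring(9,10) by blast

lemma N_add_right_cancel: "(x::N) + z = y + z \<longleftrightarrow> x = y"
  using N_semiring(9)[of "x + z"] N_semiring(12)[of x y z] N_semiring(12)[of y x z] N_semiring(11)[of x y] by auto

lemma N_le_iff: "(x::N) \<le> y \<longleftrightarrow> (\<exists>z. x + z = y)"
proof
  assume "\<exists>z. x + z = y"
  then obtain z where z: "x + z = y" by blast
  have "z = 0 \<or> 0 < z" using N_semiring(11)[of z 0] N_semiring(16)[of z] by auto
  then show "x \<le> y"
    using z N_semiring(3)[of x] N_semiring(12)[of 0 z x] N_semiring(2)[of x] N_semiring(2)[of 0 x]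
    unfolding less_eq_N_def by metis
next
  assume "x \<le> y"
  then show "\<exists>z. x + z = y" using N_semiring(14)[of x y] N_semiring(3) unfolding less_eq_N_def by metis
qed

instantiation N :: minus
begin

text \<open>Truncated subtraction, part of the signature of
  \<open>linordered_semidom\<close>.\<close>

definition minus_N :: "N \<Rightarrow> N \<Rightarrow> N" where "minus_N a b = (if b \<le> a then (THE c. b + c = a) else 0)"

instance ..

end

lemma N_diff: "(b::N) + c - b = c"
proof -
  have "b \<le> b + c" by (metis N_le_iff)
  moreover have "(THE d. b + d = b + c) = c"
    by (rule the_equality) (use N_add_right_cancel N_semiring(2) in metis)+
  ultimately show ?thesis unfolding minus_N_def by simp
qed

lemma N_le_total: "(a::N) \<le> b \<or> b \<le> a"
  using N_semiring(11) unfolding less_eq_N_def by blast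

instance N :: linordered_semidom
proof
  note r = N_semiring
  fix a b c :: N
  show "a + b + c = a + (b + c)" "a + b = b + a" "a * b * c = a * (b * c)" "a * b = b * a" by (rule r)+
  show "0 + a = a" "1 * a = a" "0 * a = 0" "a * 0 = 0" using r by metis+
  show "a * (b + c) = a * b + a * c" by (rule r)
  show dist: "(a + b) * c = a * c + b * c" using r by metis
  show "(0::N) < 1" by (rule r)
  then show "(0::N) \<noteq> 1" using r(9) by metis
  show "a + b - a = b" by (rule N_diff)
  show less: "(a < b) = (a \<le> b \<and> \<not> b \<le> a)" for a b :: N
    unfolding less_eq_N_def by (metis N_less_antisym r(9))
  show "a \<le> a" "a \<le> b \<or> b \<le> a" using N_le_total unfolding less_eq_N_def by auto
  show tr: "a \<le> b \<Longrightarrow> b \<le> c \<Longrightarrow> a \<le> c" for a b c :: N using r(10) unfolding less_eq_N_def by blast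
  show "a \<le> b \<Longrightarrow> b \<le> a \<Longrightarrow> a = b" using N_less_antisym unfolding less_eq_N_def by blast
  show "a \<le> b \<Longrightarrow> c + a \<le> c + b" using r(12)[of a b c] r(2) unfolding less_eq_N_def by metis
  show "a < b \<Longrightarrow> 0 < c \<Longrightarrow> c * a < c * b" using r(13)[of c a b] r(5) by metis
  show "b \<le> a \<Longrightarrow> a - b + b = a" using N_le_iff N_diff r(2) by metis
  have pos: "0 < a \<or> a = 0" for a :: N using r(11,16) by blast
  show "a \<noteq> 0 \<Longrightarrow> b \<noteq> 0 \<Longrightarrow> a * b \<noteq> 0"
    using pos[of a] pos[of b] r(13)[of b 0 a] r(5,7,9) by metis
  have zd: "a - b = 0" if "\<not> b \<le> a" for a b :: N using that unfolding minus_N_def by simp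
  show "a - b - c = a - (b + c)"
  proof (cases "b \<le> a")
    case True
    then obtain d where a: "a = b + d" by (metis N_le_iff)
    show ?thesis
    proof (cases "c \<le> d")
      case True
      then obtain k where "d = c + k" by (metis N_le_iff)
      then show ?thesis using a N_diff r(1) by metis
    next
      case False
      have "\<not> b + c \<le> a"
      proof
        assume "b + c \<le> a"
        then obtain k where "b + (c + k) = b + d" unfolding N_le_iff a r(1) by blast
        then have "c + k = d" by (metis N_diff)
        then show False using False N_le_iff by blast
      qed
      then show ?thesis using zd False a N_diff by metis
    qed
  next
    case False
    then have "\<not> b + c \<le> a" using N_le_iff tr by metis
    moreover have "0 - c = (0::N)"
      using zd N_diff[of 0 0] r(3)[of 0] pos[of c] r(16) unfolding less_eq_N_def by metis
    ultimately show ?thesis using zd False by metis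
  qed
  show "a * (b - c) = a * b - a * c"
  proof (cases "c \<le> b")
    case True
    then obtain d where "b = c + d" by (metis N_le_iff)
    then show ?thesis using N_diff r(8) by metis
  next
    case False
    show ?thesis
    proof (cases "a = 0")
      case True
      then show ?thesis using N_diff[of 0 0] r(3)[of 0] r(5)[of a] r(7) by metis
    next
      case a: False
      then have "a * b < a * c" using False N_le_total[of c b] r(13)[of a b c] pos[of a] r(5) unfolding less_eq_N_def by metis
      then show ?thesis using zd False less r(7) by metis
    qed
  qed
qed

lemma N_nonneg [simp]: "(0::N) \<le> x"
  using N_semiring(16) not_less by blast

lemma N_le_0 [simp]: "(x::N) \<le> 0 \<longleftrightarrow> x = 0"
  by (meson N_nonneg antisym order.refl)

lemma N_pos_iff: "(0::N) < x \<longleftrightarrow> x \<noteq> 0"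
  by (metis N_nonneg order_le_less less_irrefl)

text \<open>Discreteness: a positive difference is at least 1.\<close>

lemma N_less_iff: "(x::N) < y \<longleftrightarrow> x + 1 \<le> y"
proof
  assume "x < y"
  then obtain z where z: "x + z = y" "0 < z" using N_le_iff[of x y] N_pos_iff by (metis add.right_neutral less_imp_le less_irrefl)
  then have "1 \<le> z" using N_semiring(17)[of z] by auto
  then show "x + 1 \<le> y" using z by auto
qed (meson add_pos_pos less_add_one less_le_trans)

lemma N_less_Suc: "(x::N) < y + 1 \<longleftrightarrow> x \<le> y"
  by (simp add: N_less_iff)

section \<open>Integers and rationals over the numbers\<close>

\<comment> \<open>Since \<open>N\<close> may be nonstandard, its integers and rationals are built
  anew. The fraction field construction asks for an integral domain, hence this intermediate
  type.\<close>
quotient_type Z = "N \<times> N" / "\<lambda>(a, b) (c, d). a + d = c + b"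
proof (rule equivpI)
  show "transp (\<lambda>(a, b) (c, d). a + d = c + (b::N))"
  proof (rule transpI, clarsimp)
    fix a b c d e f :: N
    assume "a + d = c + b" "c + f = e + d"
    then have "(a + f) + (c + d) = (e + b) + (c + d)"
      by (metis (no_types, lifting) add.assoc add.commute)
    then show "a + f = e + b" by simp
  qed
qed (auto simp: reflp_def symp_def)

instantiation Z :: linordered_idom
begin

lift_definition zero_Z :: Z is "(0, 0)" .
lift_definition one_Z :: Z is "(1, 0)" .
lift_definition plus_Z :: "Z \<Rightarrow> Z \<Rightarrow> Z" is "\<lambda>(a, b) (c, d). (a + c, b + d)"
  by clarsimp (metis (no_types, lifting) add.assoc add.commute)
lift_definition uminus_Z :: "Z \<Rightarrow> Z" is "\<lambda>(a, b). (b, a)"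
  by (clarsimp simp: add.commute)
lift_definition minus_Z :: "Z \<Rightarrow> Z \<Rightarrow> Z" is "\<lambda>(a, b) (c, d). (a + d, b + c)"
  by clarsimp (metis (no_types, lifting) add.assoc add.commute)
lift_definition times_Z :: "Z \<Rightarrow> Z \<Rightarrow> Z" is "\<lambda>(a, b) (c, d). (a * c + b * d, a * d + b * c)"
proof (clarsimp)
  fix s t u v w x y z :: N
  assume "s + v = u + t" "w + z = y + x"
  then have "(s + v) * w + (u + t) * x + u * (w + z) + v * (y + x) =
    (u + t) * w + (s + v) * x + u * (y + x) + v * (w + z)" by simp
  then have "s * w + t * x + (u * z + v * y) + (u * w + u * x + v * w + v * x) =
     u * y + v * z + (s * x + t * w) + (u * w + u * x + v * w + v * x)"
    by (simp add: algebra_simps)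
  then show "s * w + t * x + (u * z + v * y) = u * y + v * z + (s * x + t * w)"
    by (simp only: add_right_cancel)
qed
lift_definition less_eq_Z :: "Z \<Rightarrow> Z \<Rightarrow> bool" is "\<lambda>(a, b) (c, d). a + d \<le> c + b"
proof (clarsimp)
  fix s t u v w x y z :: N
  assume a: "s + v = u + t" "w + z = y + x"
  have "s + x \<le> w + t \<longleftrightarrow> (s + x) + (v + z) \<le> (w + t) + (v + z)" by simp
  also have "\<dots> \<longleftrightarrow> (s + v) + (x + z) \<le> (w + z) + (t + v)" by (simp add: ac_simps)
  also have "\<dots> \<longleftrightarrow> (u + z) + (t + x) \<le> (y + v) + (t + x)" unfolding a by (simp add: ac_simps)
  also have "\<dots> \<longleftrightarrow> u + z \<le> y + v" by simp
  finally show "s + x \<le> w + t \<longleftrightarrow> u + z \<le> y + v" .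
qed
definition less_Z :: "Z \<Rightarrow> Z \<Rightarrow> bool" where "less_Z a b \<longleftrightarrow> a \<le> b \<and> \<not> b \<le> a"
definition abs_Z_if: "\<bar>a :: Z\<bar> = (if a < 0 then - a else a)"
definition sgn_Z :: "Z \<Rightarrow> Z" where "sgn_Z a = (if a = 0 then 0 else if 0 < a then 1 else - 1)"

instance
proof
  fix a b c :: Z
  show "a + b + c = a + (b + c)" by transfer (auto simp: ac_simps)
  show "a + b = b + a" by transfer (auto simp: ac_simps)
  show "0 + a = a" by transfer auto
  show "- a + a = 0" by transfer (auto simp: ac_simps)
  show "a - b = a + - b" by transfer auto
  show "a * b * c = a * (b * c)" by transfer (auto simp: algebra_simps)
  show "a * b = b * a" by transfer (auto simp: algebra_simps)
  show "1 * a = a" by transfer auto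
  show "(a + b) * c = a * c + b * c" by transfer (auto simp: algebra_simps)
  show "(0::Z) \<noteq> 1" by transfer simp
  show "(a < b) = (a \<le> b \<and> \<not> b \<le> a)" by (rule less_Z_def)
  show "a \<le> a" by transfer auto
  show "a \<le> b \<Longrightarrow> b \<le> c \<Longrightarrow> a \<le> c"
  proof (transfer, clarsimp)
    fix a b c d e f :: N
    assume "a + d \<le> c + b" "c + f \<le> e + d"
    then have "(a + d) + (c + f) \<le> (c + b) + (e + d)" by (rule add_mono)
    then have "(a + f) + (c + d) \<le> (e + b) + (c + d)" by (simp add: ac_simps)
    then show "a + f \<le> e + b" by simp
  qed
  show "a \<le> b \<Longrightarrow> b \<le> a \<Longrightarrow> a = b" by transfer auto
  show "a \<le> b \<or> b \<le> a" by transfer (auto simp: linear)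
  show "a \<le> b \<Longrightarrow> c + a \<le> c + b" by transfer (auto simp: ac_simps)
  show "\<bar>a\<bar> = (if a < 0 then - a else a)" by (rule abs_Z_if)
  show "sgn a = (if a = 0 then 0 else if 0 < a then 1 else - 1)" by (rule sgn_Z_def)
  show "a + b - a = b" by transfer (auto simp: ac_simps)
  show "a - b - c = a - (b + c)" by transfer (auto simp: ac_simps)
  show "0 * a = 0" "a * 0 = 0" by (transfer, auto)+
  have rep: "\<exists>i j. z = abs_Z (i, j)" for z :: Z
    by (induct z rule: Z.abs_induct) auto
  have less: "abs_Z (i, j) < abs_Z (k, l) \<longleftrightarrow> i + l < k + j" for i j k l
    by (auto simp: less_Z_def less_eq_Z.abs_eq)
  show "c * a < c * b" if "a < b" "0 < c"
  proof -
    obtain i1 i2 where a: "a = abs_Z (i1, i2)" using rep by blast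
    obtain j1 j2 where b: "b = abs_Z (j1, j2)" using rep by blast
    obtain k1 k2 where c: "c = abs_Z (k1, k2)" using rep by blast
    have i: "i1 + j2 < j1 + i2" and k: "k2 < k1"
      using that by (simp_all add: a b c less zero_Z_def)
    obtain m where m: "k1 = k2 + m" using k N_le_iff by (metis less_imp_le)
    with k have "0 < m" by simp
    then have "m * (i1 + j2) < m * (j1 + i2)" using i by (rule mult_strict_left_mono[rotated])
    moreover let ?A = "k2 * (i1 + i2 + j1 + j2)"
    have "k1 * i1 + k2 * i2 + (k1 * j2 + k2 * j1) = ?A + m * (i1 + j2)"
      "k1 * j1 + k2 * j2 + (k1 * i2 + k2 * i1) = ?A + m * (j1 + i2)"
      unfolding m by (simp_all add: algebra_simps)
    ultimately have "k1 * i1 + k2 * i2 + (k1 * j2 + k2 * j1) < k1 * j1 + k2 * j2 + (k1 * i2 + k2 * i1)"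
      by (simp only: add_less_cancel_left)
    then show ?thesis by (simp add: a b c less times_Z.abs_eq)
  qed
qed

end

type_synonym Q = "Z fract"

lift_definition zn :: "N \<Rightarrow> Z" is "\<lambda>a. (a, 0)" .

definition qn :: "N \<Rightarrow> Q" where "qn a = Fract (zn a) 1"

lemma zn_simps: "zn 0 = 0" "zn 1 = 1" "zn (a + b) = zn a + zn b" "zn (a * b) = zn a * zn b"
  "zn a = zn b \<longleftrightarrow> a = b" "zn a \<le> zn b \<longleftrightarrow> a \<le> b"
  by (transfer; simp)+

lemma Z_cases: "\<exists>a b. z = zn a - zn b"
  by transfer auto

lemma qn_simps [simp]: "qn 0 = 0" "qn 1 = 1" "qn (a + b) = qn a + qn b" "qn (a * b) = qn a * qn b"
  "qn a = qn b \<longleftrightarrow> a = b" "qn a \<le> qn b \<longleftrightarrow> a \<le> b" "qn a < qn b \<longleftrightarrow> a < b"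
  by (simp_all add: qn_def zn_simps eq_fract fract_collapse less_le)

lemma qn_nonneg [simp]: "0 \<le> qn a"
  using qn_simps(6)[of 0 a] by simp

text \<open>The form of the number codes, a difference over a successor. A negative denominator is
  first made positive, and a positive one is at least 1.\<close>

lemma Q_cases: "\<exists>a b c. q = (qn a - qn b) / (qn c + 1)"
proof -
  obtain x y where xy: "q = Fract x y" "y \<noteq> 0" by (cases q)
  define x' y' where "x' = (if 0 < y then x else - x)" and "y' = (if 0 < y then y else - y)"
  have q: "q = Fract x' y'" "0 < y'" using xy by (auto simp: x'_def y'_def)
  obtain a b where x: "x' = zn a - zn b" using Z_cases by blast
  obtain c d where y: "y' = zn c - zn d" using Z_cases by blast
  have "zn d < zn c" using q y by simp
  then have "d < c" by (simp add: less_le zn_simps)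
  then obtain k where "c = d + 1 + k" using N_less_iff[of d c] N_le_iff[of "d + 1" c] by metis
  then have "y' = zn (k + 1)" using y by (simp add: zn_simps)
  moreover have "Fract x' y' = Fract x' 1 / Fract y' 1" by simp
  moreover have "Fract x' 1 = qn a - qn b" "Fract (zn (k + 1)) 1 = qn k + 1"
    by (simp_all add: x qn_def zn_simps One_fract_def)
  ultimately show ?thesis using q by metis
qed

section \<open>Semantics in the countermodel\<close>

text \<open>Only objects of type 0 are identified up to equality. At higher types equality in the
  model remains this relation on terms, the counterpart of \<open>eq_at\<close>.\<close>

fun eqv :: "ty \<Rightarrow> tm \<Rightarrow> tm \<Rightarrow> bool" where
  "eqv T0 s t \<longleftrightarrow> nm s = nm t"
| "eqv (\<sigma> \<^bold>\<rightarrow> \<tau>) s t \<longleftrightarrow> (\<forall>a\<in>elts \<sigma>. eqv \<tau> (s \<^bold>\<cdot> a) (t \<^bold>\<cdot> a))"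

lemma eqv_trans: "eqv \<sigma> s t \<Longrightarrow> eqv \<sigma> t u \<Longrightarrow> eqv \<sigma> s u"
  by (induction \<sigma> arbitrary: s t u) fastforce+

text \<open>A scheme at level \<open>n\<close> binds the variable with index \<open>n\<close>. The
  outer terms in it satisfy \<open>bnd n\<close>, so updating the environment at \<open>n\<close>
  does not affect them.\<close>

definition bnd :: "nat \<Rightarrow> tm \<Rightarrow> bool" where
  "bnd n t \<longleftrightarrow> (\<forall>k \<tau>. (k, \<tau>) \<in> tm_vars t \<longrightarrow> k < n)"

lemma bnd_simps [simp]:
  "bnd n (Var k \<sigma>) \<longleftrightarrow> k < n" "bnd n (Cst c)" "bnd n (s \<^bold>\<cdot> t) \<longleftrightarrow> bnd n s \<and> bnd n t"
  by (auto simp: bnd_def)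

lemma bnd_Suc [simp]: "bnd n t \<Longrightarrow> bnd (Suc n) t"
  by (fastforce simp: bnd_def)

lemma ev_upd_fresh [simp]: "bnd n t \<Longrightarrow> ev (e((n, \<sigma>) := a)) t = ev e t"
  by (rule ev_cong) (auto simp: bnd_def)

lemma ev_ev: "ev e (ev e' t) = ev (\<lambda>u. ev e (e' u)) t"
  by (induction t) auto

lemma ev_elts_id: "t \<in> elts \<sigma> \<Longrightarrow> (\<And>n \<tau>. odd n \<Longrightarrow> e (n, \<tau>) = Var n \<tau>) \<Longrightarrow> ev e t = t"
proof -
  assume "t \<in> elts \<sigma>" and e: "\<And>n \<tau>. odd n \<Longrightarrow> e (n, \<tau>) = Var n \<tau>"
  then have "\<forall>(n, \<tau>)\<in>tm_vars t. odd n" by (auto simp: elts_def)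
  then show ?thesis using e by (induction t) auto
qed

locale model =
  assumes mdl: mdl
begin

lemma eq_sem: "odd_env e \<Longrightarrow> has_ty s T0 \<Longrightarrow> has_ty t T0 \<Longrightarrow> sat TM e (FEq s t) \<longleftrightarrow> nm (ev e s) = nm (ev e t)"
  by (simp add: nm_sem[OF mdl] ev_elts)

lemma less_sem: "odd_env e \<Longrightarrow> has_ty s T0 \<Longrightarrow> has_ty t T0 \<Longrightarrow> sat TM e (FLess s t) \<longleftrightarrow> nm (ev e s) < nm (ev e t)"
  by (simp add: nm_sem[OF mdl] ev_elts)

lemma in_TM: "s \<in> elts T0 \<Longrightarrow> t \<in> elts T0 \<Longrightarrow> FEq s t \<in> TM \<longleftrightarrow> nm s = nm t"
  "s \<in> elts T0 \<Longrightarrow> t \<in> elts T0 \<Longrightarrow> FLess s t \<in> TM \<longleftrightarrow> nm s < nm t"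
  by (simp_all add: nm_sem[OF mdl])

lemma nm_ops [simp]:
  "nm \<^bold>0 = 0" "nm \<^bold>1 = 1"
  "s \<in> elts T0 \<Longrightarrow> t \<in> elts T0 \<Longrightarrow> nm (s \<^bold>+ t) = nm s + nm t"
  "s \<in> elts T0 \<Longrightarrow> t \<in> elts T0 \<Longrightarrow> nm (s \<^bold>* t) = nm s * nm t"
  by (simp_all add: nm_sem[OF mdl] nm_const[OF mdl])

definition tn :: "N \<Rightarrow> tm" where "tn x = (SOME t. t \<in> elts T0 \<and> nm t = x)"

lemma tn [simp]: "tn x \<in> elts T0" "nm (tn x) = x"
proof -
  obtain t where "t \<in> elts T0 \<and> nm t = x" using N_cases[OF mdl] by metis
  then have "tn x \<in> elts T0 \<and> nm (tn x) = x" unfolding tn_def by (rule someI)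
  then show "tn x \<in> elts T0" "nm (tn x) = x" by auto
qed

lemma sat_eq_at:
  assumes "odd_env e" "has_ty s \<sigma>" "has_ty t \<sigma>" "bnd n s" "bnd n t"
  shows "sat TM e (eq_at \<sigma> s t n) \<longleftrightarrow> eqv \<sigma> (ev e s) (ev e t)"
  using assms
proof (induction \<sigma> arbitrary: s t n e)
  case T0
  then show ?case using eq_sem[of e s t] by (simp add: scheme_defs)
next
  case (Arr \<sigma> \<tau>)
  have "sat TM (e((n, \<sigma>) := a)) (eq_at \<tau> (s \<^bold>\<cdot> Var n \<sigma>) (t \<^bold>\<cdot> Var n \<sigma>) (Suc n)) \<longleftrightarrow>
      eqv \<tau> (ev e s \<^bold>\<cdot> a) (ev e t \<^bold>\<cdot> a)" if "a \<in> elts \<sigma>" for a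
    using Arr.IH(2)[of "e((n, \<sigma>) := a)" "s \<^bold>\<cdot> Var n \<sigma>" "t \<^bold>\<cdot> Var n \<sigma>" "Suc n"] Arr.prems that
    by (auto simp: odd_env_upd has_ty_App simp del: fun_upd_apply) (auto simp: odd_env_upd)
  then show ?case by (simp add: s_all_def)
qed

lemma K_eqv: assumes "x \<in> elts \<sigma>" "y \<in> elts \<tau>" shows "eqv \<sigma> (Cst (Comb_K \<sigma> \<tau>) \<^bold>\<cdot> x \<^bold>\<cdot> y) x"
proof -
  let ?e = "oenv0((0, \<sigma>) := x, (Suc 0, \<tau>) := y)"
  have "K_axiom \<sigma> \<tau> \<in> ACA0_omega" unfolding ACA0_omega_def RCA0_omega_def by blast
  then have "sat TM oenv0 (K_axiom \<sigma> \<tau>)" by (rule sat_TM2[OF mdl])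
  then have "sat TM ?e (eq_at \<sigma> (Cst (Comb_K \<sigma> \<tau>) \<^bold>\<cdot> Var 0 \<sigma> \<^bold>\<cdot> Var (Suc 0) \<tau>) (Var 0 \<sigma>) (Suc (Suc 0)))"
    using assms by (simp add: K_axiom_def s_all_def sentence_def)
  then show ?thesis using assms
    by (subst (asm) sat_eq_at) (auto simp: odd_oenv0 odd_env_upd has_ty_App simp del: fun_upd_apply, simp)
qed

lemma S_eqv:
  assumes "x \<in> elts (\<rho> \<^bold>\<rightarrow> \<sigma> \<^bold>\<rightarrow> \<tau>)" "y \<in> elts (\<rho> \<^bold>\<rightarrow> \<sigma>)" "z \<in> elts \<rho>"
  shows "eqv \<tau> (Cst (Comb_S \<rho> \<sigma> \<tau>) \<^bold>\<cdot> x \<^bold>\<cdot> y \<^bold>\<cdot> z) (x \<^bold>\<cdot> z \<^bold>\<cdot> (y \<^bold>\<cdot> z))"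
proof -
  let ?x = "Var 0 (\<rho> \<^bold>\<rightarrow> \<sigma> \<^bold>\<rightarrow> \<tau>)" and ?y = "Var (Suc 0) (\<rho> \<^bold>\<rightarrow> \<sigma>)" and ?z = "Var (Suc (Suc 0)) \<rho>"
  let ?e = "oenv0((0, \<rho> \<^bold>\<rightarrow> \<sigma> \<^bold>\<rightarrow> \<tau>) := x, (Suc 0, \<rho> \<^bold>\<rightarrow> \<sigma>) := y, (Suc (Suc 0), \<rho>) := z)"
  have "S_axiom \<rho> \<sigma> \<tau> \<in> ACA0_omega" unfolding ACA0_omega_def RCA0_omega_def by blast
  then have "sat TM oenv0 (S_axiom \<rho> \<sigma> \<tau>)" by (rule sat_TM2[OF mdl])
  then have "sat TM ?e (eq_at \<tau> (Cst (Comb_S \<rho> \<sigma> \<tau>) \<^bold>\<cdot> ?x \<^bold>\<cdot> ?y \<^bold>\<cdot> ?z) (?x \<^bold>\<cdot> ?z \<^bold>\<cdot> (?y \<^bold>\<cdot> ?z)) (Suc (Suc (Suc 0))))"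
    using assms by (simp add: S_axiom_def s_all_def sentence_def)
  then show ?thesis using assms
    by (subst (asm) sat_eq_at) (auto simp: odd_oenv0 odd_env_upd has_ty_App simp del: fun_upd_apply, simp)
qed

lemma ext_eqv:
  assumes "x \<in> elts \<rho>" "y \<in> elts \<rho>" "f \<in> elts (\<rho> \<^bold>\<rightarrow> \<tau>)" "eqv \<rho> x y"
  shows "eqv \<tau> (f \<^bold>\<cdot> x) (f \<^bold>\<cdot> y)"
proof -
  let ?x = "Var 0 \<rho>" and ?y = "Var (Suc 0) \<rho>" and ?f = "Var (Suc (Suc 0)) (\<rho> \<^bold>\<rightarrow> \<tau>)"
  let ?e = "oenv0((0, \<rho>) := x, (Suc 0, \<rho>) := y, (Suc (Suc 0), \<rho> \<^bold>\<rightarrow> \<tau>) := f)"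
  have "ext_axiom \<rho> \<tau> \<in> ACA0_omega" unfolding ACA0_omega_def RCA0_omega_def by blast
  then have "sat TM oenv0 (ext_axiom \<rho> \<tau>)" by (rule sat_TM2[OF mdl])
  then have "sat TM ?e (eq_at \<rho> ?x ?y (Suc (Suc (Suc 0)))) \<longrightarrow>
       sat TM ?e (eq_at \<tau> (?f \<^bold>\<cdot> ?x) (?f \<^bold>\<cdot> ?y) (Suc (Suc (Suc 0))))"
    using assms by (simp add: ext_axiom_def s_all_def s_imp_def sentence_def)
  moreover have e: "odd_env ?e" using assms by (simp add: odd_oenv0 odd_env_upd)
  ultimately show ?thesis using assms(4)
    using sat_eq_at[OF e, of ?x \<rho> ?y "Suc (Suc (Suc 0))"] sat_eq_at[OF e, of "?f \<^bold>\<cdot> ?x" \<tau> "?f \<^bold>\<cdot> ?y" "Suc (Suc (Suc 0))"]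
    by (simp add: has_ty_App)
qed

lemma R0_nm:
  assumes "f \<in> elts (T0 \<^bold>\<rightarrow> T0 \<^bold>\<rightarrow> T0)" "m \<in> elts T0" "n \<in> elts T0"
  shows "nm (Cst R0 \<^bold>\<cdot> f \<^bold>\<cdot> m \<^bold>\<cdot> \<^bold>0) = nm m"
    "nm (Cst R0 \<^bold>\<cdot> f \<^bold>\<cdot> m \<^bold>\<cdot> (n \<^bold>+ \<^bold>1)) = nm (f \<^bold>\<cdot> n \<^bold>\<cdot> (Cst R0 \<^bold>\<cdot> f \<^bold>\<cdot> m \<^bold>\<cdot> n))"
proof -
  have R: "Cst R0 \<^bold>\<cdot> f \<^bold>\<cdot> m \<^bold>\<cdot> k \<in> elts T0" if "k \<in> elts T0" for k
    by (rule elts_App[OF elts_App[OF elts_App]]) (use assms that in auto)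
  have fR: "f \<^bold>\<cdot> n \<^bold>\<cdot> (Cst R0 \<^bold>\<cdot> f \<^bold>\<cdot> m \<^bold>\<cdot> n) \<in> elts T0"
    by (rule elts_App[OF elts_App]) (use assms R in auto)
  have "\<forall>\<phi>\<in>R0_axioms. sat TM oenv0 \<phi>"
    by (intro ballI sat_TM2[OF mdl]) (auto simp: ACA0_omega_def RCA0_omega_def)
  then have "FEq (Cst R0 \<^bold>\<cdot> f \<^bold>\<cdot> m \<^bold>\<cdot> \<^bold>0) m \<in> TM \<and>
      FEq (Cst R0 \<^bold>\<cdot> f \<^bold>\<cdot> m \<^bold>\<cdot> (n \<^bold>+ \<^bold>1)) (f \<^bold>\<cdot> n \<^bold>\<cdot> (Cst R0 \<^bold>\<cdot> f \<^bold>\<cdot> m \<^bold>\<cdot> n)) \<in> TM"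
    unfolding R0_axioms_def using assms by (simp add: scheme_defs)
  then show "nm (Cst R0 \<^bold>\<cdot> f \<^bold>\<cdot> m \<^bold>\<cdot> \<^bold>0) = nm m"
    "nm (Cst R0 \<^bold>\<cdot> f \<^bold>\<cdot> m \<^bold>\<cdot> (n \<^bold>+ \<^bold>1)) = nm (f \<^bold>\<cdot> n \<^bold>\<cdot> (Cst R0 \<^bold>\<cdot> f \<^bold>\<cdot> m \<^bold>\<cdot> n))"
    using R fR assms by (simp_all add: in_TM)
qed

text \<open>Bracket abstraction: S K K for the variable itself, K for the other atoms, S for
  applications. The last case needs extensionality, because the argument of \<open>s\<close> is
  known only up to \<open>eqv\<close>.\<close>

lemma abstraction:
  assumes "has_ty t \<tau>"
  shows "\<exists>t'. has_ty t' (\<sigma> \<^bold>\<rightarrow> \<tau>) \<and> tm_vars t' \<subseteq> tm_vars t - {(n, \<sigma>)} \<and>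
    (\<forall>e a. odd_env e \<longrightarrow> a \<in> elts \<sigma> \<longrightarrow> eqv \<tau> (ev e t' \<^bold>\<cdot> a) (ev (e((n, \<sigma>) := a)) t))"
  using assms
proof (induction rule: has_ty.induct)
  case (1 k \<rho>)
  show ?case
  proof (cases "(k, \<rho>) = (n, \<sigma>)")
    case True
    let ?K1 = "Cst (Comb_K \<sigma> (\<sigma> \<^bold>\<rightarrow> \<sigma>))" and ?K2 = "Cst (Comb_K \<sigma> \<sigma>)"
    let ?I = "Cst (Comb_S \<sigma> (\<sigma> \<^bold>\<rightarrow> \<sigma>) \<sigma>) \<^bold>\<cdot> ?K1 \<^bold>\<cdot> ?K2"
    have "eqv \<sigma> (?I \<^bold>\<cdot> a) a" if a: "a \<in> elts \<sigma>" for a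
    proof (rule eqv_trans)
      show "eqv \<sigma> (?I \<^bold>\<cdot> a) (?K1 \<^bold>\<cdot> a \<^bold>\<cdot> (?K2 \<^bold>\<cdot> a))" by (rule S_eqv) (use a in auto)
      show "eqv \<sigma> (?K1 \<^bold>\<cdot> a \<^bold>\<cdot> (?K2 \<^bold>\<cdot> a)) a"
        by (rule K_eqv) (use a in \<open>auto intro!: elts_App[of "?K2" \<sigma>]\<close>)
    qed
    then show ?thesis using True by (intro exI[of _ ?I]) (auto simp: has_ty_App)
  next
    case False
    then show ?thesis
      by (intro exI[of _ "Cst (Comb_K \<rho> \<sigma>) \<^bold>\<cdot> Var k \<rho>"])
        (auto simp: has_ty_App odd_env_def intro!: K_eqv)
  qed
next
  case (2 c)
  then show ?case
    by (intro exI[of _ "Cst (Comb_K (cst_ty c) \<sigma>) \<^bold>\<cdot> Cst c"])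
      (auto simp: has_ty_App intro!: K_eqv elts_Cst)
next
  case (3 s \<rho> \<tau> t)
  obtain s' where s': "has_ty s' (\<sigma> \<^bold>\<rightarrow> \<rho> \<^bold>\<rightarrow> \<tau>)" "tm_vars s' \<subseteq> tm_vars s - {(n, \<sigma>)}"
    "\<And>e a. odd_env e \<Longrightarrow> a \<in> elts \<sigma> \<Longrightarrow> eqv (\<rho> \<^bold>\<rightarrow> \<tau>) (ev e s' \<^bold>\<cdot> a) (ev (e((n, \<sigma>) := a)) s)"
    using 3 by blast
  obtain t' where t': "has_ty t' (\<sigma> \<^bold>\<rightarrow> \<rho>)" "tm_vars t' \<subseteq> tm_vars t - {(n, \<sigma>)}"
    "\<And>e a. odd_env e \<Longrightarrow> a \<in> elts \<sigma> \<Longrightarrow> eqv \<rho> (ev e t' \<^bold>\<cdot> a) (ev (e((n, \<sigma>) := a)) t)"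
    using 3 by blast
  let ?u = "Cst (Comb_S \<sigma> \<rho> \<tau>) \<^bold>\<cdot> s' \<^bold>\<cdot> t'"
  have "eqv \<tau> (ev e ?u \<^bold>\<cdot> a) (ev (e((n, \<sigma>) := a)) (s \<^bold>\<cdot> t))" if e: "odd_env e" and a: "a \<in> elts \<sigma>" for e a
  proof -
    let ?e = "e((n, \<sigma>) := a)"
    have oe: "odd_env ?e" using e a by (simp add: odd_env_upd)
    have m: "ev e s' \<in> elts (\<sigma> \<^bold>\<rightarrow> \<rho> \<^bold>\<rightarrow> \<tau>)" "ev e t' \<in> elts (\<sigma> \<^bold>\<rightarrow> \<rho>)" "ev ?e s \<in> elts (\<rho> \<^bold>\<rightarrow> \<tau>)" "ev ?e t \<in> elts \<rho>"
      using ev_elts[OF e] ev_elts[OF oe] s' t' 3 by auto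
    have 1: "eqv \<tau> (ev e ?u \<^bold>\<cdot> a) (ev e s' \<^bold>\<cdot> a \<^bold>\<cdot> (ev e t' \<^bold>\<cdot> a))"
      using S_eqv[OF m(1,2) a] by simp
    have 2: "eqv \<tau> (ev e s' \<^bold>\<cdot> a \<^bold>\<cdot> (ev e t' \<^bold>\<cdot> a)) (ev ?e s \<^bold>\<cdot> (ev e t' \<^bold>\<cdot> a))"
      using s'(3)[OF e a] elts_App[OF m(2) a] by simp
    have "eqv \<tau> (ev ?e s \<^bold>\<cdot> (ev e t' \<^bold>\<cdot> a)) (ev ?e s \<^bold>\<cdot> ev ?e t)"
      by (rule ext_eqv[OF elts_App[OF m(2) a] m(4,3) t'(3)[OF e a]])
    from eqv_trans[OF eqv_trans[OF 1 2] this] show ?thesis by simp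
  qed
  moreover have "has_ty ?u (\<sigma> \<^bold>\<rightarrow> \<tau>)"
    by (rule has_ty.intros(3)[OF has_ty.intros(3)]) (use s' t' in auto)
  moreover have "tm_vars ?u \<subseteq> tm_vars (s \<^bold>\<cdot> t) - {(n, \<sigma>)}" using s'(2) t'(2) by auto
  ultimately show ?case by blast
qed

section \<open>Representable functions and arithmetical relations\<close>

text \<open>Number variables are the components of a stream \<open>v\<close>, with de Bruijn indices: component
  \<open>i\<close> is the value of the variable with index \<open>2 * i\<close>. Parameters of higher type are elements of the
  model, that is, terms with odd variables, and may occur in the representing terms.\<close>

definition E :: "(nat \<Rightarrow> N) \<Rightarrow> nat \<times> ty \<Rightarrow> tm" where
  "E v = (\<lambda>(n, \<sigma>). if odd n then Var n \<sigma> else if \<sigma> = T0 then tn (v (n div 2)) else Var 1 \<sigma>)"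

lemma odd_env_E [simp]: "odd_env (E v)"
  by (auto simp: odd_env_def E_def) (auto simp: elts_def)

lemma ev_E_elts [simp]: "t \<in> elts \<sigma> \<Longrightarrow> ev (E v) t = t"
  by (rule ev_elts_id) (auto simp: E_def)

lemma ev_E_tn [simp]: "ev (E v) (tn c) = tn c"
  by (rule ev_E_elts[of _ T0]) simp

definition rep :: "((nat \<Rightarrow> N) \<Rightarrow> N) \<Rightarrow> bool" where
  "rep h \<longleftrightarrow> (\<exists>p. has_ty p T0 \<and> (\<forall>v. nm (ev (E v) p) = h v))"

lemma elts_has_ty: "t \<in> elts \<sigma> \<Longrightarrow> has_ty t \<sigma>"
  by (simp add: elts_def)

lemma rep_var [simp]: "rep (\<lambda>v. v i)"
  unfolding rep_def by (intro exI[of _ "Var (2 * i) T0"]) (simp add: E_def)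

lemma rep_const [simp]: "rep (\<lambda>v. c)"
  unfolding rep_def by (intro exI[of _ "tn c"]) (auto simp: elts_has_ty)

lemma rep_plus [intro]: "rep f \<Longrightarrow> rep g \<Longrightarrow> rep (\<lambda>v. f v + g v)"
  and rep_times [intro]: "rep f \<Longrightarrow> rep g \<Longrightarrow> rep (\<lambda>v. f v * g v)"
proof -
  assume "rep f" "rep g"
  then obtain p q where pq: "has_ty p T0" "\<And>v. nm (ev (E v) p) = f v" "has_ty q T0" "\<And>v. nm (ev (E v) q) = g v"
    unfolding rep_def by blast
  have "ev (E v) p \<in> elts T0" "ev (E v) q \<in> elts T0" for v using pq ev_elts by auto
  then show "rep (\<lambda>v. f v + g v)" "rep (\<lambda>v. f v * g v)"
    unfolding rep_def by (intro exI[of _ "p \<^bold>+ q"] exI[of _ "p \<^bold>* q"], simp add: pq)+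
qed

definition fn :: "tm \<Rightarrow> N \<Rightarrow> N" where "fn x n = nm (x \<^bold>\<cdot> tn n)"

lemma nm_cong:
  assumes "x \<in> elts T0" "y \<in> elts T0" "f \<in> elts (T0 \<^bold>\<rightarrow> \<tau>)" "nm x = nm y"
  shows "eqv \<tau> (f \<^bold>\<cdot> x) (f \<^bold>\<cdot> y)"
  using ext_eqv[of x T0 y f \<tau>] assms by simp

lemma fn_nm: "x \<in> elts T1 \<Longrightarrow> t \<in> elts T0 \<Longrightarrow> nm (x \<^bold>\<cdot> t) = fn x (nm t)"
  using nm_cong[of t "tn (nm t)" x T0] by (simp add: fn_def)

lemma rep_fn [intro]: "x \<in> elts T1 \<Longrightarrow> rep h \<Longrightarrow> rep (\<lambda>v. fn x (h v))"
  unfolding rep_def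
proof (elim exE conjE)
  fix p assume p: "x \<in> elts T1" "has_ty p T0" "\<forall>v. nm (ev (E v) p) = h v"
  then have "nm (ev (E v) (x \<^bold>\<cdot> p)) = fn x (h v)" for v
    using ev_elts[OF odd_env_E p(2)] by (simp add: fn_nm)
  then show "\<exists>p. has_ty p T0 \<and> (\<forall>v. nm (ev (E v) p) = fn x (h v))"
    using p by (intro exI[of _ "x \<^bold>\<cdot> p"]) (auto intro: has_ty.intros(3) elts_has_ty)
qed

text \<open>Lambda abstraction over component 0, uniformly in the remaining components.
  Comprehension, substitution, quantifiers and choice all go through this term.\<close>

lemma rep_abs:
  assumes "rep (\<lambda>v. Q (v 0) (\<lambda>n. v (Suc n)))"
  shows "\<exists>p. has_ty p T1 \<and> (\<forall>v. ev (E v) p \<in> elts T1 \<and> (\<forall>a. fn (ev (E v) p) a = Q a v))"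
proof -
  obtain p where p: "has_ty p T0" "\<And>v. nm (ev (E v) p) = Q (v 0) (\<lambda>n. v (Suc n))"
    using assms unfolding rep_def by blast
  obtain p' where p': "has_ty p' T1" "tm_vars p' \<subseteq> tm_vars p - {(0, T0)}"
    "\<And>e a. odd_env e \<Longrightarrow> a \<in> elts T0 \<Longrightarrow> nm (ev e p' \<^bold>\<cdot> a) = nm (ev (e((0, T0) := a)) p)"
    using abstraction[OF p(1), of T0 0] by auto
  \<comment> \<open>The other components sit one place too high in \<open>p'\<close>;
    \<open>sh\<close> moves index \<open>2 * Suc k\<close> down to \<open>2 * k\<close>. The
    variable of type 0 with index 0 does not occur in \<open>p'\<close>.\<close>
  define sh where "sh = (\<lambda>(n::nat, \<sigma>). if even n \<and> \<sigma> = T0 then Var (n - 2) \<sigma> else Var n \<sigma>)"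
  have "has_ty (ev sh p') T1"
    by (rule has_ty_ev[OF p'(1)]) (auto simp: typed_env_def sh_def)
  moreover have "nm (ev (E v) (ev sh p') \<^bold>\<cdot> tn a) = Q a v" for v a
  proof -
    let ?v = "case_nat a v"
    have "ev (E v) (ev sh p') = ev (E ?v) p'"
      unfolding ev_ev
    proof (rule ev_cong)
      fix u assume "u \<in> tm_vars p'"
      then have "u \<noteq> (0, T0)" using p'(2) by blast
      then obtain n \<sigma> where u: "u = (n, \<sigma>)" "n \<noteq> 0 \<or> \<sigma> \<noteq> T0" by (cases u) auto
      show "ev (E v) (sh u) = E ?v u"
      proof (cases "even n \<and> \<sigma> = T0")
        case True
        then obtain k where "n = 2 * Suc k" using u by (metis evenE not0_implies_Suc mult_0_right)
        then show ?thesis using True u by (simp add: sh_def E_def)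
      next
        case False then show ?thesis using u by (auto simp: sh_def E_def)
      qed
    qed
    moreover have "(E ?v)((0, T0) := tn a) = E ?v" by (auto simp: E_def)
    ultimately show ?thesis using p'(3)[of "E ?v" "tn a"] p(2)[of ?v] by simp
  qed
  ultimately show ?thesis using ev_elts[OF odd_env_E] by (intro exI[of _ "ev sh p'"]) (simp add: fn_def)
qed

lemma comprehension:
  assumes "rep (\<lambda>v. h (v 0))"
  shows "\<exists>x\<in>elts T1. \<forall>n. fn x n = h n"
  using rep_abs[of "\<lambda>a _. h a", OF assms] by blast

lemma rep_subst:
  assumes "rep (\<lambda>v. Q (v 0) (\<lambda>n. v (Suc n)))" "rep g"
  shows "rep (\<lambda>v. Q (g v) v)"
proof -
  obtain p where p: "has_ty p T1" "\<And>v. ev (E v) p \<in> elts T1" "\<And>v a. fn (ev (E v) p) a = Q a v"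
    using rep_abs[OF assms(1)] by blast
  obtain q where q: "has_ty q T0" "\<And>v. nm (ev (E v) q) = g v" using assms unfolding rep_def by blast
  have "nm (ev (E v) (p \<^bold>\<cdot> q)) = Q (g v) v" for v
    using fn_nm[OF p(2) ev_elts[OF odd_env_E q(1)]] by (simp add: p q)
  then show ?thesis unfolding rep_def using p q by (intro exI[of _ "p \<^bold>\<cdot> q"]) (auto simp: has_ty_App)
qed

lemma rep_ren: "rep h \<Longrightarrow> rep (\<lambda>v. h (\<lambda>n. v (r n)))"
  unfolding rep_def
proof (elim exE conjE)
  fix p assume p: "has_ty p T0" "\<forall>v. nm (ev (E v) p) = h v"
  define sh where "sh = (\<lambda>(n, \<sigma>). if even n \<and> \<sigma> = T0 then Var (2 * r (n div 2)) \<sigma> else Var n \<sigma>)"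
  have "(\<lambda>u. ev (E v) (sh u)) = E (\<lambda>n. v (r n))" for v by (auto simp: sh_def E_def)
  then have "nm (ev (E v) (ev sh p)) = h (\<lambda>n. v (r n))" for v using p by (simp add: ev_ev)
  moreover have "has_ty (ev sh p) T0"
    by (rule has_ty_ev[OF p(1)]) (auto simp: typed_env_def sh_def)
  ultimately show "\<exists>p. has_ty p T0 \<and> (\<forall>v. nm (ev (E v) p) = h (\<lambda>n. v (r n)))" by blast
qed

section \<open>Primitive recursion and definition by cases\<close>

definition RR :: "tm \<Rightarrow> N \<Rightarrow> N \<Rightarrow> N" where "RR f m n = nm (Cst R0 \<^bold>\<cdot> f \<^bold>\<cdot> tn m \<^bold>\<cdot> tn n)"

lemma R0_elts [simp]:
  "f \<in> elts (T0 \<^bold>\<rightarrow> T0 \<^bold>\<rightarrow> T0) \<Longrightarrow> m \<in> elts T0 \<Longrightarrow> Cst R0 \<^bold>\<cdot> f \<^bold>\<cdot> m \<in> elts T1"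
  "f \<in> elts (T0 \<^bold>\<rightarrow> T0 \<^bold>\<rightarrow> T0) \<Longrightarrow> m \<in> elts T0 \<Longrightarrow> n \<in> elts T0 \<Longrightarrow> Cst R0 \<^bold>\<cdot> f \<^bold>\<cdot> m \<^bold>\<cdot> n \<in> elts T0"
  "f \<in> elts (T0 \<^bold>\<rightarrow> T0 \<^bold>\<rightarrow> T0) \<Longrightarrow> Cst R0 \<^bold>\<cdot> f \<in> elts (T0 \<^bold>\<rightarrow> T0 \<^bold>\<rightarrow> T0)"
  by (meson elts_App elts_ops)+

definition fn2 :: "tm \<Rightarrow> N \<Rightarrow> N \<Rightarrow> N" where "fn2 f m n = nm (f \<^bold>\<cdot> tn m \<^bold>\<cdot> tn n)"

lemma fn2_nm:
  assumes "f \<in> elts (T0 \<^bold>\<rightarrow> T0 \<^bold>\<rightarrow> T0)" "m \<in> elts T0" "n \<in> elts T0"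
  shows "nm (f \<^bold>\<cdot> m \<^bold>\<cdot> n) = fn2 f (nm m) (nm n)"
proof -
  have "eqv T1 (f \<^bold>\<cdot> m) (f \<^bold>\<cdot> tn (nm m))" by (rule nm_cong) (use assms in auto)
  then have "nm (f \<^bold>\<cdot> m \<^bold>\<cdot> n) = nm (f \<^bold>\<cdot> tn (nm m) \<^bold>\<cdot> n)" using assms by simp
  also have "\<dots> = fn2 f (nm m) (nm n)"
    using fn_nm[of "f \<^bold>\<cdot> tn (nm m)" n] assms by (simp add: fn2_def fn_def)
  finally show ?thesis .
qed

lemma RR_simps:
  assumes "f \<in> elts (T0 \<^bold>\<rightarrow> T0 \<^bold>\<rightarrow> T0)"
  shows "RR f m 0 = m" "RR f m (n + 1) = fn2 f n (RR f m n)"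
proof -
  have *: "RR f m (nm k) = nm (Cst R0 \<^bold>\<cdot> f \<^bold>\<cdot> tn m \<^bold>\<cdot> k)" if "k \<in> elts T0" for k
    using fn_nm[of "Cst R0 \<^bold>\<cdot> f \<^bold>\<cdot> tn m" k] assms that by (simp add: RR_def fn_def)
  show "RR f m 0 = m" using *[of "\<^bold>0"] R0_nm(1)[OF assms, of "tn m" "\<^bold>0"] by simp
  show "RR f m (n + 1) = fn2 f n (RR f m n)"
    using *[of "tn n \<^bold>+ \<^bold>1"] R0_nm(2)[OF assms, of "tn m" "tn n"] fn2_nm[OF assms, of "tn n" "Cst R0 \<^bold>\<cdot> f \<^bold>\<cdot> tn m \<^bold>\<cdot> tn n"] assms
    by (simp add: RR_def)
qed

lemma rep_fn2: "f \<in> elts (T0 \<^bold>\<rightarrow> T0 \<^bold>\<rightarrow> T0) \<Longrightarrow> rep g \<Longrightarrow> rep h \<Longrightarrow> rep (\<lambda>v. fn2 f (g v) (h v))"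
proof -
  assume f: "f \<in> elts (T0 \<^bold>\<rightarrow> T0 \<^bold>\<rightarrow> T0)" and "rep g" "rep h"
  then obtain p q where pq: "has_ty p T0" "\<And>v. nm (ev (E v) p) = g v" "has_ty q T0" "\<And>v. nm (ev (E v) q) = h v"
    unfolding rep_def by blast
  have "nm (ev (E v) (f \<^bold>\<cdot> p \<^bold>\<cdot> q)) = fn2 f (g v) (h v)" for v
    using fn2_nm[OF f ev_elts[OF odd_env_E pq(1)] ev_elts[OF odd_env_E pq(3)]] f by (simp add: pq)
  then show ?thesis unfolding rep_def using f pq
    by (intro exI[of _ "f \<^bold>\<cdot> p \<^bold>\<cdot> q"]) (auto intro: has_ty.intros(3) elts_has_ty)
qed

lemma rep_RR: "f \<in> elts (T0 \<^bold>\<rightarrow> T0 \<^bold>\<rightarrow> T0) \<Longrightarrow> rep g \<Longrightarrow> rep h \<Longrightarrow> rep (\<lambda>v. RR f (g v) (h v))"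
  using rep_fn2[of "Cst R0 \<^bold>\<cdot> f" g h] by (simp add: RR_def fn2_def)

lemma comprehension2:
  assumes "rep (\<lambda>v. h (v 0) (v 1))"
  shows "\<exists>f\<in>elts (T0 \<^bold>\<rightarrow> T0 \<^bold>\<rightarrow> T0). \<forall>m n. fn2 f m n = h m n"
proof -
  obtain p where p: "has_ty p T0" "\<And>v. nm (ev (E v) p) = h (v 0) (v 1)"
    using assms unfolding rep_def by blast
  obtain p1 where p1: "has_ty p1 T1" 
    "\<And>e a. odd_env e \<Longrightarrow> a \<in> elts T0 \<Longrightarrow> nm (ev e p1 \<^bold>\<cdot> a) = nm (ev (e((2, T0) := a)) p)"
    using abstraction[OF p(1), of T0 2] by auto
  obtain p2 where p2: "has_ty p2 (T0 \<^bold>\<rightarrow> T1)" 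
    "\<And>e a. odd_env e \<Longrightarrow> a \<in> elts T0 \<Longrightarrow> eqv T1 (ev e p2 \<^bold>\<cdot> a) (ev (e((0, T0) := a)) p1)"
    using abstraction[OF p1(1), of T0 0] by auto
  let ?f = "ev (E (\<lambda>_. 0)) p2"
  have "fn2 ?f m n = h m n" for m n
  proof -
    let ?e = "(E (\<lambda>_. 0))((0, T0) := tn m)" and ?v = "case_nat m (case_nat n (\<lambda>_. 0))"
    have "fn2 ?f m n = nm (ev ?e p1 \<^bold>\<cdot> tn n)" using p2(2)[of "E (\<lambda>_. 0)" "tn m"] by (simp add: fn2_def)
    also have "\<dots> = nm (ev (?e((2, T0) := tn n)) p)" by (rule p1(2)) (auto simp: odd_env_upd)
    also have "?e((2, T0) := tn n) = E ?v"
    proof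
      fix u :: "nat \<times> ty" obtain k \<sigma> where u: "u = (k, \<sigma>)" by (cases u)
      have "k = 2 * Suc (Suc (k div 2 - 2))" if "even k" "k \<noteq> 0" "k \<noteq> 2" using that by presburger
      then consider "odd k" | "k = 0" | "k = 2" | j where "k = 2 * Suc (Suc j)" by blast
      then show "(?e((2, T0) := tn n)) u = E ?v u"
        by cases (auto simp: u E_def)
    qed
    finally show ?thesis by (simp add: p(2))
  qed
  then show ?thesis using ev_elts[OF odd_env_E p2(1)] by blast
qed

text \<open>Recursion along possibly nonstandard numbers: the sequence exists because the model has
  the recursor, so \<open>step\<close> has to be given by a term.\<close>

lemma prim_recursion:
  assumes "rep (\<lambda>v. step (v 0) (v 1))"
  shows "\<exists>x\<in>elts T1. fn x 0 = a \<and> (\<forall>n. fn x (n + 1) = step n (fn x n))"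
proof -
  obtain f where f: "f \<in> elts (T0 \<^bold>\<rightarrow> T0 \<^bold>\<rightarrow> T0)" "\<And>m n. fn2 f m n = step m n"
    using comprehension2[OF assms] by blast
  have "rep (\<lambda>v. RR f a (v 0))" using f by (intro rep_RR) auto
  then obtain x where "x \<in> elts T1" "\<And>n. fn x n = RR f a n"
    using comprehension[of "RR f a"] by blast
  then show ?thesis using RR_simps[OF f(1)] f(2) by (intro bexI[of _ x]) auto
qed

text \<open>A recursion that starts with \<open>a\<close> and whose step is constantly
  \<open>b\<close>.\<close>

lemma rep_cond: "rep c \<Longrightarrow> rep a \<Longrightarrow> rep b \<Longrightarrow> rep (\<lambda>v. if c v = 0 then a v else b v)"
proof -
  assume "rep c" "rep a" "rep b"
  then obtain p q r where pq: "has_ty p T0" "\<And>v. nm (ev (E v) p) = c v" "has_ty q T0" "\<And>v. nm (ev (E v) q) = a v"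
    "has_ty r T0" "\<And>v. nm (ev (E v) r) = b v"
    unfolding rep_def by blast
  let ?K = "Cst (Comb_K T0 T0)" and ?K1 = "Cst (Comb_K T1 T0)"
  have "nm (ev (E v) (Cst R0 \<^bold>\<cdot> (?K1 \<^bold>\<cdot> (?K \<^bold>\<cdot> r)) \<^bold>\<cdot> q \<^bold>\<cdot> p)) = (if c v = 0 then a v else b v)" for v
  proof -
    let ?p = "ev (E v) p" and ?q = "ev (E v) q" and ?r = "ev (E v) r"
    let ?f = "?K1 \<^bold>\<cdot> (?K \<^bold>\<cdot> ?r)"
    have m: "?p \<in> elts T0" "?q \<in> elts T0" "?r \<in> elts T0" using ev_elts[OF odd_env_E] pq by auto
    have K: "?K \<^bold>\<cdot> ?r \<in> elts T1" by (meson elts_App elts_ops m)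
    then have f: "?f \<in> elts (T0 \<^bold>\<rightarrow> T0 \<^bold>\<rightarrow> T0)" by (meson elts_App elts_ops)
    have fv: "fn2 ?f x y = b v" for x y
      using K_eqv[OF K, of "tn x" T0] K_eqv[OF m(3), of "tn y" T0] pq(6) by (simp add: fn2_def)
    have "nm (Cst R0 \<^bold>\<cdot> ?f \<^bold>\<cdot> ?q \<^bold>\<cdot> ?p) = RR ?f (a v) (c v)"
      using fn2_nm[of "Cst R0 \<^bold>\<cdot> ?f" ?q ?p] f m pq by (simp add: RR_def fn2_def)
    also have "\<dots> = (if c v = 0 then a v else b v)"
    proof (cases "c v = 0")
      case False
      then obtain k where "c v = k + 1"
        by (metis N_le_iff N_less_iff N_pos_iff add.commute add_0)
      then show ?thesis using RR_simps(2)[OF f] fv False by simp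
    qed (simp add: RR_simps[OF f])
    finally show ?thesis by simp
  qed
  then show ?thesis unfolding rep_def using pq
    by (intro exI[of _ "Cst R0 \<^bold>\<cdot> (?K1 \<^bold>\<cdot> (?K \<^bold>\<cdot> r)) \<^bold>\<cdot> q \<^bold>\<cdot> p"]) (auto simp: has_ty_App)
qed

subsection \<open>Induction\<close>

text \<open>Serves before subtraction is available: the characteristic term of an inequality is
  built from subtraction, whereas QF-IND applies at once to a quantifier-free formula.\<close>

definition qrel :: "((nat \<Rightarrow> N) \<Rightarrow> bool) \<Rightarrow> bool" where
  "qrel P \<longleftrightarrow> (\<exists>\<phi>. qf \<phi> \<and> wff \<phi> \<and> (\<forall>v. sat TM (E v) \<phi> \<longleftrightarrow> P v))"

lemma qrel_eq: "rep f \<Longrightarrow> rep g \<Longrightarrow> qrel (\<lambda>v. f v = g v)"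
  and qrel_less: "rep f \<Longrightarrow> rep g \<Longrightarrow> qrel (\<lambda>v. f v < g v)"
proof -
  assume "rep f" "rep g"
  then obtain p q where pq: "has_ty p T0" "\<And>v. nm (ev (E v) p) = f v" "has_ty q T0" "\<And>v. nm (ev (E v) q) = g v"
    unfolding rep_def by blast
  show "qrel (\<lambda>v. f v = g v)" unfolding qrel_def
    using pq eq_sem[OF odd_env_E pq(1,3)] by (intro exI[of _ "FEq p q"]) auto
  show "qrel (\<lambda>v. f v < g v)" unfolding qrel_def
    using pq less_sem[OF odd_env_E pq(1,3)] by (intro exI[of _ "FLess p q"]) auto
qed

lemma qrel_imp: "qrel P \<Longrightarrow> qrel Q \<Longrightarrow> qrel (\<lambda>v. P v \<longrightarrow> Q v)"
  unfolding qrel_def by (metis qf.simps(4) sat.simps(4) wff.simps(4))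

lemma qrel_not: "qrel P \<Longrightarrow> qrel (\<lambda>v. \<not> P v)"
  using qrel_imp[of P "\<lambda>_. False"] qrel_less[of "\<lambda>_. 0" "\<lambda>_. 0"] by simp

lemma qrel_conj: "qrel P \<Longrightarrow> qrel Q \<Longrightarrow> qrel (\<lambda>v. P v \<and> Q v)"
  using qrel_not[OF qrel_imp[OF _ qrel_not], of P Q] by simp

lemma sat_subst_qf: "qf \<phi> \<Longrightarrow> sat TM e (subst v t \<phi>) \<longleftrightarrow> sat TM (e(v := ev e t)) \<phi>"
  by (induction \<phi>) (auto simp: ev_tm_subst simp del: fun_upd_apply)

lemma E_upd: "(E v)((0, T0) := tn a) = E (v(0 := a))"
  by (auto simp: E_def fun_eq_iff elim!: evenE)

text \<open>Quantifiers range over terms, while \<open>E\<close> inserts only the representatives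
  \<open>tn\<close>. By \<open>abstraction\<close> and extensionality a quantifier-free formula sees
  nothing of a number term but its value.\<close>

lemma sat_cong_T0:
  assumes "qf \<phi>" "wff \<phi>" "odd_env e" "s \<in> elts T0" "t \<in> elts T0" "nm s = nm t"
  shows "sat TM (e((n, T0) := s)) \<phi> \<longleftrightarrow> sat TM (e((n, T0) := t)) \<phi>"
  using assms(1,2)
proof (induction \<phi>)
  have *: "nm (ev (e((n, T0) := s)) u) = nm (ev (e((n, T0) := t)) u)" if "has_ty u T0" for u
  proof -
    obtain u' where u': "has_ty u' T1"
      "\<And>a. a \<in> elts T0 \<Longrightarrow> nm (ev e u' \<^bold>\<cdot> a) = nm (ev (e((n, T0) := a)) u)"
      using abstraction[OF \<open>has_ty u T0\<close>, of T0 n] assms(3) by auto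
    then show ?thesis
      using u'(2)[OF assms(4)] u'(2)[OF assms(5)] fn_nm[OF ev_elts[OF assms(3) u'(1)]] assms(4-6) by simp
  qed
  have o: "odd_env (e((n, T0) := s))" "odd_env (e((n, T0) := t))" using assms by (simp_all add: odd_env_upd)
  {
    case (FEq u w)
    then show ?case using *[of u] *[of w] eq_sem[OF o(1), of u w] eq_sem[OF o(2), of u w]
      by (simp del: fun_upd_apply sat.simps)
  next
    case (FLess u w)
    then show ?case using *[of u] *[of w] less_sem[OF o(1), of u w] less_sem[OF o(2), of u w]
      by (simp del: fun_upd_apply sat.simps)
  }
qed auto

lemma qrel_induct:
  assumes "qrel (\<lambda>v. P (v 0))" "P 0" "\<And>n. P n \<Longrightarrow> P (n + 1)"
  shows "P n"
proof -
  obtain \<phi> where \<phi>: "qf \<phi>" "wff \<phi>" "\<And>v. sat TM (E v) \<phi> \<longleftrightarrow> P (v 0)"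
    using assms(1) unfolding qrel_def by blast
  let ?e = "E (\<lambda>_. 0)"
  have P: "sat TM (?e((0, T0) := t)) \<phi> \<longleftrightarrow> P (nm t)" if "t \<in> elts T0" for t
  proof -
    have "sat TM (?e((0, T0) := t)) \<phi> \<longleftrightarrow> sat TM (?e((0, T0) := tn (nm t))) \<phi>"
      by (rule sat_cong_T0) (use \<phi> that in auto)
    also have "\<dots> \<longleftrightarrow> P (nm t)" unfolding E_upd by (simp add: \<phi>)
    finally show ?thesis .
  qed
  have S0: "sat TM ?e (subst (0, T0) \<^bold>0 \<phi>) \<longleftrightarrow> P 0"
    using P[of "\<^bold>0"] by (simp only: sat_subst_qf[OF \<phi>(1)] ev.simps nm_ops elts_ops)
  have S1: "sat TM (?e((0, T0) := t)) (subst (0, T0) (Var 0 T0 \<^bold>+ \<^bold>1) \<phi>) \<longleftrightarrow> P (nm t + 1)" if "t \<in> elts T0" for t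
    using P[of "t \<^bold>+ \<^bold>1"] that by (simp add: sat_subst_qf[OF \<phi>(1)])
  have "induction_axiom 0 \<phi> \<in> ACA0_omega"
    unfolding ACA0_omega_def RCA0_omega_def QF_IND_def using \<phi> by blast
  then have "sat TM ?e (induction_axiom 0 \<phi>)" by (intro sat_TM[OF mdl]) auto
  then have "P 0 \<longrightarrow> (\<forall>t\<in>elts T0. P (nm t) \<longrightarrow> P (nm t + 1)) \<longrightarrow> (\<forall>t\<in>elts T0. P (nm t))"
    unfolding induction_axiom_def by (simp only: sat.simps S0 S1 P cong: ball_cong)
  then show ?thesis using assms(2,3) tn[of n] by metis
qed

subsection \<open>Arithmetical relations\<close>

text \<open>A characteristic term, with 0 for true to match \<open>exists2\<close>. These are the
  relations arithmetical in parameters of any type.\<close>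

definition ard :: "((nat \<Rightarrow> N) \<Rightarrow> bool) \<Rightarrow> bool" where
  "ard P \<longleftrightarrow> rep (\<lambda>v. if P v then 0 else 1)"

lemma rep_if:
  assumes "ard P" "rep a" "rep b" shows "rep (\<lambda>v. if P v then a v else b v)"
proof -
  have "(\<lambda>v. if P v then a v else b v) = (\<lambda>v. if (if P v then 0 else 1 :: N) = 0 then a v else b v)" by auto
  then show ?thesis using rep_cond[OF _ assms(2,3), of "\<lambda>v. if P v then 0 else 1"] assms(1) by (simp add: ard_def)
qed

lemma ard_not: assumes "ard P" shows "ard (\<lambda>v. \<not> P v)"
proof -
  have "(\<lambda>v. if \<not> P v then 0 else 1 :: N) = (\<lambda>v. if P v then 1 else 0)" by auto
  then show ?thesis unfolding ard_def using rep_if[OF assms, of "\<lambda>_. 1" "\<lambda>_. 0"] by simp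
qed

lemma ard_conj: assumes "ard P" "ard Q" shows "ard (\<lambda>v. P v \<and> Q v)"
proof -
  have "(\<lambda>v. if P v \<and> Q v then 0 else 1 :: N) = (\<lambda>v. if P v then (if Q v then 0 else 1) else 1)" by auto
  then show ?thesis unfolding ard_def using rep_if[OF assms(1), of "\<lambda>v. if Q v then 0 else 1" "\<lambda>_. 1"] assms(2)
    by (simp add: ard_def)
qed

lemma ard_imp: "ard P \<Longrightarrow> ard Q \<Longrightarrow> ard (\<lambda>v. P v \<longrightarrow> Q v)"
  using ard_not[OF ard_conj[OF _ ard_not], of P Q] by simp

lemma ard_disj: "ard P \<Longrightarrow> ard Q \<Longrightarrow> ard (\<lambda>v. P v \<or> Q v)"
  using ard_imp[OF ard_not, of P Q] by (simp add: disj_imp)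

lemma ard_const: "ard (\<lambda>v. b)"
  unfolding ard_def by (cases b) auto

lemma N_diff_eq_0: "(a::N) \<le> b \<Longrightarrow> a - b = 0"
  by (cases "a = b") (auto simp: minus_N_def)

lemma rep_pd: "rep h \<Longrightarrow> rep (\<lambda>v. h v - 1)"
proof -
  obtain x where x: "x \<in> elts T1" "fn x 0 = 0" "\<And>n. fn x (n + 1) = n"
    using prim_recursion[of "\<lambda>n m. n" 0] by auto
  have "fn x n = n - 1" for n
  proof (cases "n = 0")
    case False
    then obtain k where "n = k + 1" by (metis N_le_iff N_less_iff N_pos_iff add.commute add_0)
    then show ?thesis using x by simp
  qed (simp add: x N_diff_eq_0)
  then show "rep h \<Longrightarrow> ?thesis" using rep_fn[OF x(1)] by simp
qed

text \<open>Iterated predecessor. Its agreement with subtraction is shown by quantifier-free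
  induction, so the invariant is phrased with sums and strict inequalities between number
  terms.\<close>

lemma rep_minus: "rep g \<Longrightarrow> rep h \<Longrightarrow> rep (\<lambda>v. g v - h v)"
proof -
  have "rep (\<lambda>v. v 1 - 1)" by (rule rep_pd) simp
  then obtain f where f: "f \<in> elts (T0 \<^bold>\<rightarrow> T0 \<^bold>\<rightarrow> T0)" "\<And>n m. fn2 f n m = m - 1"
    using comprehension2[of "\<lambda>n m. m - 1"] by blast
  note R = RR_simps[OF f(1), unfolded f(2)]
  have I: "(\<not> m < n \<longrightarrow> RR f m n + n = m) \<and> (\<not> n < m \<longrightarrow> RR f m n = 0)" for m n
  proof (rule qrel_induct[of "\<lambda>n. (\<not> m < n \<longrightarrow> RR f m n + n = m) \<and> (\<not> n < m \<longrightarrow> RR f m n = 0)"])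
    show "qrel (\<lambda>v. (\<not> m < v 0 \<longrightarrow> RR f m (v 0) + v 0 = m) \<and> (\<not> v 0 < m \<longrightarrow> RR f m (v 0) = 0))"
      by (intro qrel_conj qrel_imp qrel_not qrel_eq qrel_less rep_plus rep_RR f rep_var rep_const)
    fix n assume IH: "(\<not> m < n \<longrightarrow> RR f m n + n = m) \<and> (\<not> n < m \<longrightarrow> RR f m n = 0)"
    consider "n + 1 < m" | "n + 1 = m" | "m \<le> n" using N_less_iff[of n m] by fastforce
    then show "(\<not> m < n + 1 \<longrightarrow> RR f m (n + 1) + (n + 1) = m) \<and> (\<not> n + 1 < m \<longrightarrow> RR f m (n + 1) = 0)"
    proof cases
      case 1
      then have nm: "n < m" using N_less_iff less_imp_le by blast
      then have *: "RR f m n + n = m" using IH by auto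
      then have "RR f m n \<noteq> 0" using nm by auto
      then obtain k where k: "RR f m n = k + 1" by (metis N_le_iff N_less_iff N_pos_iff add.commute add_0)
      then have a: "RR f m (n + 1) = k" using R(2)[of m n] by simp
      have b: "k + (n + 1) = m" using * k by (simp add: ac_simps)
      show ?thesis using 1 by (simp only: a b) auto
    next
      case 2
      then have "n < m" by auto
      then have "RR f m n + n = 1 + n" using IH 2 by (auto simp: add.commute)
      then have "RR f m (n + 1) = 0" using R(2)[of m n] by simp
      then show ?thesis using 2 by simp
    next
      case 3
      then have "RR f m n = 0" using IH by auto
      moreover have "m < n + 1" using 3 by (simp add: N_less_Suc)
      ultimately show ?thesis using R by (simp add: N_diff_eq_0)
    qed
  qed (auto simp: R N_pos_iff)
  have "RR f m n = m - n" for m n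
  proof (cases "n \<le> m")
    case True
    then have "RR f m n + n = m" using I[of m n] by (simp add: not_less)
    then show ?thesis by (metis add_diff_cancel_right')
  qed (use I[of m n] N_diff_eq_0[of m n] in \<open>auto simp: not_less not_le\<close>)
  then show "rep g \<Longrightarrow> rep h \<Longrightarrow> ?thesis" using rep_RR[OF f(1)] by simp
qed

lemma N_diff_eq_0_iff: "(a::N) - b = 0 \<longleftrightarrow> a \<le> b"
  by (metis N_diff_eq_0 add_0 le_add_diff_inverse2 linear)

lemma ard_le: assumes "rep f" "rep g" shows "ard (\<lambda>v. f v \<le> g v)"
  using rep_cond[OF rep_minus[OF assms] rep_const[of 0] rep_const[of 1]] by (simp add: ard_def N_diff_eq_0_iff)

lemma ard_less: assumes "rep f" "rep g" shows "ard (\<lambda>v. f v < g v)"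
  using ard_not[OF ard_le[OF assms(2,1)]] by (simp add: not_le)

lemma ard_eq: assumes "rep f" "rep g" shows "ard (\<lambda>v. f v = g v)"
  using ard_conj[OF ard_le[OF assms] ard_le[OF assms(2,1)]] by (simp add: order_eq_iff)

lemma elts_app [simp]:
  "x \<in> elts T1 \<Longrightarrow> n \<in> elts T0 \<Longrightarrow> x \<^bold>\<cdot> n \<in> elts T0"
  "X \<in> elts T2 \<Longrightarrow> x \<in> elts T1 \<Longrightarrow> X \<^bold>\<cdot> x \<in> elts T0"
  "f \<in> elts (T1 \<^bold>\<rightarrow> T1) \<Longrightarrow> x \<in> elts T1 \<Longrightarrow> f \<^bold>\<cdot> x \<in> elts T1"
  "F \<in> elts (T0 \<^bold>\<rightarrow> T1 \<^bold>\<rightarrow> T1) \<Longrightarrow> n \<in> elts T0 \<Longrightarrow> F \<^bold>\<cdot> n \<in> elts (T1 \<^bold>\<rightarrow> T1)"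
  "U \<in> elts (T0 \<^bold>\<rightarrow> T1 \<^bold>\<rightarrow> T0) \<Longrightarrow> n \<in> elts T0 \<Longrightarrow> U \<^bold>\<cdot> n \<in> elts T2"
  by (blast intro: elts_App)+

lemma ex_tn: "(\<exists>t\<in>elts T0. P (nm t)) \<longleftrightarrow> (\<exists>a. P a)" "(\<forall>t\<in>elts T0. P (nm t)) \<longleftrightarrow> (\<forall>a. P a)"
  using tn by metis+

section \<open>Number quantifiers, arithmetical induction and choice\<close>

lemma ex_E2: "\<exists>\<phi>\<in>elts T2. \<forall>f\<in>elts T1. (nm (\<phi> \<^bold>\<cdot> f) = 0 \<or> nm (\<phi> \<^bold>\<cdot> f) = 1) \<and> (nm (\<phi> \<^bold>\<cdot> f) = 0 \<longleftrightarrow> (\<exists>a. fn f a = 0))"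
proof -
  have "exists2 \<in> ACA0_omega" by (simp add: ACA0_omega_def)
  then have "sat TM oenv0 exists2" by (rule sat_TM2[OF mdl])
  then obtain \<phi> where \<phi>: "\<phi> \<in> elts T2" "\<forall>f\<in>elts T1. (FEq (\<phi> \<^bold>\<cdot> f) \<^bold>0 \<notin> TM \<longrightarrow> FEq (\<phi> \<^bold>\<cdot> f) \<^bold>1 \<in> TM) \<and>
      ((FEq (\<phi> \<^bold>\<cdot> f) \<^bold>0 \<in> TM) = (\<exists>n\<in>elts T0. FEq (f \<^bold>\<cdot> n) \<^bold>0 \<in> TM))"
    by (auto simp: exists2_def scheme_defs)
  have "(\<exists>n\<in>elts T0. nm (f \<^bold>\<cdot> n) = 0) \<longleftrightarrow> (\<exists>a. fn f a = 0)" if "f \<in> elts T1" for f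
    using ex_tn(1)[of "\<lambda>a. fn f a = 0"] that by (simp add: fn_nm)
  then show ?thesis using \<phi> by (intro bexI[of _ \<phi>]) (auto simp: in_TM)
qed

definition E2 :: tm where
  "E2 = (SOME \<phi>. \<phi> \<in> elts T2 \<and> (\<forall>f\<in>elts T1. (nm (\<phi> \<^bold>\<cdot> f) = 0 \<or> nm (\<phi> \<^bold>\<cdot> f) = 1) \<and> (nm (\<phi> \<^bold>\<cdot> f) = 0 \<longleftrightarrow> (\<exists>a. fn f a = 0))))"

lemma E2: "E2 \<in> elts T2" "f \<in> elts T1 \<Longrightarrow> nm (E2 \<^bold>\<cdot> f) = (if \<exists>a. fn f a = 0 then 0 else 1)"
proof -
  have "E2 \<in> elts T2 \<and> (\<forall>f\<in>elts T1. (nm (E2 \<^bold>\<cdot> f) = 0 \<or> nm (E2 \<^bold>\<cdot> f) = 1) \<and> (nm (E2 \<^bold>\<cdot> f) = 0 \<longleftrightarrow> (\<exists>a. fn f a = 0)))"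
    unfolding E2_def by (rule someI_ex) (use ex_E2 in blast)
  then show "E2 \<in> elts T2" "f \<in> elts T1 \<Longrightarrow> nm (E2 \<^bold>\<cdot> f) = (if \<exists>a. fn f a = 0 then 0 else 1)" by auto
qed

text \<open>\<open>E2\<close> looks for a zero of the term that is 0 exactly at the counterexamples,
  so it decides the negation.\<close>

lemma ard_all:
  assumes "ard (\<lambda>v. P (v 0) (\<lambda>n. v (Suc n)))" shows "ard (\<lambda>v. \<forall>a. P a v)"
proof -
  have "rep (\<lambda>v. if P (v 0) (\<lambda>n. v (Suc n)) then 1 else 0)" by (rule rep_if[OF assms]) auto
  from rep_abs[of "\<lambda>a v. if P a v then 1 else 0", OF this]
  obtain p where p: "has_ty p T1" "\<And>v. ev (E v) p \<in> elts T1" "\<And>v a. fn (ev (E v) p) a = (if P a v then 1 else 0)"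
    by blast
  have "ard (\<lambda>v. \<not> (\<forall>a. P a v))" unfolding ard_def rep_def
    using p E2 by (intro exI[of _ "E2 \<^bold>\<cdot> p"]) (auto intro: has_ty.intros(3) elts_has_ty)
  from ard_not[OF this] show ?thesis by simp
qed

lemma ard_ex: "ard (\<lambda>v. P (v 0) (\<lambda>n. v (Suc n))) \<Longrightarrow> ard (\<lambda>v. \<exists>a. P a v)"
  using ard_not[OF ard_all[of "\<lambda>a v. \<not> P a v"]] ard_not[of "\<lambda>v. P (v 0) (\<lambda>n. v (Suc n))"] by simp

text \<open>That the characteristic term equals 0 is a quantifier-free formula, and QF-IND admits
  its parameters of higher type. Thus quantifier-free induction covers all arithmetical
  relations.\<close>

lemma ard_induct:
  assumes "ard (\<lambda>v. P (v 0))" "P 0" "\<And>n. P n \<Longrightarrow> P (n + 1)"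
  shows "P n"
proof (rule qrel_induct[of P])
  have "qrel (\<lambda>v. (if P (v 0) then 0 else 1) = (0 :: N))"
    using assms(1) unfolding ard_def by (rule qrel_eq) simp
  then show "qrel (\<lambda>v. P (v 0))" by (simp cong: if_cong split: if_splits)
qed (use assms in auto)

text \<open>Feferman's selector mu. Choice is applied to the formula saying that
  \<open>E2 x = 0\<close> implies \<open>x y = 0\<close>, which is quantifier-free in the parameter
  \<open>E2\<close> and has a solution \<open>y\<close> for every \<open>x\<close>.\<close>

lemma ex_Mu: "\<exists>Mu\<in>elts T2. \<forall>f\<in>elts T1. (\<exists>a. fn f a = 0) \<longrightarrow> fn f (nm (Mu \<^bold>\<cdot> f)) = 0"
proof -
  \<comment> \<open>The argument, the value and the choice function all have index 0; their types
    tell them apart.\<close>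
  let ?x = "Var 0 T1" and ?y = "Var 0 T0"
  let ?\<phi> = "FImp (FEq (E2 \<^bold>\<cdot> ?x) \<^bold>0) (FEq (?x \<^bold>\<cdot> ?y) \<^bold>0)"
  have nv: "(0, \<sigma>) \<notin> tm_vars E2" for \<sigma> using E2(1) by (auto simp: elts_def)
  have w: "wff ?\<phi>" using elts_has_ty[OF E2(1)] by (auto simp: has_ty_App)
  have "choice_axiom T1 T0 0 0 0 ?\<phi> \<in> QF_AC T1 T0"
    unfolding QF_AC_def
    by (rule CollectI, rule exI[of _ 0], rule exI[of _ 0], rule exI[of _ 0], rule exI[of _ ?\<phi>])
      (use w nv in \<open>auto simp del: wff.simps\<close>)
  then have "choice_axiom T1 T0 0 0 0 ?\<phi> \<in> ACA0_omega" unfolding ACA0_omega_def RCA0_omega_def by blast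
  then have S: "sat TM (E (\<lambda>_. 0)) (choice_axiom T1 T0 0 0 0 ?\<phi>)" by (intro sat_TM[OF mdl]) auto
  have id: "ev ((E (\<lambda>_. 0))((0, \<sigma>) := a)) E2 = E2" "ev ((E (\<lambda>_. 0))((0, \<sigma>) := a, (0, \<tau>) := b)) E2 = E2" for \<sigma> a \<tau> b
    by (rule ev_elts_id[OF E2(1)], auto simp: E_def)+
  have "\<exists>y\<in>elts T0. FEq (E2 \<^bold>\<cdot> f) \<^bold>0 \<in> TM \<longrightarrow> FEq (f \<^bold>\<cdot> y) \<^bold>0 \<in> TM" if f: "f \<in> elts T1" for f
  proof (cases "\<exists>a. fn f a = 0")
    case True
    then obtain a where "fn f a = 0" by blast
    then show ?thesis using f by (intro bexI[of _ "tn a"]) (auto simp: in_TM fn_nm)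
  next
    case False
    then show ?thesis using f E2 by (intro bexI[of _ "\<^bold>0"]) (auto simp: in_TM)
  qed
  with S obtain Mu where "Mu \<in> elts T2" "\<forall>f\<in>elts T1. FEq (E2 \<^bold>\<cdot> f) \<^bold>0 \<in> TM \<longrightarrow> FEq (f \<^bold>\<cdot> (Mu \<^bold>\<cdot> f)) \<^bold>0 \<in> TM"
    unfolding choice_axiom_def by (auto simp: id tm_subst_nonfree[OF nv])
  then show ?thesis using E2 by (intro bexI[of _ Mu]) (auto simp: in_TM fn_nm)
qed

text \<open>Applying the selector to the characteristic term gives a choice function that is itself
  a term in the parameters, so it can be composed and iterated.\<close>

lemma rep_choice:
  assumes "ard (\<lambda>v. P (v 0) (\<lambda>n. v (Suc n)))"
  shows "\<exists>h. rep h \<and> (\<forall>v. (\<exists>a. P a v) \<longrightarrow> P (h v) v)"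
proof -
  obtain p where p: "has_ty p T1" "\<And>v. ev (E v) p \<in> elts T1" "\<And>v a. fn (ev (E v) p) a = (if P a v then 0 else 1)"
    using rep_abs[of "\<lambda>a v. if P a v then 0 else 1"] assms unfolding ard_def by blast
  obtain Mu where Mu: "Mu \<in> elts T2" "\<And>f. f \<in> elts T1 \<Longrightarrow> (\<exists>a. fn f a = 0) \<Longrightarrow> fn f (nm (Mu \<^bold>\<cdot> f)) = 0"
    using ex_Mu by blast
  define h where "h v = nm (Mu \<^bold>\<cdot> ev (E v) p)" for v
  have "rep h" unfolding rep_def h_def
    using p Mu by (intro exI[of _ "Mu \<^bold>\<cdot> p"]) (auto intro: has_ty.intros(3) elts_has_ty)
  moreover have "P (h v) v" if ex: "\<exists>a. P a v" for v
  proof -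
    obtain a where "P a v" using ex by blast
    then have "fn (ev (E v) p) a = 0" by (simp add: p(3))
    then have "fn (ev (E v) p) (h v) = 0" using Mu(2)[OF p(2), of v] unfolding h_def by blast
    then show ?thesis by (simp add: p(3) split: if_splits)
  qed
  ultimately show ?thesis by blast
qed

lemma ard_subst:
  assumes "ard (\<lambda>v. P (v 0) (\<lambda>n. v (Suc n)))" "rep g" shows "ard (\<lambda>v. P (g v) v)"
  using rep_subst[of "\<lambda>a v. if P a v then 0 else 1"] assms unfolding ard_def by blast

lemma ard_ren: "ard P \<Longrightarrow> ard (\<lambda>v. P (\<lambda>n. v (r n)))"
  unfolding ard_def by (rule rep_ren)

text \<open>The choice function is iterated by primitive recursion. That the recursion never leaves
  \<open>P\<close> is again an arithmetical induction.\<close>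

lemma dependent_choice:
  assumes P: "ard (\<lambda>v. P (v 0) (v 1))" and S: "ard (\<lambda>v. S (v 0) (v 1) (v 2))"
    and "P 0 w" and step: "\<And>i w. P i w \<Longrightarrow> \<exists>w'. S i w w' \<and> P (i + 1) w'"
  shows "\<exists>x\<in>elts T1. fn x 0 = w \<and> (\<forall>i. P i (fn x i) \<and> S i (fn x i) (fn x (i + 1)))"
proof -
  let ?R = "\<lambda>w' (v :: nat \<Rightarrow> N). S (v 0) (v 1) w' \<and> P (v 0 + 1) w'"
  have "ard (\<lambda>v. S (v 1) (v 2) (v 0))"
    using ard_ren[OF S, of "case_nat 1 (case_nat 2 (\<lambda>_. 0))"] by (simp add: numeral_2_eq_2)
  moreover have "ard (\<lambda>v. P (v 1 + 1) (v 0))"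
    by (rule ard_subst[of "\<lambda>a v. P a (v 0)"]) (use P in \<open>auto intro!: rep_plus\<close>)
  ultimately have "ard (\<lambda>v. ?R (v 0) (\<lambda>n. v (Suc n)))"
    by (auto intro: ard_conj simp: numeral_2_eq_2)
  then obtain h where h: "rep h" "\<And>v. (\<exists>a. ?R a v) \<Longrightarrow> ?R (h v) v"
    using rep_choice[of ?R] by blast
  \<comment> \<open>The stream with \<open>i\<close> at 0 and \<open>w\<close> everywhere else
    supplies the parameters, so that \<open>g\<close> is obtained from \<open>h\<close> by renaming
    components.\<close>
  define g where "g i w = h (case_nat i (\<lambda>_. w))" for i w
  have g: "S i w (g i w) \<and> P (i + 1) (g i w)" if "P i w" for i w
    using h(2)[of "case_nat i (\<lambda>_. w)"] step[OF that] by (simp add: g_def)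
  have "(\<lambda>v :: nat \<Rightarrow> N. g (v 0) (v 1)) = (\<lambda>v. h (\<lambda>n. v (case_nat 0 (\<lambda>_. 1) n)))"
    unfolding g_def by (intro ext arg_cong[of _ _ h]) (auto split: nat.splits)
  then have "rep (\<lambda>v. g (v 0) (v 1))" using rep_ren[OF h(1), of "case_nat 0 (\<lambda>_. 1)"] by (simp only:)
  then obtain x where x: "x \<in> elts T1" "fn x 0 = w" "\<And>n. fn x (n + 1) = g n (fn x n)"
    using prim_recursion[of g w] by blast
  have "P i (fn x i)" for i
  proof (rule ard_induct[of "\<lambda>i. P i (fn x i)"])
    show "ard (\<lambda>v. P (v 0) (fn x (v 0)))"
      by (rule ard_subst[of "\<lambda>a v. P (v 0) a" "\<lambda>v. fn x (v 0)"])
        (use ard_ren[OF P, of "case_nat 1 (\<lambda>_. 0)"] x in \<open>auto intro!: rep_fn\<close>)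
  qed (use x g assms(3) in auto)
  then show ?thesis using x g by (intro bexI[of _ x]) auto
qed

end

section \<open>Rational and real numbers of the model\<close>

lemma has_ty_apps:
  "has_ty f (T1 \<^bold>\<rightarrow> T1) \<Longrightarrow> has_ty x T1 \<Longrightarrow> has_ty (f \<^bold>\<cdot> x) T1"
  "has_ty X T2 \<Longrightarrow> has_ty x T1 \<Longrightarrow> has_ty (X \<^bold>\<cdot> x) T0"
  "has_ty F (T0 \<^bold>\<rightarrow> T1 \<^bold>\<rightarrow> T1) \<Longrightarrow> has_ty n T0 \<Longrightarrow> has_ty (F \<^bold>\<cdot> n) (T1 \<^bold>\<rightarrow> T1)"
  "has_ty U (T0 \<^bold>\<rightarrow> T1 \<^bold>\<rightarrow> T0) \<Longrightarrow> has_ty n T0 \<Longrightarrow> has_ty (U \<^bold>\<cdot> n) T2"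
  "has_ty x T1 \<Longrightarrow> has_ty n T0 \<Longrightarrow> has_ty (x \<^bold>\<cdot> n) T0"
  by (auto intro: has_ty.intros)

lemma has_ty_pow2 [simp]: "has_ty (pow2 t) T0 \<longleftrightarrow> has_ty t T0"
  by (auto simp: pow2_def double_step_def has_ty_App)

lemma has_ty_rat_real [simp]: "has_ty (rat_real c) T1 \<longleftrightarrow> has_ty c T0"
  by (auto simp: rat_real_def has_ty_App)

context model
begin

lemma double_step: "double_step \<in> elts (T0 \<^bold>\<rightarrow> T0 \<^bold>\<rightarrow> T0)" "fn2 double_step k m = m + m"
proof -
  let ?I = "Cst (Comb_S T0 T1 T0) \<^bold>\<cdot> Cst (Comb_K T0 T1) \<^bold>\<cdot> Cst (Comb_K T0 T0)"
  let ?D = "Cst (Comb_S T0 T0 T0) \<^bold>\<cdot> Cst Plus \<^bold>\<cdot> ?I"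
  have I: "?I \<in> elts T1" by (meson elts_App elts_ops)
  then have D: "?D \<in> elts T1" by (meson elts_App elts_ops)
  then show "double_step \<in> elts (T0 \<^bold>\<rightarrow> T0 \<^bold>\<rightarrow> T0)" unfolding double_step_def by (meson elts_App elts_ops)
  have KK: "Cst (Comb_K T0 T0) \<^bold>\<cdot> tn m \<in> elts T1" by (meson elts_App elts_ops tn(1))
  have Im: "?I \<^bold>\<cdot> tn m \<in> elts T0" using I by simp
  have "nm (?I \<^bold>\<cdot> tn m) = m"
    using S_eqv[of "Cst (Comb_K T0 T1)" T0 T1 T0 "Cst (Comb_K T0 T0)" "tn m"] K_eqv[of "tn m" T0 _ T1, OF _ KK] by simp
  moreover have "nm (?D \<^bold>\<cdot> tn m) = nm (tn m \<^bold>+ (?I \<^bold>\<cdot> tn m))"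
    using S_eqv[of "Cst Plus" T0 T0 T0 ?I "tn m"] I by simp
  ultimately have "nm (?D \<^bold>\<cdot> tn m) = m + m" using Im by simp
  then show "fn2 double_step k m = m + m"
    using K_eqv[OF D, of "tn k" T0] by (simp add: fn2_def double_step_def)
qed

definition pwN :: "N \<Rightarrow> N" where "pwN n = RR double_step 1 n"

lemma pwN_simps [simp]: "pwN 0 = 1" "pwN (n + 1) = pwN n + pwN n"
  unfolding pwN_def by (simp_all only: RR_simps[OF double_step(1)] double_step(2))

lemma rep_pwN: "rep h \<Longrightarrow> rep (\<lambda>v. pwN (h v))"
  unfolding pwN_def by (rule rep_RR[OF double_step(1)]) auto

lemma ev_pow2 [simp]: "ev e (pow2 t) = pow2 (ev e t)"
  by (simp add: pow2_def double_step_def)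

lemma nm_pow2 [simp]:
  assumes "t \<in> elts T0" shows "nm (pow2 t) = pwN (nm t)"
proof -
  have "nm (pow2 t) = fn2 (Cst R0 \<^bold>\<cdot> double_step) (nm \<^bold>1) (nm t)"
    unfolding pow2_def by (rule fn2_nm) (use assms double_step in auto)
  then show ?thesis by (simp only: nm_ops pwN_def RR_def fn2_def)
qed

lemma pwN_gt: "n < pwN n"
proof (rule qrel_induct[of "\<lambda>n. n < pwN n"])
  fix n assume "n < pwN n"
  then have *: "n + 1 \<le> pwN n" by (simp only: N_less_iff)
  moreover have "1 \<le> n + 1" by simp
  ultimately have "1 \<le> pwN n" by (metis order_trans)
  with * have "(n + 1) + 1 \<le> pwN n + pwN n" by (rule add_mono)
  then show "n + 1 < pwN (n + 1)" by (simp only: N_less_iff pwN_simps)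
qed (auto intro!: qrel_less rep_pwN)

lemma qn_2 [simp]: "qn 2 = 2"
  by (metis one_add_one qn_simps(2,3))

definition ep :: "N \<Rightarrow> Q" where "ep n = 1 / qn (pwN n)"

lemma qn_pwN_pos: "0 < qn (pwN n)"
  using pwN_gt[of n] N_nonneg[of n] qn_simps(1,7) by (metis le_less_trans)

lemma ep_pos [simp]: "0 < ep n"
  unfolding ep_def using qn_pwN_pos by simp

lemma ep_simps [simp]: "ep 0 = 1" "ep (n + 1) = ep n / 2"
  by (simp_all add: ep_def)

lemma ep_add_le: "ep (n + k) \<le> ep n"
proof -
  have "pwN n \<le> pwN (n + k)"
  proof (rule ard_induct[of "\<lambda>k. pwN n \<le> pwN (n + k)"])
    fix k assume "pwN n \<le> pwN (n + k)"
    also have "\<dots> \<le> pwN (n + k) + pwN (n + k)" by (simp add: add_increasing)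
    also have "\<dots> = pwN (n + (k + 1))" by (simp only: pwN_simps add.assoc[symmetric])
    finally show "pwN n \<le> pwN (n + (k + 1))" .
  qed (auto intro!: ard_le rep_pwN rep_plus)
  then show ?thesis unfolding ep_def using qn_pwN_pos[of n] by (simp add: frac_le)
qed

lemma ep_mono: "n \<le> m \<Longrightarrow> ep m \<le> ep n"
  using ep_add_le N_le_iff by metis

text \<open>With exponents from \<open>N\<close> this holds in nonstandard models too: a positive
  rational with denominator \<open>c + 1\<close> is at least \<open>1 / (c + 1)\<close>, and
  \<open>c + 1 < 2 ^ (c + 1)\<close>.\<close>

lemma ep_archimedean: assumes "0 < r" shows "\<exists>n. ep n < r"
proof -
  obtain a b c where r: "r = (qn a - qn b) / (qn c + 1)" using Q_cases by blast
  have c: "0 < qn c + 1" using qn_nonneg[of c] by (simp add: add_nonneg_pos)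
  then have "qn b < qn a" using assms r by (simp add: zero_less_divide_iff)
  then have "b + 1 \<le> a" by (simp add: N_less_iff)
  then have "qn b + 1 \<le> qn a" using qn_simps(6)[of "b + 1" a] by simp
  then have "1 / (qn c + 1) \<le> r" using c unfolding r by (intro divide_right_mono) auto
  moreover have "qn c + 1 < qn (pwN (c + 1))" using qn_simps(7)[of "c + 1" "pwN (c + 1)"] pwN_gt[of "c + 1"] by simp
  then have "ep (c + 1) < 1 / (qn c + 1)" unfolding ep_def using c qn_pwN_pos by (intro divide_strict_left_mono) auto
  ultimately show ?thesis by (metis less_le_trans)
qed

subsection \<open>Codes\<close>

definition pr :: "N \<Rightarrow> N \<Rightarrow> N" where "pr i j = (i + j) * (i + j) + i"

text \<open>The sum can be recovered because \<open>i\<close> is at most \<open>i + j\<close>, which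
  is smaller than the gap to the next square.\<close>

lemma pr_inj: "pr i j = pr k l \<longleftrightarrow> i = k \<and> j = l"
proof
  assume eq: "pr i j = pr k l"
  have *: False if "i + j < k + l" "pr i j = pr k l" for i j k l
  proof -
    have "i + j + 1 \<le> k + l" using that(1) by (simp add: N_less_iff)
    then have "(i + j + 1) * (i + j + 1) \<le> (k + l) * (k + l)" by (intro mult_mono) auto
    also have "\<dots> \<le> pr k l" by (simp add: pr_def add_increasing2)
    also have "pr k l = (i + j) * (i + j) + i" using that(2) by (simp add: pr_def)
    finally have "(i + j) * (i + j) + (i + (i + (j + j) + 1)) \<le> (i + j) * (i + j) + i"
      by (simp add: algebra_simps)
    then have "i + (i + (j + j) + 1) \<le> i + 0" by simp
    then have "i + (j + j) + 1 \<le> 0" by (simp only: add_le_cancel_left)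
    moreover have "0 < i + (j + j) + 1" by (simp only: N_less_Suc N_nonneg)
    ultimately show False using leD by blast
  qed
  have "i + j = k + l" using *[of i j k l] *[of k l i j] eq by (metis linorder_neqE)
  then have "i = k" using eq by (simp add: pr_def)
  then show "i = k \<and> j = l" using \<open>i + j = k + l\<close> by simp
qed auto

definition cd :: "N \<Rightarrow> N \<Rightarrow> N \<Rightarrow> N" where "cd a b d = pr (pr a b) d"

definition isq :: "N \<Rightarrow> bool" where "isq c \<longleftrightarrow> (\<exists>a b d. c = cd a b d)"

definition qv :: "N \<Rightarrow> Q" where
  "qv c = (THE q. \<exists>a b d. c = cd a b d \<and> q = (qn a - qn b) / (qn d + 1))"

lemma isq_cd [simp]: "isq (cd a b d)"
  by (auto simp: isq_def)

lemma qv_cd [simp]: "qv (cd a b d) = (qn a - qn b) / (qn d + 1)"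
  unfolding qv_def by (rule the_equality) (auto simp: cd_def pr_inj)

lemma qv_surj: "\<exists>c. isq c \<and> qv c = q"
  by (metis Q_cases isq_cd qv_cd)

definition rho :: "tm \<Rightarrow> N \<Rightarrow> Q" where "rho x n = qv (fn x n)"

subsection \<open>Meaning of the defined notions\<close>

text \<open>Environments that terms of level \<open>n\<close> cannot distinguish, such as those
  inside and outside of binders introduced from level \<open>n\<close> on.\<close>

definition agree :: "nat \<Rightarrow> (nat \<times> ty \<Rightarrow> tm) \<Rightarrow> (nat \<times> ty \<Rightarrow> tm) \<Rightarrow> bool" where
  "agree n e e' \<longleftrightarrow> (\<forall>t. bnd n t \<longrightarrow> ev e t = ev e' t)"

definition okt :: "(nat \<times> ty \<Rightarrow> tm) \<Rightarrow> rat_tm \<Rightarrow> bool" where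
  "okt e = (\<lambda>(a, b, c). has_ty a T0 \<and> has_ty b T0 \<and> has_ty c T0 \<and> 0 < nm (ev e c))"

definition qt :: "(nat \<times> ty \<Rightarrow> tm) \<Rightarrow> rat_tm \<Rightarrow> Q" where
  "qt e = (\<lambda>(a, b, c). (qn (nm (ev e a)) - qn (nm (ev e b))) / qn (nm (ev e c)))"

lemma qadd_sem: "odd_env e \<Longrightarrow> okt e p \<Longrightarrow> okt e q \<Longrightarrow> okt e (p \<^bold>+\<^sub>q q) \<and> qt e (p \<^bold>+\<^sub>q q) = qt e p + qt e q"
proof -
  obtain a b c a' b' c' where pq: "p = (a, b, c)" "q = (a', b', c')" by (metis prod_cases3)
  assume "odd_env e" "okt e p" "okt e q"
  moreover from this have "ev e a \<in> elts T0" "ev e b \<in> elts T0" "ev e c \<in> elts T0"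
    "ev e a' \<in> elts T0" "ev e b' \<in> elts T0" "ev e c' \<in> elts T0" by (auto simp: pq okt_def ev_elts)
  moreover have "0 < qn (nm (ev e c))" "0 < qn (nm (ev e c'))"
    using calculation qn_simps(1,7) by (auto simp: pq okt_def simp del: qn_simps) (metis qn_simps(1,7))+
  ultimately show ?thesis by (simp add: pq okt_def qt_def field_simps)
qed

lemma qless_sem: "odd_env e \<Longrightarrow> okt e p \<Longrightarrow> okt e q \<Longrightarrow> sat TM e ((p \<^bold><\<^sub>q q) n) \<longleftrightarrow> qt e p < qt e q"
proof -
  obtain a b c a' b' c' where pq: "p = (a, b, c)" "q = (a', b', c')" by (metis prod_cases3)
  assume A: "odd_env e" "okt e p" "okt e q"
  then have m: "ev e a \<in> elts T0" "ev e b \<in> elts T0" "ev e c \<in> elts T0"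
    "ev e a' \<in> elts T0" "ev e b' \<in> elts T0" "ev e c' \<in> elts T0" by (auto simp: pq okt_def ev_elts)
  have c: "0 < qn (nm (ev e c))" "0 < qn (nm (ev e c'))"
    using A qn_simps(1,7) by (auto simp: pq okt_def simp del: qn_simps) (metis qn_simps(1,7))+
  have "sat TM e ((p \<^bold><\<^sub>q q) n) \<longleftrightarrow> nm (ev e a) * nm (ev e c') + nm (ev e b') * nm (ev e c)
     < nm (ev e a') * nm (ev e c) + nm (ev e b) * nm (ev e c')"
    using A m by (simp add: pq s_less_def okt_def in_TM)
  also have "\<dots> \<longleftrightarrow> qn (nm (ev e a)) * qn (nm (ev e c')) + qn (nm (ev e b')) * qn (nm (ev e c))
     < qn (nm (ev e a')) * qn (nm (ev e c)) + qn (nm (ev e b)) * qn (nm (ev e c'))"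
    by (simp flip: qn_simps)
  also have "\<dots> \<longleftrightarrow> qt e p < qt e q" using c by (simp add: pq qt_def field_simps)
  finally show ?thesis .
qed

lemma qle_sem: "odd_env e \<Longrightarrow> okt e p \<Longrightarrow> okt e q \<Longrightarrow> sat TM e ((p \<^bold>\<le>\<^sub>q q) n) \<longleftrightarrow> qt e p \<le> qt e q"
  by (simp add: qle_def s_neg_def qless_sem not_less)

lemma eps_sem: "odd_env e \<Longrightarrow> has_ty t T0 \<Longrightarrow> okt e (eps t) \<and> qt e (eps t) = ep (nm (ev e t))"
  and eps2_sem: "odd_env e \<Longrightarrow> has_ty t T0 \<Longrightarrow> okt e (eps2 t) \<and> qt e (eps2 t) = 2 * ep (nm (ev e t))"
  using ev_elts[of e t T0] le_less_trans[OF N_nonneg pwN_gt, of "nm (ev e t)"]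
  by (simp_all add: eps_def eps2_def okt_def qt_def ep_def)

text \<open>\<open>ex_rat\<close> binds three variables, hence the level \<open>n + 3\<close>. The
  hypothesis on \<open>G\<close> covers every environment agreeing with \<open>e\<close> below
  \<open>n\<close>, since \<open>G\<close> contains outer terms. As the coding is injective, all
  witnesses give the same rational.\<close>

lemma ex_rat_sem:
  assumes "odd_env e" "has_ty c T0" "bnd n c"
    "\<And>e' p. odd_env e' \<Longrightarrow> okt e' p \<Longrightarrow> agree n e' e \<Longrightarrow> bnd (Suc (Suc (Suc n))) (fst p) \<Longrightarrow>
       bnd (Suc (Suc (Suc n))) (fst (snd p)) \<Longrightarrow> bnd (Suc (Suc (Suc n))) (snd (snd p)) \<Longrightarrow>
       sat TM e' (G p (Suc (Suc (Suc n)))) \<longleftrightarrow> P (qt e' p)"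
  shows "sat TM e (ex_rat c G n) \<longleftrightarrow> isq (nm (ev e c)) \<and> P (qv (nm (ev e c)))"
proof -
  let ?a = "Var n T0" and ?b = "Var (Suc n) T0" and ?d = "Var (Suc (Suc n)) T0"
  let ?e = "\<lambda>a b d. e((n, T0) := a, (Suc n, T0) := b, (Suc (Suc n), T0) := d)"
  have *: "sat TM (?e a b d) ((c \<^bold>= rat_code ?a ?b ?d \<^bold>\<and> G (?a, ?b, ?d \<^bold>+ \<^bold>1)) (Suc (Suc (Suc n)))) \<longleftrightarrow>
      nm (ev e c) = cd (nm a) (nm b) (nm d) \<and> P (qv (nm (ev e c)))"
    if "a \<in> elts T0" "b \<in> elts T0" "d \<in> elts T0" for a b d
  proof -
    have o: "odd_env (?e a b d)" using assms(1) that by (simp add: odd_env_upd)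
    have "ev (?e a b d) t = ev e t" if "bnd n t" for t
      using that by (intro ev_cong) (auto simp: bnd_def)
    then have ag: "agree n (?e a b d) e" by (simp add: agree_def)
    then have "sat TM (?e a b d) ((c \<^bold>= rat_code ?a ?b ?d) (Suc (Suc (Suc n)))) \<longleftrightarrow> nm (ev e c) = cd (nm a) (nm b) (nm d)"
      using eq_sem[OF o assms(2), of "rat_code ?a ?b ?d"] that assms(3)
      by (simp add: s_eq_def rat_code_def pair_def cd_def pr_def agree_def del: sat.simps)
    moreover have "sat TM (?e a b d) (G (?a, ?b, ?d \<^bold>+ \<^bold>1) (Suc (Suc (Suc n)))) \<longleftrightarrow> P (qt (?e a b d) (?a, ?b, ?d \<^bold>+ \<^bold>1))"
      by (rule assms(4)[OF o _ ag]) (use that in \<open>auto simp: okt_def add_nonneg_pos\<close>)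
    moreover have "qt (?e a b d) (?a, ?b, ?d \<^bold>+ \<^bold>1) = qv (cd (nm a) (nm b) (nm d))"
      using that by (simp add: qt_def)
    ultimately show ?thesis by (auto simp: s_conj_def s_imp_def s_neg_def)
  qed
  have "sat TM e (ex_rat c G n) \<longleftrightarrow> (\<exists>a\<in>elts T0. \<exists>b\<in>elts T0. \<exists>d\<in>elts T0.
      sat TM (?e a b d) ((c \<^bold>= rat_code ?a ?b ?d \<^bold>\<and> G (?a, ?b, ?d \<^bold>+ \<^bold>1)) (Suc (Suc (Suc n)))))"
    by (simp add: ex_rat_def s_ex0_def s_ex_def)
  also have "\<dots> \<longleftrightarrow> (\<exists>a\<in>elts T0. \<exists>b\<in>elts T0. \<exists>d\<in>elts T0. nm (ev e c) = cd (nm a) (nm b) (nm d) \<and> P (qv (nm (ev e c))))"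
    by (simp add: *)
  also have "\<dots> \<longleftrightarrow> isq (nm (ev e c)) \<and> P (qv (nm (ev e c)))"
    unfolding isq_def ex_tn(1)[symmetric] by blast
  finally show ?thesis .
qed

lemma agree_trans: "agree n e e' \<Longrightarrow> agree n e' e'' \<Longrightarrow> agree n e e''"
  by (simp add: agree_def)

lemma agree_mono: "agree m e e' \<Longrightarrow> n \<le> m \<Longrightarrow> agree n e e'"
  unfolding agree_def bnd_def by (meson less_le_trans)

lemma two_rat_sem:
  assumes "odd_env e" "has_ty c T0" "bnd n c" "has_ty c' T0" "bnd n c'"
    "\<And>e' p q m. odd_env e' \<Longrightarrow> okt e' p \<Longrightarrow> okt e' q \<Longrightarrow> agree n e' e \<Longrightarrow> sat TM e' (B p q m) \<longleftrightarrow> P (qt e' p) (qt e' q)"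
  shows "sat TM e (ex_rat c (\<lambda>p. ex_rat c' (\<lambda>q. B p q)) n) \<longleftrightarrow>
    isq (nm (ev e c)) \<and> isq (nm (ev e c')) \<and> P (qv (nm (ev e c))) (qv (nm (ev e c')))"
proof (rule ex_rat_sem[OF assms(1-3)])
  fix e' p assume A: "odd_env e'" "okt e' p" "agree n e' e" "bnd (Suc (Suc (Suc n))) (fst p)"
    "bnd (Suc (Suc (Suc n))) (fst (snd p))" "bnd (Suc (Suc (Suc n))) (snd (snd p))"
  have ev': "ev e' c' = ev e c'" using A(3) assms(5) by (simp add: agree_def)
  have "sat TM e' (ex_rat c' (B p) (Suc (Suc (Suc n)))) \<longleftrightarrow>
    isq (nm (ev e' c')) \<and> P (qt e' p) (qv (nm (ev e' c')))"
  proof (rule ex_rat_sem[OF A(1) assms(4)])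
    show "bnd (Suc (Suc (Suc n))) c'" using assms(5) by simp
    fix e'' q assume B: "odd_env e''" "okt e'' q" "agree (Suc (Suc (Suc n))) e'' e'"
    have "ev e'' (fst p) = ev e' (fst p)" "ev e'' (fst (snd p)) = ev e' (fst (snd p))"
      "ev e'' (snd (snd p)) = ev e' (snd (snd p))" using A B(3) by (auto simp: agree_def)
    then have p: "qt e'' p = qt e' p" "okt e'' p" using A(2) by (auto simp: qt_def okt_def split: prod.splits)
    have "agree n e'' e" using agree_trans[OF agree_mono[OF B(3)] A(3)] by simp
    then show "sat TM e'' (B p q (Suc (Suc (Suc (Suc (Suc (Suc n))))))) \<longleftrightarrow> P (qt e' p) (qt e'' q)"
      using assms(6)[OF B(1) p(2) B(2)] p(1) by simp
  qed
  then show "sat TM e' (ex_rat c' (B p) (Suc (Suc (Suc n)))) \<longleftrightarrow>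
    isq (nm (ev e c')) \<and> P (qt e' p) (qv (nm (ev e c')))" by (simp only: ev')
qed

definition Real :: "tm \<Rightarrow> bool" where
  "Real x \<longleftrightarrow> (\<forall>n i. isq (fn x n) \<and> isq (fn x (n + i)) \<and> rho x n < rho x (n + i) + ep n \<and> rho x (n + i) < rho x n + ep n)"
definition Req :: "tm \<Rightarrow> tm \<Rightarrow> bool" where
  "Req x y \<longleftrightarrow> (\<forall>n. isq (fn x n) \<and> isq (fn y n) \<and> rho x n \<le> rho y n + 2 * ep n \<and> rho y n \<le> rho x n + 2 * ep n)"
definition Rless :: "tm \<Rightarrow> tm \<Rightarrow> bool" where
  "Rless x y \<longleftrightarrow> (\<exists>n. isq (fn x n) \<and> isq (fn y n) \<and> rho x n + 2 * ep n < rho y n)"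
definition Lpe :: "tm \<Rightarrow> tm \<Rightarrow> N \<Rightarrow> bool" where
  "Lpe x y k \<longleftrightarrow> (\<exists>n. isq (fn x n) \<and> isq (fn y n) \<and> rho x n + 2 * ep n < rho y n + ep k)"
definition Near :: "tm \<Rightarrow> tm \<Rightarrow> N \<Rightarrow> bool" where
  "Near x y k \<longleftrightarrow> Lpe x y k \<and> Lpe y x k"

lemma all0_sem: "sat TM e (s_all0 F n) \<longleftrightarrow> (\<forall>a\<in>elts T0. sat TM (e((n, T0) := a)) (F (Var n T0) (Suc n)))"
  and ex0_sem: "sat TM e (s_ex0 F n) \<longleftrightarrow> (\<exists>a\<in>elts T0. sat TM (e((n, T0) := a)) (F (Var n T0) (Suc n)))"
  and all1_sem: "sat TM e (s_all1 F n) \<longleftrightarrow> (\<forall>a\<in>elts T1. sat TM (e((n, T1) := a)) (F (Var n T1) (Suc n)))"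
  and ex1_sem: "sat TM e (s_ex1 F n) \<longleftrightarrow> (\<exists>a\<in>elts T1. sat TM (e((n, T1) := a)) (F (Var n T1) (Suc n)))"
  and all_sem: "sat TM e (s_all \<sigma> F n) \<longleftrightarrow> (\<forall>a\<in>elts \<sigma>. sat TM (e((n, \<sigma>) := a)) (F (Var n \<sigma>) (Suc n)))"
  and ex_sem: "sat TM e (s_ex \<sigma> F n) \<longleftrightarrow> (\<exists>a\<in>elts \<sigma>. sat TM (e((n, \<sigma>) := a)) (F (Var n \<sigma>) (Suc n)))"
  and imp_sem: "sat TM e ((A \<^bold>\<longrightarrow> B) n) \<longleftrightarrow> (sat TM e (A n) \<longrightarrow> sat TM e (B n))"
  and neg_sem: "sat TM e ((\<^bold>\<not> A) n) \<longleftrightarrow> \<not> sat TM e (A n)"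
  and conj_sem: "sat TM e ((A \<^bold>\<and> B) n) \<longleftrightarrow> (sat TM e (A n) \<and> sat TM e (B n))"
  and disj_sem: "sat TM e ((A \<^bold>\<or> B) n) \<longleftrightarrow> (sat TM e (A n) \<or> sat TM e (B n))"
  and iff_sem: "sat TM e ((A \<^bold>\<longleftrightarrow> B) n) \<longleftrightarrow> (sat TM e (A n) \<longleftrightarrow> sat TM e (B n))"
  by (auto simp: scheme_defs)

lemmas log_sem = all0_sem ex0_sem all1_sem ex1_sem all_sem ex_sem imp_sem neg_sem conj_sem disj_sem iff_sem

lemma has_ty_app1: "has_ty x T1 \<Longrightarrow> has_ty n T0 \<Longrightarrow> has_ty (x \<^bold>\<cdot> n) T0"
  by (rule has_ty.intros)

lemma real_sem:
  assumes "odd_env e" "has_ty x T1" "bnd n x"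
  shows "sat TM e (is_real x n) \<longleftrightarrow> Real (ev e x)"
proof -
  have x: "ev e x \<in> elts T1" using assms ev_elts by blast
  have *: "sat TM (e((n, T0) := a, (Suc n, T0) := b)) (ex_rat (x \<^bold>\<cdot> Var n T0) (\<lambda>p. ex_rat (x \<^bold>\<cdot> (Var n T0 \<^bold>+ Var (Suc n) T0)) (\<lambda>q.
     p \<^bold><\<^sub>q q \<^bold>+\<^sub>q eps (Var n T0) \<^bold>\<and> q \<^bold><\<^sub>q p \<^bold>+\<^sub>q eps (Var n T0))) (Suc (Suc n))) \<longleftrightarrow>
     isq (fn (ev e x) (nm a)) \<and> isq (fn (ev e x) (nm a + nm b)) \<and>
     rho (ev e x) (nm a) < rho (ev e x) (nm a + nm b) + ep (nm a) \<and>
     rho (ev e x) (nm a + nm b) < rho (ev e x) (nm a) + ep (nm a)" (is "?L \<longleftrightarrow> _")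
    if ab: "a \<in> elts T0" "b \<in> elts T0" for a b
  proof -
    let ?e = "e((n, T0) := a, (Suc n, T0) := b)"
    have o: "odd_env ?e" using assms ab by (simp add: odd_env_upd)
    have "?L \<longleftrightarrow> isq (nm (ev ?e (x \<^bold>\<cdot> Var n T0))) \<and> isq (nm (ev ?e (x \<^bold>\<cdot> (Var n T0 \<^bold>+ Var (Suc n) T0)))) \<and>
       (qv (nm (ev ?e (x \<^bold>\<cdot> Var n T0))) < qv (nm (ev ?e (x \<^bold>\<cdot> (Var n T0 \<^bold>+ Var (Suc n) T0)))) + ep (nm a) \<and>
       qv (nm (ev ?e (x \<^bold>\<cdot> (Var n T0 \<^bold>+ Var (Suc n) T0)))) < qv (nm (ev ?e (x \<^bold>\<cdot> Var n T0))) + ep (nm a))"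
    proof (rule two_rat_sem[OF o])
      fix e' p q m assume B: "odd_env e'" "okt e' p" "okt e' q" "agree (Suc (Suc n)) e' ?e"
      have "ev e' (Var n T0) = ev ?e (Var n T0)" using B(4) unfolding agree_def by (metis bnd_simps(1) lessI less_SucI)
      then have "e' (n, T0) = a" by simp
      then show "sat TM e' ((p \<^bold><\<^sub>q q \<^bold>+\<^sub>q eps (Var n T0) \<^bold>\<and> q \<^bold><\<^sub>q p \<^bold>+\<^sub>q eps (Var n T0)) m) \<longleftrightarrow>
         qt e' p < qt e' q + ep (nm a) \<and> qt e' q < qt e' p + ep (nm a)"
        using B eps_sem[OF B(1), of "Var n T0"] qadd_sem[OF B(1,3), of "eps (Var n T0)"] qadd_sem[OF B(1,2), of "eps (Var n T0)"]
        by (simp add: conj_sem qless_sem)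
    qed (use assms in \<open>simp_all add: has_ty_app1\<close>)
    then show ?thesis using ab x assms(3) by (simp add: rho_def fn_nm)
  qed
  show ?thesis unfolding is_real_def log_sem Real_def ex_tn(2)[symmetric]
    by (intro ball_cong refl) (rule *)
qed

text \<open>The common core of equality, order and nearness of reals: each compares approximations
  with the same index by a rational condition \<open>B\<close> in which that index may
  occur.\<close>

lemma pointwise_sem:
  assumes e: "odd_env e" and x: "has_ty x T1" "bnd n x" and y: "has_ty y T1" "bnd n y" and a: "a \<in> elts T0"
    and B: "\<And>e' p q m. odd_env e' \<Longrightarrow> okt e' p \<Longrightarrow> okt e' q \<Longrightarrow> agree n e' e \<Longrightarrow> e' (n, T0) = a \<Longrightarrow>
       sat TM e' (B (Var n T0) p q m) \<longleftrightarrow> P (nm a) (qt e' p) (qt e' q)"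
  shows "sat TM (e((n, T0) := a)) (ex_rat (x \<^bold>\<cdot> Var n T0) (\<lambda>p. ex_rat (y \<^bold>\<cdot> Var n T0) (\<lambda>q. B (Var n T0) p q)) (Suc n)) \<longleftrightarrow>
    isq (fn (ev e x) (nm a)) \<and> isq (fn (ev e y) (nm a)) \<and> P (nm a) (rho (ev e x) (nm a)) (rho (ev e y) (nm a))"
proof -
  let ?e = "e((n, T0) := a)" and ?x = "x \<^bold>\<cdot> Var n T0" and ?y = "y \<^bold>\<cdot> Var n T0"
  have o: "odd_env ?e" using e a by (simp add: odd_env_upd)
  have ag: "agree n ?e e" by (simp add: agree_def)
  have "sat TM ?e (ex_rat ?x (\<lambda>p. ex_rat ?y (\<lambda>q. B (Var n T0) p q)) (Suc n)) \<longleftrightarrow>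
    isq (nm (ev ?e ?x)) \<and> isq (nm (ev ?e ?y)) \<and> P (nm a) (qv (nm (ev ?e ?x))) (qv (nm (ev ?e ?y)))"
  proof (rule two_rat_sem[OF o])
    fix e' p q m assume A: "odd_env e'" "okt e' p" "okt e' q" "agree (Suc n) e' ?e"
    have "ev e' (Var n T0) = ev ?e (Var n T0)" using A(4) unfolding agree_def by (metis bnd_simps(1) lessI)
    then have v: "e' (n, T0) = a" by simp
    have "agree n e' e" using agree_trans[OF agree_mono[OF A(4)] ag] by simp
    then show "sat TM e' (B (Var n T0) p q m) \<longleftrightarrow> P (nm a) (qt e' p) (qt e' q)" using B A v by simp
  qed (use assms in \<open>simp_all add: has_ty_app1\<close>)
  moreover have "ev e x \<in> elts T1" "ev e y \<in> elts T1" using assms ev_elts by auto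
  ultimately show ?thesis using a x y by (simp add: rho_def fn_nm)
qed

lemma req_sem:
  assumes "odd_env e" "has_ty x T1" "bnd n x" "has_ty y T1" "bnd n y"
  shows "sat TM e ((x \<^bold>=\<^sub>\<real> y) n) \<longleftrightarrow> Req (ev e x) (ev e y)"
proof -
  have "sat TM (e((n, T0) := a)) (ex_rat (x \<^bold>\<cdot> Var n T0) (\<lambda>p. ex_rat (y \<^bold>\<cdot> Var n T0) (\<lambda>q.
      p \<^bold>\<le>\<^sub>q q \<^bold>+\<^sub>q eps2 (Var n T0) \<^bold>\<and> q \<^bold>\<le>\<^sub>q p \<^bold>+\<^sub>q eps2 (Var n T0))) (Suc n)) \<longleftrightarrow>
    isq (fn (ev e x) (nm a)) \<and> isq (fn (ev e y) (nm a)) \<and>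
      (rho (ev e x) (nm a) \<le> rho (ev e y) (nm a) + 2 * ep (nm a) \<and> rho (ev e y) (nm a) \<le> rho (ev e x) (nm a) + 2 * ep (nm a))"
    if "a \<in> elts T0" for a
  proof (rule pointwise_sem[OF assms that])
    fix e' p q m assume B: "odd_env e'" "okt e' p" "okt e' q" "e' (n, T0) = a"
    then show "sat TM e' ((p \<^bold>\<le>\<^sub>q q \<^bold>+\<^sub>q eps2 (Var n T0) \<^bold>\<and> q \<^bold>\<le>\<^sub>q p \<^bold>+\<^sub>q eps2 (Var n T0)) m) \<longleftrightarrow>
      qt e' p \<le> qt e' q + 2 * ep (nm a) \<and> qt e' q \<le> qt e' p + 2 * ep (nm a)"
      using eps2_sem[OF B(1), of "Var n T0"] qadd_sem[OF B(1,3), of "eps2 (Var n T0)"] qadd_sem[OF B(1,2), of "eps2 (Var n T0)"]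
      by (simp add: conj_sem qle_sem)
  qed
  then show ?thesis unfolding real_eq_def log_sem Req_def ex_tn[symmetric] by (intro ball_cong bex_cong refl)
qed

lemma rless_sem:
  assumes "odd_env e" "has_ty x T1" "bnd n x" "has_ty y T1" "bnd n y"
  shows "sat TM e ((x \<^bold><\<^sub>\<real> y) n) \<longleftrightarrow> Rless (ev e x) (ev e y)"
proof -
  have "sat TM (e((n, T0) := a)) (ex_rat (x \<^bold>\<cdot> Var n T0) (\<lambda>p. ex_rat (y \<^bold>\<cdot> Var n T0) (\<lambda>q.
      p \<^bold>+\<^sub>q eps2 (Var n T0) \<^bold><\<^sub>q q)) (Suc n)) \<longleftrightarrow>
    isq (fn (ev e x) (nm a)) \<and> isq (fn (ev e y) (nm a)) \<and> rho (ev e x) (nm a) + 2 * ep (nm a) < rho (ev e y) (nm a)"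
    if "a \<in> elts T0" for a
  proof (rule pointwise_sem[OF assms that])
    fix e' p q m assume B: "odd_env e'" "okt e' p" "okt e' q" "e' (n, T0) = a"
    then show "sat TM e' ((p \<^bold>+\<^sub>q eps2 (Var n T0) \<^bold><\<^sub>q q) m) \<longleftrightarrow> qt e' p + 2 * ep (nm a) < qt e' q"
      using eps2_sem[OF B(1), of "Var n T0"] qadd_sem[OF B(1,2), of "eps2 (Var n T0)"] by (simp add: qless_sem)
  qed
  then show ?thesis unfolding real_less_def log_sem Rless_def ex_tn[symmetric] by (intro ball_cong bex_cong refl)
qed

lemma lpe_sem:
  assumes "odd_env e" "has_ty x T1" "bnd n x" "has_ty y T1" "bnd n y" "has_ty k T0" "bnd n k"
  shows "sat TM e (less_plus_eps x y k n) \<longleftrightarrow> Lpe (ev e x) (ev e y) (nm (ev e k))"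
proof -
  have "sat TM (e((n, T0) := a)) (ex_rat (x \<^bold>\<cdot> Var n T0) (\<lambda>p. ex_rat (y \<^bold>\<cdot> Var n T0) (\<lambda>q.
      p \<^bold>+\<^sub>q eps2 (Var n T0) \<^bold><\<^sub>q q \<^bold>+\<^sub>q eps k)) (Suc n)) \<longleftrightarrow>
    isq (fn (ev e x) (nm a)) \<and> isq (fn (ev e y) (nm a)) \<and>
      rho (ev e x) (nm a) + 2 * ep (nm a) < rho (ev e y) (nm a) + ep (nm (ev e k))"
    if "a \<in> elts T0" for a
  proof (rule pointwise_sem[OF assms(1-5) that])
    fix e' p q m assume B: "odd_env e'" "okt e' p" "okt e' q" "agree n e' e" "e' (n, T0) = a"
    then have "ev e' k = ev e k" using assms(7) by (simp add: agree_def)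
    then show "sat TM e' ((p \<^bold>+\<^sub>q eps2 (Var n T0) \<^bold><\<^sub>q q \<^bold>+\<^sub>q eps k) m) \<longleftrightarrow>
        qt e' p + 2 * ep (nm a) < qt e' q + ep (nm (ev e k))"
      using B eps2_sem[OF B(1), of "Var n T0"] eps_sem[OF B(1) assms(6)] qadd_sem[OF B(1,2), of "eps2 (Var n T0)"]
        qadd_sem[OF B(1,3), of "eps k"] by (simp add: qless_sem)
  qed
  then show ?thesis unfolding less_plus_eps_def log_sem Lpe_def ex_tn[symmetric] by (intro ball_cong bex_cong refl)
qed

lemma near_sem:
  assumes "odd_env e" "has_ty x T1" "bnd n x" "has_ty y T1" "bnd n y" "has_ty k T0" "bnd n k"
  shows "sat TM e (near x y k n) \<longleftrightarrow> Near (ev e x) (ev e y) (nm (ev e k))"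
  unfolding near_def log_sem Near_def using assms by (simp add: lpe_sem)

lemma rat_real_elts [simp]: "c \<in> elts T0 \<Longrightarrow> rat_real c \<in> elts T1"
  unfolding rat_real_def by (meson elts_App elts_ops)

lemma fn_rat_real [simp]: "c \<in> elts T0 \<Longrightarrow> fn (rat_real c) n = nm c"
  using K_eqv[of c T0 "tn n" T0] by (simp add: fn_def rat_real_def)

lemma rho_rat_real [simp]: "c \<in> elts T0 \<Longrightarrow> rho (rat_real c) n = qv (nm c)"
  by (simp add: rho_def)

lemma ev_rat_real [simp]: "ev e (rat_real c) = rat_real (ev e c)"
  by (simp add: rat_real_def)

lemma bnd_rat_real [simp]: "bnd n (rat_real c) \<longleftrightarrow> bnd n c"
  by (simp add: rat_real_def)

definition Unit :: "tm \<Rightarrow> bool" where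
  "Unit x \<longleftrightarrow> Real x \<and> (\<forall>n. 0 \<le> rho x n + 2 * ep n) \<and> (\<forall>n. rho x n \<le> 1 + 2 * ep n)"

lemma Real_isq: "Real x \<Longrightarrow> isq (fn x n)"
  by (simp add: Real_def)

lemma unit_sem:
  assumes "odd_env e" "has_ty x T1" "bnd n x"
  shows "sat TM e (in_unit x n) \<longleftrightarrow> Unit (ev e x)"
proof -
  have c: "rat_code \<^bold>0 \<^bold>0 \<^bold>0 \<in> elts T0" "nm (rat_code \<^bold>0 \<^bold>0 \<^bold>0) = cd 0 0 0"
    "rat_code \<^bold>1 \<^bold>0 \<^bold>0 \<in> elts T0" "nm (rat_code \<^bold>1 \<^bold>0 \<^bold>0) = cd 1 0 0"
    by (simp_all add: rat_code_def pair_def cd_def pr_def)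
  have h: "has_ty (rat_real (rat_code \<^bold>0 \<^bold>0 \<^bold>0)) T1" "bnd n (rat_real (rat_code \<^bold>0 \<^bold>0 \<^bold>0))"
    "has_ty (rat_real (rat_code \<^bold>1 \<^bold>0 \<^bold>0)) T1" "bnd n (rat_real (rat_code \<^bold>1 \<^bold>0 \<^bold>0))"
    by (simp_all add: rat_code_def pair_def)
  have E: "ev e (rat_real (rat_code \<^bold>0 \<^bold>0 \<^bold>0)) = rat_real (rat_code \<^bold>0 \<^bold>0 \<^bold>0)"
     "ev e (rat_real (rat_code \<^bold>1 \<^bold>0 \<^bold>0)) = rat_real (rat_code \<^bold>1 \<^bold>0 \<^bold>0)"
    by (simp_all add: rat_code_def pair_def)
  have "sat TM e (in_unit x n) \<longleftrightarrow> Real (ev e x) \<and> \<not> Rless (ev e x) (rat_real (rat_code \<^bold>0 \<^bold>0 \<^bold>0)) \<and>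
    \<not> Rless (rat_real (rat_code \<^bold>1 \<^bold>0 \<^bold>0)) (ev e x)"
    unfolding in_unit_def real_le_def log_sem
    using real_sem[OF assms] rless_sem[OF assms h(1,2)] rless_sem[OF assms(1) h(3,4) assms(2,3)] E by simp
  also have "\<dots> \<longleftrightarrow> Unit (ev e x)"
    unfolding Unit_def Rless_def using c by (auto simp: Real_isq not_less)
  finally show ?thesis .
qed

definition IsFun :: "tm \<Rightarrow> bool" where
  "IsFun f \<longleftrightarrow> (\<forall>x\<in>elts T1. Unit x \<longrightarrow> Real (f \<^bold>\<cdot> x)) \<and>
     (\<forall>x\<in>elts T1. Unit x \<longrightarrow> (\<forall>y\<in>elts T1. Unit y \<longrightarrow> Req x y \<longrightarrow> Req (f \<^bold>\<cdot> x) (f \<^bold>\<cdot> y)))"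
definition Cont :: "tm \<Rightarrow> bool" where
  "Cont f \<longleftrightarrow> (\<forall>x\<in>elts T1. Unit x \<longrightarrow> (\<forall>k. \<exists>M. \<forall>y\<in>elts T1. Unit y \<longrightarrow> Near x y M \<longrightarrow> Near (f \<^bold>\<cdot> x) (f \<^bold>\<cdot> y) k))"
definition Usc :: "tm \<Rightarrow> bool" where
  "Usc f \<longleftrightarrow> (\<forall>c\<in>elts T1. Unit c \<longrightarrow> (\<forall>k. \<exists>M. \<forall>x\<in>elts T1. Unit x \<longrightarrow> \<not> Req x c \<longrightarrow> Near x c M \<longrightarrow>
     Lpe (f \<^bold>\<cdot> x) (f \<^bold>\<cdot> c) k))"
definition Conv :: "tm \<Rightarrow> tm \<Rightarrow> tm \<Rightarrow> bool" where
  "Conv F x y \<longleftrightarrow> (\<forall>k. \<exists>M. \<forall>n\<in>elts T0. \<not> nm n < M \<longrightarrow> Near (F \<^bold>\<cdot> n \<^bold>\<cdot> x) y k)"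
definition Baire1 :: "tm \<Rightarrow> bool" where
  "Baire1 f \<longleftrightarrow> (\<exists>F\<in>elts (T0 \<^bold>\<rightarrow> T1 \<^bold>\<rightarrow> T1). (\<forall>n\<in>elts T0. IsFun (F \<^bold>\<cdot> n) \<and> Cont (F \<^bold>\<cdot> n)) \<and>
     (\<forall>x\<in>elts T1. Unit x \<longrightarrow> Conv F x (f \<^bold>\<cdot> x)))"
definition IsSet :: "tm \<Rightarrow> bool" where
  "IsSet X \<longleftrightarrow> (\<forall>x\<in>elts T1. Unit x \<longrightarrow> nm (X \<^bold>\<cdot> x) = 0 \<or> nm (X \<^bold>\<cdot> x) = 1) \<and>
     (\<forall>x\<in>elts T1. Unit x \<longrightarrow> (\<forall>y\<in>elts T1. Unit y \<longrightarrow> Req x y \<longrightarrow> nm (X \<^bold>\<cdot> x) = nm (X \<^bold>\<cdot> y)))"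
definition Open :: "tm \<Rightarrow> bool" where
  "Open X \<longleftrightarrow> (\<forall>x\<in>elts T1. Unit x \<longrightarrow> nm (X \<^bold>\<cdot> x) = 1 \<longrightarrow>
     (\<exists>k. \<forall>y\<in>elts T1. Unit y \<longrightarrow> Near x y k \<longrightarrow> nm (X \<^bold>\<cdot> y) = 1))"
definition Dense :: "tm \<Rightarrow> bool" where
  "Dense X \<longleftrightarrow> (\<forall>x\<in>elts T1. Unit x \<longrightarrow> (\<forall>k. \<exists>y\<in>elts T1. Unit y \<and> Near x y k \<and> nm (X \<^bold>\<cdot> y) = 1))"

lemmas sem = log_sem real_sem req_sem rless_sem lpe_sem near_sem unit_sem has_ty_apps odd_env_upd
  all_unit_def ex_unit_def mem_def

lemma odd_upd [simp]: "odd_env e \<Longrightarrow> t \<in> elts \<sigma> \<Longrightarrow> odd_env (e((n, \<sigma>) := t))"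
  by (simp add: odd_env_upd)

lemma ev_mem [simp]: "odd_env e \<Longrightarrow> has_ty t \<sigma> \<Longrightarrow> ev e t \<in> elts \<sigma>"
  by (rule ev_elts)

lemma s_eq_sem: "odd_env e \<Longrightarrow> has_ty s T0 \<Longrightarrow> has_ty t T0 \<Longrightarrow> sat TM e ((s \<^bold>= t) n) \<longleftrightarrow> nm (ev e s) = nm (ev e t)"
  and s_less_sem: "odd_env e \<Longrightarrow> has_ty s T0 \<Longrightarrow> has_ty t T0 \<Longrightarrow> sat TM e ((s \<^bold>< t) n) \<longleftrightarrow> nm (ev e s) < nm (ev e t)"
  unfolding s_eq_def s_less_def by (rule eq_sem less_sem; assumption)+

lemma fun_sem: "odd_env e \<Longrightarrow> has_ty f (T1 \<^bold>\<rightarrow> T1) \<Longrightarrow> bnd n f \<Longrightarrow> sat TM e (is_fun f n) \<longleftrightarrow> IsFun (ev e f)"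
  unfolding is_fun_def IsFun_def by (simp add: sem)

lemma cont_sem: "odd_env e \<Longrightarrow> has_ty f (T1 \<^bold>\<rightarrow> T1) \<Longrightarrow> bnd n f \<Longrightarrow> sat TM e (continuous f n) \<longleftrightarrow> Cont (ev e f)"
  unfolding continuous_def Cont_def ex_tn[symmetric] by (simp add: sem)

lemma usc_sem: "odd_env e \<Longrightarrow> has_ty f (T1 \<^bold>\<rightarrow> T1) \<Longrightarrow> bnd n f \<Longrightarrow> sat TM e (upper_semicontinuous f n) \<longleftrightarrow> Usc (ev e f)"
  unfolding upper_semicontinuous_def limsup_le_def Usc_def ex_tn[symmetric] by (simp add: sem)

lemma conv_sem: "odd_env e \<Longrightarrow> has_ty F (T0 \<^bold>\<rightarrow> T1 \<^bold>\<rightarrow> T1) \<Longrightarrow> bnd n F \<Longrightarrow> has_ty x T1 \<Longrightarrow> bnd n x \<Longrightarrow> has_ty y T1 \<Longrightarrow> bnd n y \<Longrightarrow>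
    sat TM e (converges F x y n) \<longleftrightarrow> Conv (ev e F) (ev e x) (ev e y)"
  unfolding converges_def Conv_def ex_tn[symmetric] by (simp add: sem s_less_sem)

lemma baire1_sem: "odd_env e \<Longrightarrow> has_ty f (T1 \<^bold>\<rightarrow> T1) \<Longrightarrow> bnd n f \<Longrightarrow> sat TM e (baire1 f n) \<longleftrightarrow> Baire1 (ev e f)"
  unfolding baire1_def Baire1_def by (simp add: sem fun_sem cont_sem conv_sem ball_conj_distrib)

lemma usc_baire1_sem: "odd_env e \<Longrightarrow> sat TM e (sentence usc_baire1) \<longleftrightarrow>
    (\<forall>f\<in>elts (T1 \<^bold>\<rightarrow> T1). IsFun f \<longrightarrow> Usc f \<longrightarrow> Baire1 f)"
  unfolding usc_baire1_def sentence_def by (simp add: log_sem fun_sem usc_sem baire1_sem)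

lemma set_sem: "odd_env e \<Longrightarrow> has_ty X T2 \<Longrightarrow> bnd n X \<Longrightarrow> sat TM e (is_set X n) \<longleftrightarrow> IsSet (ev e X)"
  unfolding is_set_def IsSet_def by (simp add: sem s_eq_sem)

lemma open_sem: "odd_env e \<Longrightarrow> has_ty X T2 \<Longrightarrow> bnd n X \<Longrightarrow> sat TM e (open_set X n) \<longleftrightarrow> Open (ev e X)"
  unfolding open_set_def Open_def ex_tn[symmetric] by (simp add: sem s_eq_sem)

lemma dense_sem: "odd_env e \<Longrightarrow> has_ty X T2 \<Longrightarrow> bnd n X \<Longrightarrow> sat TM e (dense_set X n) \<longleftrightarrow> Dense (ev e X)"
  unfolding dense_set_def Dense_def ex_tn[symmetric] by (simp add: sem s_eq_sem)

lemma BCT_sem: "odd_env e \<Longrightarrow> sat TM e (sentence BCT) \<longleftrightarrow>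
    (\<forall>X\<in>elts (T0 \<^bold>\<rightarrow> T1 \<^bold>\<rightarrow> T0). (\<forall>n\<in>elts T0. IsSet (X \<^bold>\<cdot> n) \<and> Open (X \<^bold>\<cdot> n) \<and> Dense (X \<^bold>\<cdot> n)) \<longrightarrow>
      (\<forall>n\<in>elts T0. \<forall>x\<in>elts T1. Unit x \<longrightarrow> nm (X \<^bold>\<cdot> (n \<^bold>+ \<^bold>1) \<^bold>\<cdot> x) = 1 \<longrightarrow> nm (X \<^bold>\<cdot> n \<^bold>\<cdot> x) = 1) \<longrightarrow>
      (\<exists>x\<in>elts T1. Unit x \<and> (\<forall>n\<in>elts T0. nm (X \<^bold>\<cdot> n \<^bold>\<cdot> x) = 1)))"
  unfolding BCT_def sentence_def by (simp add: sem s_eq_sem set_sem open_sem dense_sem)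

definition Code :: "tm \<Rightarrow> tm \<Rightarrow> tm \<Rightarrow> bool" where
  "Code a b X \<longleftrightarrow> (\<forall>n. isq (fn a n) \<and> isq (fn b n) \<and> rho a n < rho b n) \<and>
     (\<forall>x\<in>elts T1. Unit x \<longrightarrow> (nm (X \<^bold>\<cdot> x) = 1 \<longleftrightarrow>
        (\<exists>n\<in>elts T0. Rless (rat_real (a \<^bold>\<cdot> n)) x \<and> Rless x (rat_real (b \<^bold>\<cdot> n)))))"

lemma code_sem:
  assumes "odd_env e" "has_ty a T1" "bnd n a" "has_ty b T1" "bnd n b" "has_ty X T2" "bnd n X"
  shows "sat TM e (RM_code a b X n) \<longleftrightarrow> Code (ev e a) (ev e b) (ev e X)"
proof -
  have "sat TM (e((n, T0) := t)) (ex_rat (a \<^bold>\<cdot> Var n T0) (\<lambda>p. ex_rat (b \<^bold>\<cdot> Var n T0) (\<lambda>q. p \<^bold><\<^sub>q q)) (Suc n)) \<longleftrightarrow>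
    isq (fn (ev e a) (nm t)) \<and> isq (fn (ev e b) (nm t)) \<and> rho (ev e a) (nm t) < rho (ev e b) (nm t)"
    if "t \<in> elts T0" for t
    by (rule pointwise_sem[OF assms(1-5) that]) (simp add: qless_sem)
  then show ?thesis using assms
    unfolding RM_code_def Code_def ex_tn(2)[symmetric] by (simp add: sem s_eq_sem)
qed

lemma open_RM_sem: "odd_env e \<Longrightarrow> sat TM e (sentence open_RM) \<longleftrightarrow>
    (\<forall>X\<in>elts T2. IsSet X \<longrightarrow> Open X \<longrightarrow> (\<exists>a\<in>elts T1. \<exists>b\<in>elts T1. Code a b X))"
  unfolding open_RM_def sentence_def by (simp add: log_sem set_sem open_sem code_sem)

subsection \<open>Representable rational-valued functions\<close>

text \<open>Rationals live outside the model. The two parts of the numerator and the denominator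
  minus one are number-valued terms, so comparisons between such functions are arithmetical.\<close>

definition repq :: "((nat \<Rightarrow> N) \<Rightarrow> Q) \<Rightarrow> bool" where
  "repq g \<longleftrightarrow> (\<exists>a b c. rep a \<and> rep b \<and> rep c \<and> (\<forall>v. g v = (qn (a v) - qn (b v)) / (qn (c v) + 1)))"

lemma qn_Suc_pos: "0 < qn c + 1"
  using qn_nonneg[of c] by (simp add: add_nonneg_pos)

lemma repq_const: "repq (\<lambda>_. q)"
proof -
  obtain a b c where "q = (qn a - qn b) / (qn c + 1)" using Q_cases by blast
  then show ?thesis unfolding repq_def by (intro exI[of _ "\<lambda>_. a"] exI[of _ "\<lambda>_. b"] exI[of _ "\<lambda>_. c"]) simp
qed

lemma repq_uminus: "repq f \<Longrightarrow> repq (\<lambda>v. - f v)"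
  unfolding repq_def by (metis minus_diff_eq minus_divide_left)

lemma repq_add: assumes "repq f" "repq g" shows "repq (\<lambda>v. f v + g v)"
proof -
  obtain a b c where f: "rep a" "rep b" "rep c" "\<And>v. f v = (qn (a v) - qn (b v)) / (qn (c v) + 1)"
    using assms unfolding repq_def by blast
  obtain a' b' c' where g: "rep a'" "rep b'" "rep c'" "\<And>v. g v = (qn (a' v) - qn (b' v)) / (qn (c' v) + 1)"
    using assms unfolding repq_def by blast
  \<comment> \<open>\<open>(c + 1) * (c' + 1) = (c * c' + c + c') + 1\<close>, which keeps the
    denominator a successor.\<close>
  have "f v + g v = (qn (a v * (c' v + 1) + a' v * (c v + 1)) - qn (b v * (c' v + 1) + b' v * (c v + 1))) /
      (qn (c v * c' v + c v + c' v) + 1)" for v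
  proof -
    have nz: "qn (c v) + 1 \<noteq> 0" "qn (c' v) + 1 \<noteq> 0" using qn_Suc_pos by (metis less_irrefl)+
    have "f v + g v = ((qn (a v) - qn (b v)) * (qn (c' v) + 1) + (qn (a' v) - qn (b' v)) * (qn (c v) + 1)) /
       ((qn (c v) + 1) * (qn (c' v) + 1))"
      unfolding f(4) g(4) by (rule add_frac_eq[OF nz])
    then show ?thesis by (simp add: algebra_simps)
  qed
  moreover have "rep (\<lambda>v. a v * (c' v + 1) + a' v * (c v + 1))" "rep (\<lambda>v. b v * (c' v + 1) + b' v * (c v + 1))"
    "rep (\<lambda>v. c v * c' v + c v + c' v)" by (intro rep_plus rep_times f g rep_const)+
  ultimately show ?thesis unfolding repq_def by blast
qed

lemma repq_diff: "repq f \<Longrightarrow> repq g \<Longrightarrow> repq (\<lambda>v. f v - g v)"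
  using repq_add[OF _ repq_uminus, of f g] by simp

lemma repq_times: assumes "repq f" "repq g" shows "repq (\<lambda>v. f v * g v)"
proof -
  obtain a b c where f: "rep a" "rep b" "rep c" "\<And>v. f v = (qn (a v) - qn (b v)) / (qn (c v) + 1)"
    using assms unfolding repq_def by blast
  obtain a' b' c' where g: "rep a'" "rep b'" "rep c'" "\<And>v. g v = (qn (a' v) - qn (b' v)) / (qn (c' v) + 1)"
    using assms unfolding repq_def by blast
  have "f v * g v = (qn (a v * a' v + b v * b' v) - qn (a v * b' v + b v * a' v)) /
      (qn (c v * c' v + c v + c' v) + 1)" for v
    unfolding f(4) g(4) times_divide_times_eq by (simp add: algebra_simps)
  moreover have "rep (\<lambda>v. a v * a' v + b v * b' v)" "rep (\<lambda>v. a v * b' v + b v * a' v)"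
    "rep (\<lambda>v. c v * c' v + c v + c' v)" by (intro rep_plus rep_times f g rep_const)+
  ultimately show ?thesis unfolding repq_def by blast
qed

lemma repq_ep: assumes "rep h" shows "repq (\<lambda>v. ep (h v))"
proof -
  have "ep (h v) = (qn 1 - qn 0) / (qn (pwN (h v) - 1) + 1)" for v
  proof -
    have "0 < pwN (h v)" by (rule le_less_trans[OF N_nonneg pwN_gt])
    then have "1 \<le> pwN (h v)" by (simp add: N_less_iff)
    then have "pwN (h v) - 1 + 1 = pwN (h v)" by (rule le_add_diff_inverse2)
    then have "qn (pwN (h v) - 1) + 1 = qn (pwN (h v))" by (metis qn_simps(2,3))
    then show ?thesis by (simp add: ep_def)
  qed
  moreover have "rep (\<lambda>v. pwN (h v) - 1)" by (intro rep_minus rep_pwN assms rep_const)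
  ultimately show ?thesis unfolding repq_def using rep_const by blast
qed

lemma repq_if: assumes "ard P" "repq f" "repq g" shows "repq (\<lambda>v. if P v then f v else g v)"
proof -
  obtain a b c where f: "rep a" "rep b" "rep c" "\<And>v. f v = (qn (a v) - qn (b v)) / (qn (c v) + 1)"
    using assms unfolding repq_def by blast
  obtain a' b' c' where g: "rep a'" "rep b'" "rep c'" "\<And>v. g v = (qn (a' v) - qn (b' v)) / (qn (c' v) + 1)"
    using assms unfolding repq_def by blast
  show ?thesis unfolding repq_def
    by (intro exI[of _ "\<lambda>v. if P v then a v else a' v"] exI[of _ "\<lambda>v. if P v then b v else b' v"]
       exI[of _ "\<lambda>v. if P v then c v else c' v"]) (auto intro: rep_if assms f g simp: f(4) g(4))
qed

lemma ard_lessq: assumes "repq f" "repq g" shows "ard (\<lambda>v. f v < g v)"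
proof -
  have "repq (\<lambda>v. g v - f v)" by (intro repq_diff assms)
  then obtain a b c where d: "rep a" "rep b" "\<And>v. g v - f v = (qn (a v) - qn (b v)) / (qn (c v) + 1)"
    unfolding repq_def by blast
  have "f v < g v \<longleftrightarrow> b v < a v" for v
  proof -
    have "f v < g v \<longleftrightarrow> 0 < (qn (a v) - qn (b v)) / (qn (c v) + 1)" by (simp flip: d(3))
    also have "\<dots> \<longleftrightarrow> b v < a v" using qn_Suc_pos[of "c v"] by (simp add: zero_less_divide_iff)
    finally show ?thesis .
  qed
  then show ?thesis using ard_less[OF d(2,1)] by simp
qed

lemma ard_leq: "repq f \<Longrightarrow> repq g \<Longrightarrow> ard (\<lambda>v. f v \<le> g v)"
  using ard_not[OF ard_lessq, of g f] by (simp add: not_less)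

lemma rep_comp: "rep (\<lambda>v. d (v 0)) \<Longrightarrow> rep g \<Longrightarrow> rep (\<lambda>v. d (g v))"
  by (rule rep_subst[of "\<lambda>a v. d a"])

lemma rep_shift: "rep g \<Longrightarrow> rep (\<lambda>v. g (\<lambda>n. v (Suc n)))"
  by (rule rep_ren)

text \<open>A choice function of one number variable in the form of a HOL function that may be
  applied to any representable one.\<close>

lemma ex_rep_unary:
  assumes "ard (\<lambda>v. P (v 0) (v 1))"
  shows "\<exists>d. (\<forall>g. rep g \<longrightarrow> rep (\<lambda>v. d (g v))) \<and> (\<forall>w. (\<exists>a. P a w) \<longrightarrow> P (d w) w)"
proof -
  obtain h where h: "rep h" "\<And>v. (\<exists>a. P a (v 0)) \<Longrightarrow> P (h v) (v 0)"
    using rep_choice[of "\<lambda>a v. P a (v 0)"] assms by auto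
  have "rep (\<lambda>v. h (\<lambda>_. v 0))" using rep_ren[OF h(1), of "\<lambda>_. 0"] .
  then have "rep g \<Longrightarrow> rep (\<lambda>v. h (\<lambda>_. g v))" for g by (rule rep_comp[of "\<lambda>w. h (\<lambda>_. w)"])
  moreover have "(\<exists>a. P a w) \<Longrightarrow> P (h (\<lambda>_. w)) w" for w using h(2)[of "\<lambda>_. w"] by simp
  ultimately show ?thesis by (intro exI[of _ "\<lambda>w. h (\<lambda>_. w)"]) auto
qed

lemma rep_pr: "rep f \<Longrightarrow> rep g \<Longrightarrow> rep (\<lambda>v. pr (f v) (g v))"
  unfolding pr_def by (intro rep_plus rep_times)

lemma rep_cd: "rep f \<Longrightarrow> rep g \<Longrightarrow> rep h \<Longrightarrow> rep (\<lambda>v. cd (f v) (g v) (h v))"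
  unfolding cd_def by (intro rep_pr)

lemma ard_isq: "rep h \<Longrightarrow> ard (\<lambda>v. isq (h v))"
  unfolding isq_def by (intro ard_ex ard_eq rep_cd rep_var rep_shift)

text \<open>The components of a code are found by choice functions and are unique by injectivity.
  All non-codes share one unspecified value, which is a constant.\<close>

lemma repq_qv: assumes "rep h" shows "repq (\<lambda>v. qv (h v))"
proof -
  have A: "ard (\<lambda>v. \<exists>b d. v 1 = cd (v 0) b d)" "ard (\<lambda>v. \<exists>a d. v 1 = cd a (v 0) d)" "ard (\<lambda>v. \<exists>a b. v 1 = cd a b (v 0))"
    by (intro ard_ex ard_eq rep_cd rep_var)+
  from ex_rep_unary[OF A(1)] obtain da where da: "\<forall>g. rep g \<longrightarrow> rep (\<lambda>v. da (g v))"
    "\<forall>w. (\<exists>a b d. w = cd a b d) \<longrightarrow> (\<exists>b d. w = cd (da w) b d)" by (elim exE conjE) (rule that)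
  from ex_rep_unary[OF A(2)] obtain db where db: "\<forall>g. rep g \<longrightarrow> rep (\<lambda>v. db (g v))"
    "\<forall>w. (\<exists>b a d. w = cd a b d) \<longrightarrow> (\<exists>a d. w = cd a (db w) d)" by (elim exE conjE) (rule that)
  from ex_rep_unary[OF A(3)] obtain dd where dd: "\<forall>g. rep g \<longrightarrow> rep (\<lambda>v. dd (g v))"
    "\<forall>w. (\<exists>d a b. w = cd a b d) \<longrightarrow> (\<exists>a b. w = cd a b (dd w))" by (elim exE conjE) (rule that)
  have "qv w = (if isq w then (qn (da w) - qn (db w)) / (qn (dd w) + 1) else (THE q. False))" for w
  proof (cases "isq w")
    case True
    then obtain a b c where w: "w = cd a b c" unfolding isq_def by blast
    have "\<exists>b d. w = cd (da w) b d" using da(2) w by blast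
    then have "da w = a" using w by (auto simp: cd_def pr_inj)
    moreover have "\<exists>a d. w = cd a (db w) d" using db(2) w by blast
    then have "db w = b" using w by (auto simp: cd_def pr_inj)
    moreover have "\<exists>a b. w = cd a b (dd w)" using dd(2) w by blast
    then have "dd w = c" using w by (auto simp: cd_def pr_inj)
    ultimately have "da w = a" "db w = b" "dd w = c" .
    then show ?thesis using w by simp
  next
    case False
    then show ?thesis unfolding isq_def qv_def by simp
  qed
  moreover have "repq (\<lambda>v. (qn (da (h v)) - qn (db (h v))) / (qn (dd (h v)) + 1))"
    unfolding repq_def
    by (rule exI[of _ "\<lambda>v. da (h v)"], rule exI[of _ "\<lambda>v. db (h v)"], rule exI[of _ "\<lambda>v. dd (h v)"])
      (simp only: da(1)[rule_format, OF assms] db(1)[rule_format, OF assms] dd(1)[rule_format, OF assms] simp_thms)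
  note repq_if[OF ard_isq[OF assms] this repq_const[of "THE q. False"]]
  ultimately show ?thesis by (simp only:)
qed

text \<open>Every rational has a code, so a quantifier over rationals is one over numbers.\<close>

lemma ard_allQ:
  assumes "ard (\<lambda>v. P (qv (v 0)) (\<lambda>n. v (Suc n)))" shows "ard (\<lambda>v. \<forall>q. P q v)"
proof -
  have "(\<forall>q. P q v) \<longleftrightarrow> (\<forall>c. P (qv c) v)" for v by (metis qv_surj)
  then show ?thesis using ard_all[of "\<lambda>c v. P (qv c) v", OF assms] by simp
qed

end

section \<open>Real analysis in the countermodel\<close>

context model
begin

lemma rho_any: assumes "Real x" shows "rho x n < rho x m + ep n + ep m"
proof (cases "n \<le> m")
  case True
  then obtain i where m: "m = n + i" using N_le_iff by metis
  have "rho x n < rho x (n + i) + ep n" using assms unfolding Real_def by blast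
  then show ?thesis using ep_pos[of m] unfolding m by linarith
next
  case False
  then obtain i where n: "n = m + i" using N_le_iff by (metis linear)
  have "rho x (m + i) < rho x m + ep m" using assms unfolding Real_def by blast
  then show ?thesis using ep_pos[of n] unfolding n by linarith
qed

lemma LpeD: assumes "Lpe x y k" "Real x" "Real y" shows "rho x n < rho y n + ep k + 2 * ep n"
proof -
  obtain m where "rho x m + 2 * ep m < rho y m + ep k" using assms(1) unfolding Lpe_def by blast
  with rho_any[OF assms(2), of n m] rho_any[OF assms(3), of m n] show ?thesis by linarith
qed

lemma LpeI: "Real x \<Longrightarrow> Real y \<Longrightarrow> rho x n + 2 * ep n < rho y n + ep k \<Longrightarrow> Lpe x y k"
  unfolding Lpe_def using Real_isq by blast

lemma NearD:
  assumes "Near x y k" "Real x" "Real y"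
  shows "rho x n < rho y n + ep k + 2 * ep n" "rho y n < rho x n + ep k + 2 * ep n"
  using assms LpeD unfolding Near_def by blast+

lemma NearI:
  "Real x \<Longrightarrow> Real y \<Longrightarrow> rho x n + 2 * ep n < rho y n + ep k \<Longrightarrow> rho y n + 2 * ep n < rho x n + ep k \<Longrightarrow> Near x y k"
  unfolding Near_def using LpeI by blast

lemma Near_sym: "Near x y k \<Longrightarrow> Near y x k"
  unfolding Near_def by blast

text \<open>For a real \<open>z\<close> this is \<open>z \<le> c\<close>: an approximation
  \<open>rho z j\<close> is off by at most \<open>ep j\<close>.\<close>

definition Le :: "tm \<Rightarrow> Q \<Rightarrow> bool" where "Le z c \<longleftrightarrow> (\<forall>j. rho z j \<le> c + ep j)"

text \<open>Late approximations determine the real, so any constant error factor can be improved to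
  1; the factor 10 leaves room for the estimates below.\<close>

lemma tighten:
  assumes "Real z" "\<And>j. rho z j \<le> c + 10 * ep j" shows "Le z c"
  unfolding Le_def
proof (intro allI leI notI)
  fix j assume "c + ep j < rho z j"
  \<comment> \<open>11 is the factor 10 of the hypothesis plus one \<open>ep i\<close> from
    comparing \<open>rho z j\<close> with \<open>rho z i\<close>.\<close>
  then obtain i where i: "ep i < (rho z j - c - ep j) / 11" using ep_archimedean[of "(rho z j - c - ep j) / 11"] by auto
  have "rho z j < rho z i + ep j + ep i" by (rule rho_any[OF assms(1)])
  also have "rho z i \<le> c + 10 * ep i" by (rule assms(2))
  finally show False using i by (simp add: field_simps)
qed

lemma ep_le_1: "ep n \<le> 1"
  using ep_mono[of 0 n] by simp

definition okr :: "N \<Rightarrow> bool" where "okr r \<longleftrightarrow> isq r \<and> 0 \<le> qv r \<and> qv r \<le> 1"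

lemma okr_unit: assumes "okr r" shows "Unit (rat_real (tn r))"
proof -
  have q: "0 \<le> qv r" "qv r \<le> 1" "isq r" using assms by (auto simp: okr_def)
  show ?thesis
    unfolding Unit_def Real_def
  proof (intro conjI allI)
    show "0 \<le> rho (rat_real (tn r)) n + 2 * ep n" for n
      unfolding rho_rat_real[OF tn(1)] tn(2) using q ep_pos[of n] by linarith
    show "rho (rat_real (tn r)) n \<le> 1 + 2 * ep n" for n
      unfolding rho_rat_real[OF tn(1)] tn(2) using q ep_pos[of n] by linarith
  qed (use q in auto)
qed

lemma Unit_Real: "Unit x \<Longrightarrow> Real x"
  by (simp add: Unit_def)

lemma near_rational:
  assumes "Real x" "okr r" "qv r + 2 * ep n < rho x n + ep k" "rho x n + 2 * ep n < qv r + ep k"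
  shows "Near x (rat_real (tn r)) k"
  by (rule NearI[of _ _ n]) (use assms okr_unit in \<open>auto simp: Unit_Real\<close>)

text \<open>An approximation of a point of the unit interval can lie up to \<open>2 * ep n\<close>
  outside of it, where nothing is known about the functions. Clamping gives a rational
  inside.\<close>

definition clamp :: "Q \<Rightarrow> Q" where "clamp t = max 0 (min 1 t)"

lemma clamp_unit:
  assumes "Unit x"
  shows "clamp (rho x n) \<le> rho x n + 2 * ep n" "rho x n \<le> clamp (rho x n) + 2 * ep n"
proof -
  have u: "0 \<le> rho x n + 2 * ep n" "rho x n \<le> 1 + 2 * ep n" using assms unfolding Unit_def by auto
  show "clamp (rho x n) \<le> rho x n + 2 * ep n"
    unfolding clamp_def max.bounded_iff min_le_iff_disj using u ep_pos[of n] by linarith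
  have "rho x n - 2 * ep n \<le> clamp (rho x n)"
    unfolding clamp_def le_max_iff_disj min.bounded_iff using u ep_pos[of n] by linarith
  then show "rho x n \<le> clamp (rho x n) + 2 * ep n" by linarith
qed

lemma clamp_range: "0 \<le> clamp t" "clamp t \<le> 1"
  unfolding clamp_def by auto

lemma clamp_lipschitz: "s \<le> t + d \<Longrightarrow> 0 \<le> d \<Longrightarrow> clamp s \<le> clamp t + d"
  unfolding clamp_def by (auto simp: max_def min_def)

text \<open>Continuity carries a bound from the rationals of an interval to every point whose
  clamped approximations finally lie there. Bounds on \<open>F m\<close> are thus settled at
  rational arguments.\<close>

lemma transfer_Le:
  assumes g: "g \<in> elts (T1 \<^bold>\<rightarrow> T1)" "IsFun g" "Cont g" and x: "x \<in> elts T1" "Unit x"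
    and le: "\<And>r. okr r \<Longrightarrow> p \<le> qv r \<Longrightarrow> qv r \<le> q \<Longrightarrow> Le (g \<^bold>\<cdot> rat_real (tn r)) c"
    and ev: "\<And>n. n0 \<le> n \<Longrightarrow> p \<le> clamp (rho x n) \<and> clamp (rho x n) \<le> q"
  shows "Le (g \<^bold>\<cdot> x) c"
proof (rule tighten)
  show R: "Real (g \<^bold>\<cdot> x)" using g x unfolding IsFun_def by blast
  fix j
  obtain M where M: "\<And>y. y \<in> elts T1 \<Longrightarrow> Unit y \<Longrightarrow> Near x y M \<Longrightarrow> Near (g \<^bold>\<cdot> x) (g \<^bold>\<cdot> y) j"
    using g(3) x unfolding Cont_def by blast
  \<comment> \<open>Clamping costs \<open>2 * ep n\<close> and nearness another
    \<open>2 * ep n\<close>; together they stay below \<open>ep M\<close>, as \<open>ep n\<close> is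
    at most an eighth of it.\<close>
  define n where "n = max n0 (M + 1 + 1 + 1)"
  have e: "ep n \<le> ep M / 8" using ep_mono[of "M + 1 + 1 + 1" n] by (simp add: n_def)
  obtain r where r: "isq r" "qv r = clamp (rho x n)" using qv_surj by blast
  then have ok: "okr r" unfolding okr_def using clamp_range by simp
  have pq: "p \<le> qv r" "qv r \<le> q" using ev[of n] r by (auto simp: n_def)
  have "Near x (rat_real (tn r)) M"
    by (rule near_rational[OF Unit_Real[OF x(2)] ok, of n])
      (use clamp_unit[OF x(2), of n] r e ep_pos[of n] ep_pos[of M] in linarith)+
  then have "Near (g \<^bold>\<cdot> x) (g \<^bold>\<cdot> rat_real (tn r)) j" using M okr_unit[OF ok] by simp
  moreover have "Real (g \<^bold>\<cdot> rat_real (tn r))" using g okr_unit[OF ok] unfolding IsFun_def by simp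
  ultimately have "rho (g \<^bold>\<cdot> x) j < rho (g \<^bold>\<cdot> rat_real (tn r)) j + ep j + 2 * ep j" using NearD R by blast
  moreover have "rho (g \<^bold>\<cdot> rat_real (tn r)) j \<le> c + ep j" using le[OF ok pq] unfolding Le_def by blast
  ultimately show "rho (g \<^bold>\<cdot> x) j \<le> c + 10 * ep j" using ep_pos[of j] by linarith
qed

text \<open>The direction opposite to \<open>transfer_Le\<close>: the slack between
  \<open>c'\<close> and \<open>c\<close> absorbs the oscillation near \<open>x\<close>. Nearness is
  spelled out with approximations, the form in which it is known later.\<close>

lemma neighbourhood_Le:
  assumes g: "g \<in> elts (T1 \<^bold>\<rightarrow> T1)" "IsFun g" "Cont g" and x: "x \<in> elts T1" "Unit x"
    and le: "Le (g \<^bold>\<cdot> x) c'" and c: "c' < c"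
  shows "\<exists>M. \<forall>r n. okr r \<longrightarrow> qv r + 2 * ep n < rho x n + ep M \<longrightarrow> rho x n + 2 * ep n < qv r + ep M \<longrightarrow>
    Le (g \<^bold>\<cdot> rat_real (tn r)) c"
proof -
  obtain k where k: "ep k < c - c'" using ep_archimedean[of "c - c'"] c by auto
  obtain M where M: "\<And>y. y \<in> elts T1 \<Longrightarrow> Unit y \<Longrightarrow> Near x y M \<Longrightarrow> Near (g \<^bold>\<cdot> x) (g \<^bold>\<cdot> y) k"
    using g(3) x unfolding Cont_def by blast
  have R: "Real (g \<^bold>\<cdot> x)" using g x unfolding IsFun_def by blast
  have "Le (g \<^bold>\<cdot> rat_real (tn r)) c"
    if ok: "okr r" and n: "qv r + 2 * ep n < rho x n + ep M" "rho x n + 2 * ep n < qv r + ep M" for r n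
  proof (rule tighten)
    show R': "Real (g \<^bold>\<cdot> rat_real (tn r))" using g okr_unit[OF ok] unfolding IsFun_def by simp
    have "Near x (rat_real (tn r)) M" by (rule near_rational[OF Unit_Real[OF x(2)] ok n])
    then have N: "Near (g \<^bold>\<cdot> x) (g \<^bold>\<cdot> rat_real (tn r)) k" using M okr_unit[OF ok] by simp
    fix j
    have "rho (g \<^bold>\<cdot> rat_real (tn r)) j < rho (g \<^bold>\<cdot> x) j + ep k + 2 * ep j" by (rule NearD[OF N R R'])
    moreover have "rho (g \<^bold>\<cdot> x) j \<le> c' + ep j" using le unfolding Le_def by blast
    ultimately show "rho (g \<^bold>\<cdot> rat_real (tn r)) j \<le> c + 10 * ep j" using k ep_pos[of j] by linarith
  qed
  then show ?thesis by blast
qed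

section \<open>Pairs and nested intervals\<close>

lemma unpair:
  obtains u1 u2 where "\<And>g. rep g \<Longrightarrow> rep (\<lambda>v. u1 (g v))" "\<And>g. rep g \<Longrightarrow> rep (\<lambda>v. u2 (g v))"
    "\<And>c d. u1 (pr c d) = c" "\<And>c d. u2 (pr c d) = d"
proof -
  have A: "ard (\<lambda>v. \<exists>d. v 1 = pr (v 0) d)" "ard (\<lambda>v. \<exists>c. v 1 = pr c (v 0))"
    by (intro ard_ex ard_eq rep_pr rep_var)+
  from ex_rep_unary[OF A(1)] obtain u1 where u1: "\<forall>g. rep g \<longrightarrow> rep (\<lambda>v. u1 (g v))"
    "\<forall>w. (\<exists>a d. w = pr a d) \<longrightarrow> (\<exists>d. w = pr (u1 w) d)" by (elim exE conjE) (rule that)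
  from ex_rep_unary[OF A(2)] obtain u2 where u2: "\<forall>g. rep g \<longrightarrow> rep (\<lambda>v. u2 (g v))"
    "\<forall>w. (\<exists>a c. w = pr c a) \<longrightarrow> (\<exists>c. w = pr c (u2 w))" by (elim exE conjE) (rule that)
  have a: "u1 (pr c d) = c" for c d
  proof -
    have "\<exists>d'. pr c d = pr (u1 (pr c d)) d'" using u1(2) by blast
    then show ?thesis by (simp add: pr_inj)
  qed
  have b: "u2 (pr c d) = d" for c d
  proof -
    have "\<exists>c'. pr c d = pr c' (u2 (pr c d))" using u2(2) by blast
    then show ?thesis by (simp add: pr_inj)
  qed
  show thesis by (rule that[of u1 u2]) (use u1(1) u2(1) a b in auto)
qed

lemmas ard_intros = ard_ex ard_all ard_allQ ard_imp ard_conj ard_disj ard_not ard_isq ard_le ard_less ard_leq ard_lessq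
  ard_eq ard_const repq_const repq_ep repq_qv repq_add repq_diff repq_times
  rep_var rep_const rep_plus rep_times rep_pr

text \<open>The left endpoints form the real; they converge fast because the \<open>i\<close>-th
  interval is shorter than \<open>ep i\<close>. The sequence has to exist inside the model, so
  \<open>P\<close> is arithmetical, and an interval becomes a single number, a pair of codes, to fit
  \<open>dependent_choice\<close>.\<close>

lemma nested_intervals:
  assumes P: "ard (\<lambda>v. P (v 0) (qv (v 1)) (qv (v 2)))" and P0: "P 0 p0 q0"
    and len: "\<And>i p q. P i p q \<Longrightarrow> p \<le> q \<and> q - p < ep i"
    and step: "\<And>i p q. P i p q \<Longrightarrow> \<exists>p' q'. p \<le> p' \<and> q' \<le> q \<and> P (i + 1) p' q'"
  shows "\<exists>x\<in>elts T1. Real x \<and> (\<forall>i. \<exists>p q. P i p q \<and> (\<forall>n\<ge>i. p \<le> rho x n \<and> rho x n \<le> q))"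
proof -
  obtain u1 u2 where u: "\<And>g. rep g \<Longrightarrow> rep (\<lambda>v. u1 (g v))" "\<And>g. rep g \<Longrightarrow> rep (\<lambda>v. u2 (g v))"
    "\<And>c d. u1 (pr c d) = c" "\<And>c d. u2 (pr c d) = d" by (rule unpair) blast
  define P' where "P' i w \<longleftrightarrow> isq (u1 w) \<and> isq (u2 w) \<and> P i (qv (u1 w)) (qv (u2 w))" for i w
  define S where "S (i :: N) w w' \<longleftrightarrow> qv (u1 w) \<le> qv (u1 w') \<and> qv (u2 w') \<le> qv (u2 w)" for i w w'
  have aP': "ard (\<lambda>v. P' (v 0) (v 1))"
  proof -
    have "ard (\<lambda>v. P (v 1) (qv (u1 (v 2))) (qv (v 0)))"
      by (rule ard_subst[of "\<lambda>a v. P (v 1) (qv a) (qv (v 0))"])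
        (use ard_ren[OF P, of "case_nat 2 (case_nat 0 (\<lambda>_. 1))"] u in \<open>auto simp: numeral_2_eq_2\<close>)
    then have "ard (\<lambda>v. P (v 0) (qv (u1 (v 1))) (qv (u2 (v 1))))"
      by (intro ard_subst[of "\<lambda>a v. P (v 0) (qv (u1 (v 1))) (qv a)"]) (use u in \<open>auto simp: numeral_2_eq_2\<close>)
    then show ?thesis unfolding P'_def by (intro ard_intros u)
  qed
  have aS: "ard (\<lambda>v. S (v 0) (v 1) (v 2))" unfolding S_def by (intro ard_intros u)
  obtain c0 d0 where "isq c0" "qv c0 = p0" "isq d0" "qv d0 = q0" using qv_surj by metis
  then have P'0: "P' 0 (pr c0 d0)" unfolding P'_def using P0 by (simp add: u)
  have "\<exists>w'. S i w w' \<and> P' (i + 1) w'" if w: "P' i w" for i w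
  proof -
    obtain p' q' where "qv (u1 w) \<le> p'" "q' \<le> qv (u2 w)" "P (i + 1) p' q'"
      using step w unfolding P'_def by blast
    moreover obtain c d where "isq c" "qv c = p'" "isq d" "qv d = q'" using qv_surj by metis
    ultimately show ?thesis by (intro exI[of _ "pr c d"]) (simp add: S_def P'_def u)
  qed
  from dependent_choice[OF aP' aS P'0 this] obtain G where G: "G \<in> elts T1"
    "\<And>i. P' i (fn G i)" "\<And>i. S i (fn G i) (fn G (i + 1))" by blast
  have rG: "rep (\<lambda>v. u1 (fn G (v 0)))" by (rule u(1)[OF rep_fn[OF G(1) rep_var]])
  obtain x where x: "x \<in> elts T1" "\<And>n. fn x n = u1 (fn G n)" using comprehension[of "\<lambda>n. u1 (fn G n)"] rG by blast
  define p q where "p i = qv (u1 (fn G i))" and "q i = qv (u2 (fn G i))" for i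
  have rho: "rho x n = p n" for n by (simp add: rho_def x p_def)
  have PG: "P i (p i) (q i)" for i using G(2) unfolding P'_def p_def q_def by blast
  have mono: "p i \<le> p (i + k) \<and> q (i + k) \<le> q i" for i k
  proof (rule ard_induct[of "\<lambda>k. p i \<le> p (i + k) \<and> q (i + k) \<le> q i"])
    show "ard (\<lambda>v. p i \<le> p (i + v 0) \<and> q (i + v 0) \<le> q i)"
      unfolding p_def q_def by (intro ard_intros u rep_fn G)
    fix k assume IH: "p i \<le> p (i + k) \<and> q (i + k) \<le> q i"
    have "p (i + k) \<le> p (i + k + 1)" "q (i + k + 1) \<le> q (i + k)"
      using G(3)[of "i + k"] unfolding S_def p_def q_def by auto
    then show "p i \<le> p (i + (k + 1)) \<and> q (i + (k + 1)) \<le> q i" using IH by (auto simp: add.assoc)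
  qed auto
  have in_i: "p i \<le> p n \<and> p n \<le> q i" if "i \<le> n" for i n
    using mono len[OF PG[of n]] that N_le_iff by (metis order_trans)
  have "Real x" unfolding Real_def
  proof (intro allI conjI)
    fix n i
    show "isq (fn x n)" "isq (fn x (n + i))" using G(2) unfolding P'_def by (simp_all add: x)
    have "p n \<le> p (n + i)" "p (n + i) \<le> q n" using in_i[of n "n + i"] by auto
    moreover have "q n - p n < ep n" using len[OF PG] by blast
    ultimately show "rho x n < rho x (n + i) + ep n" "rho x (n + i) < rho x n + ep n"
      unfolding rho using ep_pos[of n] by linarith+
  qed
  then show ?thesis using x PG in_i rho by metis
qed

text \<open>The real argument is replaced by the number coding a rational, so statements about these
  values quantify over numbers only.\<close>

definition FFn :: "tm \<Rightarrow> N \<Rightarrow> N \<Rightarrow> N \<Rightarrow> N" where "FFn F m r j = fn (F \<^bold>\<cdot> tn m \<^bold>\<cdot> rat_real (tn r)) j"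

lemma eqv_fn: "x \<in> elts T1 \<Longrightarrow> y \<in> elts T1 \<Longrightarrow> eqv T1 x y \<longleftrightarrow> (\<forall>n. fn x n = fn y n)"
  using ex_tn(2)[of "\<lambda>n. fn x n = fn y n"] by (simp add: fn_nm)

lemma FF_nm:
  assumes F: "F \<in> elts (T0 \<^bold>\<rightarrow> T1 \<^bold>\<rightarrow> T1)" and m: "m \<in> elts T0" "r \<in> elts T0" "j \<in> elts T0"
  shows "nm (F \<^bold>\<cdot> m \<^bold>\<cdot> rat_real r \<^bold>\<cdot> j) = FFn F (nm m) (nm r) (nm j)"
proof -
  have "eqv (T1 \<^bold>\<rightarrow> T1) (F \<^bold>\<cdot> m) (F \<^bold>\<cdot> tn (nm m))" by (rule nm_cong) (use F m in auto)
  then have "nm (F \<^bold>\<cdot> m \<^bold>\<cdot> rat_real r \<^bold>\<cdot> j) = nm (F \<^bold>\<cdot> tn (nm m) \<^bold>\<cdot> rat_real r \<^bold>\<cdot> j)" using m by simp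
  also have "eqv T1 (F \<^bold>\<cdot> tn (nm m) \<^bold>\<cdot> rat_real r) (F \<^bold>\<cdot> tn (nm m) \<^bold>\<cdot> rat_real (tn (nm r)))"
    by (rule ext_eqv[of _ T1]) (use F m in \<open>auto simp: eqv_fn simp del: eqv.simps\<close>)
  then have "nm (F \<^bold>\<cdot> tn (nm m) \<^bold>\<cdot> rat_real r \<^bold>\<cdot> j) = nm (F \<^bold>\<cdot> tn (nm m) \<^bold>\<cdot> rat_real (tn (nm r)) \<^bold>\<cdot> j)" using m by simp
  also have "\<dots> = FFn F (nm m) (nm r) (nm j)" unfolding FFn_def by (rule fn_nm) (use F m in auto)
  finally show ?thesis .
qed

lemma rep_FF:
  assumes F: "F \<in> elts (T0 \<^bold>\<rightarrow> T1 \<^bold>\<rightarrow> T1)" and "rep a" "rep b" "rep c"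
  shows "rep (\<lambda>v. FFn F (a v) (b v) (c v))"
proof -
  obtain p q r where p: "has_ty p T0" "\<And>v. nm (ev (E v) p) = a v" "has_ty q T0" "\<And>v. nm (ev (E v) q) = b v"
    "has_ty r T0" "\<And>v. nm (ev (E v) r) = c v" using assms unfolding rep_def by blast
  have "ev (E v) F = F" for v using F by simp
  then have "nm (ev (E v) (F \<^bold>\<cdot> p \<^bold>\<cdot> rat_real q \<^bold>\<cdot> r)) = FFn F (a v) (b v) (c v)" for v
    using FF_nm[OF F, of "ev (E v) p" "ev (E v) q" "ev (E v) r"] p by simp
  moreover have "has_ty (F \<^bold>\<cdot> p \<^bold>\<cdot> rat_real q \<^bold>\<cdot> r) T0"
    using p elts_has_ty[OF F] by (simp add: has_ty_apps)
  ultimately show ?thesis unfolding rep_def by blast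
qed

definition LeF :: "tm \<Rightarrow> N \<Rightarrow> N \<Rightarrow> Q \<Rightarrow> bool" where
  "LeF F m r c \<longleftrightarrow> (\<forall>j. qv (FFn F m r j) \<le> c + ep j)"

lemma LeF_iff: "LeF F m r c \<longleftrightarrow> Le (F \<^bold>\<cdot> tn m \<^bold>\<cdot> rat_real (tn r)) c"
  by (simp add: LeF_def Le_def rho_def FFn_def)

section \<open>Codes for open sets\<close>

text \<open>\<open>Small F k s L\<close>: some \<open>F m\<close> with \<open>m \<ge> k\<close> is at most 1/2 on the rationals within
  \<open>2 ^ (- L)\<close> of \<open>s\<close>. \<open>Good F k p q\<close> says that one \<open>L\<close> serves for all \<open>s\<close> in the interval, like a
  Lebesgue number, so it is inherited by the union of two adjacent intervals.\<close>

definition Small :: "tm \<Rightarrow> N \<Rightarrow> Q \<Rightarrow> N \<Rightarrow> bool" where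
  "Small F k s L \<longleftrightarrow> (\<exists>m. k \<le> m \<and> (\<forall>r. okr r \<longrightarrow> qv r \<le> s + ep L \<longrightarrow> s \<le> qv r + ep L \<longrightarrow> LeF F m r (1 / 2)))"

definition Good :: "tm \<Rightarrow> N \<Rightarrow> Q \<Rightarrow> Q \<Rightarrow> bool" where
  "Good F k p q \<longleftrightarrow> (\<exists>L. \<forall>s. 0 \<le> s \<longrightarrow> s \<le> 1 \<longrightarrow> p \<le> s \<longrightarrow> s \<le> q \<longrightarrow> Small F k s L)"

lemma Small_mono: assumes "Small F k s L" "L \<le> L'" shows "Small F k s L'"
  using assms(1) ep_mono[OF assms(2)] unfolding Small_def by (meson add_left_mono order_trans)

lemma Good_union: assumes "Good F k p c" "Good F k c q" shows "Good F k p q"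
proof -
  obtain L1 L2 where "\<And>s. 0 \<le> s \<Longrightarrow> s \<le> 1 \<Longrightarrow> p \<le> s \<Longrightarrow> s \<le> c \<Longrightarrow> Small F k s L1"
    "\<And>s. 0 \<le> s \<Longrightarrow> s \<le> 1 \<Longrightarrow> c \<le> s \<Longrightarrow> s \<le> q \<Longrightarrow> Small F k s L2" using assms unfolding Good_def by blast
  then have "Small F k s (max L1 L2)" if "0 \<le> s" "s \<le> 1" "p \<le> s" "s \<le> q" for s
    using that Small_mono[OF _ max.cobounded1, of F k s L1 L2] Small_mono[OF _ max.cobounded2, of F k s L2 L1]
    by (cases "s \<le> c") (auto simp: not_le)
  then show ?thesis unfolding Good_def by blast
qed

lemma ard_Good:
  assumes "F \<in> elts (T0 \<^bold>\<rightarrow> T1 \<^bold>\<rightarrow> T1)" "rep a" "rep b" "rep c"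
  shows "ard (\<lambda>v. Good F (a v) (qv (b v)) (qv (c v)))"
  unfolding Good_def Small_def okr_def LeF_def
  by (intro ard_intros rep_FF assms rep_shift)

end

section \<open>Pointwise limits of continuous functions\<close>

locale approximation = model +
  fixes f F :: tm
  assumes F: "F \<in> elts (T0 \<^bold>\<rightarrow> T1 \<^bold>\<rightarrow> T1)"
    and F_fun: "\<And>n. n \<in> elts T0 \<Longrightarrow> IsFun (F \<^bold>\<cdot> n) \<and> Cont (F \<^bold>\<cdot> n)"
    and F_conv: "\<And>x. x \<in> elts T1 \<Longrightarrow> Unit x \<Longrightarrow> Conv F x (f \<^bold>\<cdot> x)"
    and f_real: "\<And>x. x \<in> elts T1 \<Longrightarrow> Unit x \<Longrightarrow> Real (f \<^bold>\<cdot> x)"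
begin

lemma Fm: "F \<^bold>\<cdot> tn m \<in> elts (T1 \<^bold>\<rightarrow> T1)" "IsFun (F \<^bold>\<cdot> tn m)" "Cont (F \<^bold>\<cdot> tn m)"
  using F F_fun by auto

lemma Fm_real: "x \<in> elts T1 \<Longrightarrow> Unit x \<Longrightarrow> Real (F \<^bold>\<cdot> tn m \<^bold>\<cdot> x)"
  using Fm(2) unfolding IsFun_def by blast

lemma conv:
  assumes "x \<in> elts T1" "Unit x"
  shows "\<exists>M. \<forall>m\<ge>M. Near (F \<^bold>\<cdot> tn m \<^bold>\<cdot> x) (f \<^bold>\<cdot> x) k"
proof -
  obtain M where M: "\<And>n. n \<in> elts T0 \<Longrightarrow> \<not> nm n < M \<Longrightarrow> Near (F \<^bold>\<cdot> n \<^bold>\<cdot> x) (f \<^bold>\<cdot> x) k"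
    using F_conv[OF assms] unfolding Conv_def by blast
  have "Near (F \<^bold>\<cdot> tn m \<^bold>\<cdot> x) (f \<^bold>\<cdot> x) k" if "M \<le> m" for m
    using M[of "tn m"] that by (simp add: not_less)
  then show ?thesis by blast
qed

lemma conv_below:
  assumes x: "x \<in> elts T1" "Unit x" and le: "Le (f \<^bold>\<cdot> x) c"
  shows "\<exists>M. \<forall>m\<ge>M. Le (F \<^bold>\<cdot> tn m \<^bold>\<cdot> x) (c + ep k)"
proof -
  obtain M where M: "\<And>m. M \<le> m \<Longrightarrow> Near (F \<^bold>\<cdot> tn m \<^bold>\<cdot> x) (f \<^bold>\<cdot> x) k" using conv[OF x] by blast
  have "Le (F \<^bold>\<cdot> tn m \<^bold>\<cdot> x) (c + ep k)" if "M \<le> m" for m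
  proof (rule tighten[OF Fm_real[OF x]])
    fix j
    have "rho (F \<^bold>\<cdot> tn m \<^bold>\<cdot> x) j < rho (f \<^bold>\<cdot> x) j + ep k + 2 * ep j"
      by (rule NearD[OF M[OF that] Fm_real[OF x] f_real[OF x]])
    moreover have "rho (f \<^bold>\<cdot> x) j \<le> c + ep j" using le unfolding Le_def by blast
    ultimately show "rho (F \<^bold>\<cdot> tn m \<^bold>\<cdot> x) j \<le> c + ep k + 10 * ep j" using ep_pos[of j] by linarith
  qed
  then show ?thesis by blast
qed

lemma conv_above:
  assumes x: "x \<in> elts T1" "Unit x" and le: "\<And>j. c \<le> rho (f \<^bold>\<cdot> x) j" and c': "c' < c"
  shows "\<exists>M. \<forall>m\<ge>M. \<not> Le (F \<^bold>\<cdot> tn m \<^bold>\<cdot> x) c'"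
proof -
  \<comment> \<open>Four times \<open>ep k\<close> is lost: once through \<open>Le\<close>, three
    times in comparing approximations of two near reals.\<close>
  obtain k where k: "ep k < (c - c') / 4" using ep_archimedean[of "(c - c') / 4"] c' by auto
  obtain M where M: "\<And>m. M \<le> m \<Longrightarrow> Near (F \<^bold>\<cdot> tn m \<^bold>\<cdot> x) (f \<^bold>\<cdot> x) k" using conv[OF x] by blast
  have "\<not> Le (F \<^bold>\<cdot> tn m \<^bold>\<cdot> x) c'" if "M \<le> m" for m
  proof
    assume "Le (F \<^bold>\<cdot> tn m \<^bold>\<cdot> x) c'"
    then have "rho (F \<^bold>\<cdot> tn m \<^bold>\<cdot> x) k \<le> c' + ep k" unfolding Le_def by blast
    moreover have "rho (f \<^bold>\<cdot> x) k < rho (F \<^bold>\<cdot> tn m \<^bold>\<cdot> x) k + ep k + 2 * ep k"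
      by (rule NearD[OF M[OF that] Fm_real[OF x] f_real[OF x]])
    ultimately show False using le[of k] k by (simp add: field_simps)
  qed
  then show ?thesis by blast
qed

end

locale open_indicator = approximation +
  fixes X :: tm
  assumes X: "X \<in> elts T2" "IsSet X" "Open X"
    and f_in: "\<And>x j. x \<in> elts T1 \<Longrightarrow> Unit x \<Longrightarrow> nm (X \<^bold>\<cdot> x) = 1 \<Longrightarrow> rho (f \<^bold>\<cdot> x) j = 0"
    and f_out: "\<And>x j. x \<in> elts T1 \<Longrightarrow> Unit x \<Longrightarrow> nm (X \<^bold>\<cdot> x) = 0 \<Longrightarrow> rho (f \<^bold>\<cdot> x) j = 1"
begin

text \<open>At a point outside \<open>X\<close> the limit is 1, so from some \<open>M\<close> on
  every \<open>F m\<close> exceeds 1/2 there. \<open>Good\<close> with \<open>k = M\<close> produces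
  a later \<open>F m\<close> that is at most 1/2 on the rationals near \<open>x\<close>, hence at
  \<open>x\<close>.\<close>

lemma Good_subset:
  assumes G: "\<And>k. Good F k p q" and x: "x \<in> elts T1" "Unit x"
    and px: "p + 2 * ep n1 < rho x n1" and xq: "rho x n2 + 2 * ep n2 < q"
  shows "nm (X \<^bold>\<cdot> x) = 1"
proof (rule ccontr)
  note R = Unit_Real[OF x(2)]
  assume "nm (X \<^bold>\<cdot> x) \<noteq> 1"
  then have "nm (X \<^bold>\<cdot> x) = 0" using X(2) x unfolding IsSet_def by blast
  then obtain M where M: "\<And>m. M \<le> m \<Longrightarrow> \<not> Le (F \<^bold>\<cdot> tn m \<^bold>\<cdot> x) (1 / 2)"
    using conv_above[OF x, of 1 "1 / 2"] f_out[OF x] by auto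
  obtain L where L: "\<And>s. 0 \<le> s \<Longrightarrow> s \<le> 1 \<Longrightarrow> p \<le> s \<Longrightarrow> s \<le> q \<Longrightarrow> Small F M s L"
    using G[of M] unfolding Good_def by blast
  \<comment> \<open>The first bound keeps later approximations within \<open>ep L\<close> of
    \<open>s\<close>; the other two keep \<open>s\<close> between \<open>p\<close> and
    \<open>q\<close>.\<close>
  define n where "n = max (L + 1) (max (n1 + 1 + 1 + 1) (n2 + 1 + 1 + 1))"
  have e: "ep n \<le> ep L / 2" "ep n \<le> ep n1 / 8" "ep n \<le> ep n2 / 8"
  proof -
    have "L + 1 \<le> n" "n1 + 1 + 1 + 1 \<le> n" "n2 + 1 + 1 + 1 \<le> n"
      unfolding n_def by (rule max.cobounded1 max.coboundedI2 order.refl)+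
    from this[THEN ep_mono] show "ep n \<le> ep L / 2" "ep n \<le> ep n1 / 8" "ep n \<le> ep n2 / 8" by simp_all
  qed
  define s where "s = clamp (rho x n)"
  have "rho x n1 < rho x n + ep n1 + ep n" "rho x n < rho x n2 + ep n + ep n2" using rho_any[OF R] by blast+
  then have ps: "p \<le> s" "s \<le> q"
    using clamp_unit[OF x(2), of n] e(2,3) px xq ep_pos[of n1] ep_pos[of n2] ep_pos[of n] unfolding s_def by linarith+
  obtain m where m: "M \<le> m" "\<And>r. okr r \<Longrightarrow> qv r \<le> s + ep L \<Longrightarrow> s \<le> qv r + ep L \<Longrightarrow> LeF F m r (1 / 2)"
    using L[of s] ps clamp_range[of "rho x n"] unfolding Small_def s_def by blast
  have "Le (F \<^bold>\<cdot> tn m \<^bold>\<cdot> x) (1 / 2)"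
  proof (rule transfer_Le[OF Fm x])
    show "Le (F \<^bold>\<cdot> tn m \<^bold>\<cdot> rat_real (tn r)) (1 / 2)" if "okr r" "s - ep L \<le> qv r" "qv r \<le> s + ep L" for r
      using m(2)[OF that(1)] that by (simp add: LeF_iff algebra_simps)
    fix n' assume "n \<le> n'"
    then have "ep n' \<le> ep n" by (rule ep_mono)
    then have "rho x n \<le> rho x n' + ep L" "rho x n' \<le> rho x n + ep L"
      using rho_any[OF R, of n n'] rho_any[OF R, of n' n] e(1) by linarith+
    then show "s - ep L \<le> clamp (rho x n') \<and> clamp (rho x n') \<le> s + ep L"
      using clamp_lipschitz[of "rho x n" "rho x n'" "ep L"] clamp_lipschitz[of "rho x n'" "rho x n" "ep L"] ep_pos[of L]
      unfolding s_def by (simp add: algebra_simps)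
  qed
  then show False using M[OF m(1)] by blast
qed

text \<open>By \<open>Good_union\<close> one half of a bad interval is bad.\<close>

lemma Good_bisect:
  assumes "\<not> Good F k a b" "a \<le> b" "b - a < ep i"
  shows "\<exists>a' b'. a \<le> a' \<and> b' \<le> b \<and> a' \<le> b' \<and> b' - a' < ep (i + 1) \<and> \<not> Good F k a' b'"
proof -
  let ?c = "(a + b) / 2"
  have c: "a \<le> ?c" "?c \<le> b" "?c - a < ep i / 2" "b - ?c < ep i / 2" using assms(2,3) by (simp_all add: field_simps)
  from Good_union assms(1) consider "\<not> Good F k a ?c" | "\<not> Good F k ?c b" by blast
  then show ?thesis
  proof cases
    case 1 then show ?thesis using c by (intro exI[of _ a] exI[of _ ?c]) simp
  next
    case 2 then show ?thesis using c by (intro exI[of _ ?c] exI[of _ b]) simp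
  qed
qed

text \<open>Compactness by bisection. Bad intervals shrink to some \<open>y\<close>, which is near
  \<open>x\<close> and so in \<open>X\<close>. There a single late \<open>F m\<close> is at most
  1/4, by continuity at most 1/2 nearby, which makes a small bad interval around \<open>y\<close>
  good. The interval around \<open>x\<close> is chosen before \<open>k\<close>, so it serves all
  \<open>k\<close>.\<close>

lemma ex_Good:
  assumes x: "x \<in> elts T1" "Unit x" "nm (X \<^bold>\<cdot> x) = 1"
  shows "\<exists>p q. p < q \<and> (\<forall>k. Good F k p q) \<and> (\<exists>n. p + 2 * ep n < rho x n) \<and> (\<exists>n. rho x n + 2 * ep n < q)"
proof -
  note R = Unit_Real[OF x(2)]
  obtain d where d: "\<And>y. y \<in> elts T1 \<Longrightarrow> Unit y \<Longrightarrow> Near x y d \<Longrightarrow> nm (X \<^bold>\<cdot> y) = 1"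
    using X(3) x unfolding Open_def by blast
  define n where "n = d + 1 + 1 + 1"
  have en: "ep n = ep d / 8" by (simp add: n_def)
  \<comment> \<open>The radius exceeds \<open>2 * ep n\<close>, so \<open>x\<close> is strictly
    inside. As \<open>ep n = ep d / 8\<close>, points of the interval remain within
    \<open>ep d\<close> of \<open>x\<close>, and the length is below \<open>ep 0\<close>.\<close>
  define p q where "p = rho x n - 3 * ep n" and "q = rho x n + 3 * ep n"
  have "Good F k p q" for k
  proof (rule ccontr)
    assume bad: "\<not> Good F k p q"
    define P where "P i a b \<longleftrightarrow> p \<le> a \<and> b \<le> q \<and> a \<le> b \<and> b - a < ep i \<and> \<not> Good F k a b" for i a b
    have "ard (\<lambda>v. P (v 0) (qv (v 1)) (qv (v 2)))"
      unfolding P_def by (intro ard_intros ard_Good F)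
    moreover have "p \<le> q" "q - p < ep 0"
      unfolding p_def q_def ep_simps(1) using en ep_pos[of d] ep_le_1[of d] by linarith+
    then have "P 0 p q" unfolding P_def using bad by blast
    moreover have "\<And>i a b. P i a b \<Longrightarrow> a \<le> b \<and> b - a < ep i" unfolding P_def by blast
    moreover have "\<exists>a' b'. a \<le> a' \<and> b' \<le> b \<and> P (i + 1) a' b'" if "P i a b" for i a b
      using Good_bisect[of k a b i] that unfolding P_def by (meson order_trans)
    ultimately have "\<exists>y\<in>elts T1. Real y \<and> (\<forall>i. \<exists>a b. P i a b \<and> (\<forall>n\<ge>i. a \<le> rho y n \<and> rho y n \<le> b))"
      by (rule nested_intervals)
    then obtain y where y: "y \<in> elts T1" "Real y"
      "\<And>i. \<exists>a b. P i a b \<and> (\<forall>n\<ge>i. a \<le> rho y n \<and> rho y n \<le> b)" by blast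
    have yb: "\<exists>a b. P i a b \<and> a \<le> rho y i \<and> rho y i \<le> b" for i using y(3)[of i] by blast
    have yU: "0 \<le> rho y i + 2 * ep i \<and> rho y i \<le> 1 + 2 * ep i" for i
    proof -
      obtain a b where ab: "P i a b" "a \<le> rho y i" "rho y i \<le> b" using yb by blast
      \<comment> \<open>An interval disjoint from the unit interval would be good vacuously.\<close>
      then obtain s where "0 \<le> s" "s \<le> 1" "a \<le> s" "s \<le> b" unfolding P_def Good_def by blast
      then show ?thesis using ab ep_pos[of i] unfolding P_def by (intro conjI; linarith)
    qed
    then have U: "Unit y" unfolding Unit_def using y(2) by blast
    have "Near x y d"
    proof (rule NearI[OF R y(2), of n])
      obtain a b where "P n a b" "a \<le> rho y n" "rho y n \<le> b" using yb by blast
      then have "p \<le> rho y n" "rho y n \<le> q" unfolding P_def by auto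
      then show "rho x n + 2 * ep n < rho y n + ep d" "rho y n + 2 * ep n < rho x n + ep d"
        using en ep_pos[of d] unfolding p_def q_def by linarith+
    qed
    then have "nm (X \<^bold>\<cdot> y) = 1" using d y(1) U by blast
    then have "Le (f \<^bold>\<cdot> y) 0" unfolding Le_def using f_in[OF y(1) U] ep_pos by (simp add: less_imp_le)
    then obtain M0 where M0: "\<And>m. M0 \<le> m \<Longrightarrow> Le (F \<^bold>\<cdot> tn m \<^bold>\<cdot> y) (0 + ep (0 + 1 + 1))"
      using conv_below[OF y(1) U, of 0] by blast
    define m where "m = max M0 k"
    have "Le (F \<^bold>\<cdot> tn m \<^bold>\<cdot> y) (1 / 4)" 
    proof -
      have "0 + ep (0 + 1 + 1) = (1 / 4 :: Q)" unfolding ep_simps by simp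
      then show ?thesis using M0[of m] by (simp only: m_def max.cobounded1)
    qed
    from neighbourhood_Le[OF Fm y(1) U this, of "1 / 2"] obtain M where
      M: "\<And>r n. okr r \<Longrightarrow> qv r + 2 * ep n < rho y n + ep M \<Longrightarrow> rho y n + 2 * ep n < qv r + ep M \<Longrightarrow>
         Le (F \<^bold>\<cdot> tn m \<^bold>\<cdot> rat_real (tn r)) (1 / 2)" by auto
    \<comment> \<open>Two steps of size \<open>ep i\<close> lead from \<open>qv r\<close> over
      \<open>s\<close> to \<open>rho y i\<close>, and nearness costs \<open>2 * ep i\<close>; all
      four together stay below \<open>ep M\<close>.\<close>
    define i where "i = M + 1 + 1 + 1"
    have ei: "ep i = ep M / 8" by (simp add: i_def)
    obtain a b where ab: "P i a b" "a \<le> rho y i" "rho y i \<le> b" using yb by blast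
    have "Small F k s i" if "a \<le> s" "s \<le> b" for s
      unfolding Small_def
    proof (intro exI[of _ m] conjI allI impI)
      show "k \<le> m" by (simp add: m_def)
      fix r assume r: "okr r" "qv r \<le> s + ep i" "s \<le> qv r + ep i"
      have "b - a < ep i" using ab(1) unfolding P_def by blast
      then show "LeF F m r (1 / 2)"
        unfolding LeF_iff using M[OF r(1), of i] r(2,3) that ab(2,3) ei ep_pos[of M] by (auto simp: field_simps)
    qed
    then have "Good F k a b" unfolding Good_def by blast
    then show False using ab(1) unfolding P_def by blast
  qed
  moreover have "p < q" "p + 2 * ep n < rho x n" "rho x n + 2 * ep n < q"
    unfolding p_def q_def using ep_pos[of n] by linarith+
  ultimately show ?thesis by blast
qed

text \<open>Every number is read as a pair of codes and tested for being a good interval, so all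
  good intervals are enumerated. The test is arithmetical, which makes the sequences of endpoints
  elements of the model.\<close>

lemma ex_Code: "\<exists>a\<in>elts T1. \<exists>b\<in>elts T1. Code a b X"
proof -
  obtain u1 u2 where u: "\<And>g. rep g \<Longrightarrow> rep (\<lambda>v. u1 (g v))" "\<And>g. rep g \<Longrightarrow> rep (\<lambda>v. u2 (g v))"
    "\<And>c d. u1 (pr c d) = c" "\<And>c d. u2 (pr c d) = d" by (rule unpair) blast
  \<comment> \<open>Numbers that fail the test contribute the interval from 2 to 3, which is
    disjoint from the unit interval.\<close>
  obtain c2 c3 where c: "isq c2" "qv c2 = 2" "isq c3" "qv c3 = 3" using qv_surj by metis
  define R where "R w \<longleftrightarrow> isq (u1 w) \<and> isq (u2 w) \<and> qv (u1 w) < qv (u2 w) \<and> (\<forall>k. Good F k (qv (u1 w)) (qv (u2 w)))" for w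
  define A B where "A w = (if R w then u1 w else c2)" and "B w = (if R w then u2 w else c3)" for w
  have aR: "ard (\<lambda>v. R (v 0))" unfolding R_def by (intro ard_intros ard_Good F u)
  have "rep (\<lambda>v. A (v 0))" "rep (\<lambda>v. B (v 0))" unfolding A_def B_def by (intro rep_if aR u rep_var rep_const)+
  then obtain a b where a: "a \<in> elts T1" "\<And>n. fn a n = A n" and b: "b \<in> elts T1" "\<And>n. fn b n = B n"
    using comprehension[of A] comprehension[of B] by metis
  have AB: "isq (A w)" "isq (B w)" "qv (A w) < qv (B w)" for w
    using c by (auto simp: A_def B_def R_def)
  have Rl: "Rless (rat_real (a \<^bold>\<cdot> t)) x \<longleftrightarrow> (\<exists>n. qv (A (nm t)) + 2 * ep n < rho x n)"
    and Rr: "Rless x (rat_real (b \<^bold>\<cdot> t)) \<longleftrightarrow> (\<exists>n. rho x n + 2 * ep n < qv (B (nm t)))"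
    if "Real x" "t \<in> elts T0" for t x
    unfolding Rless_def using that a b AB Real_isq by (auto simp: fn_nm)
  have "Code a b X" unfolding Code_def
  proof (intro conjI allI ballI impI)
    show "isq (fn a n)" "isq (fn b n)" "rho a n < rho b n" for n
      using AB by (auto simp: a b rho_def)
    fix x assume x: "x \<in> elts T1" "Unit x"
    note Rx = Unit_Real[OF x(2)]
    show "nm (X \<^bold>\<cdot> x) = 1 \<longleftrightarrow> (\<exists>n\<in>elts T0. Rless (rat_real (a \<^bold>\<cdot> n)) x \<and> Rless x (rat_real (b \<^bold>\<cdot> n)))"
    proof
      assume "nm (X \<^bold>\<cdot> x) = 1"
      then obtain p q where pq: "p < q" "\<And>k. Good F k p q" "\<exists>n. p + 2 * ep n < rho x n" "\<exists>n. rho x n + 2 * ep n < q"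
        using ex_Good x by blast
      obtain cp cq where cpq: "isq cp" "qv cp = p" "isq cq" "qv cq = q" using qv_surj by metis
      let ?w = "pr cp cq"
      have "R ?w" unfolding R_def using cpq pq by (simp add: u)
      then have "A ?w = cp" "B ?w = cq" by (simp_all add: A_def B_def u)
      then show "\<exists>n\<in>elts T0. Rless (rat_real (a \<^bold>\<cdot> n)) x \<and> Rless x (rat_real (b \<^bold>\<cdot> n))"
        using pq cpq Rx by (intro bexI[of _ "tn ?w"]) (simp_all add: Rl Rr)
    next
      assume "\<exists>n\<in>elts T0. Rless (rat_real (a \<^bold>\<cdot> n)) x \<and> Rless x (rat_real (b \<^bold>\<cdot> n))"
      then obtain w n1 n2 where w: "qv (A w) + 2 * ep n1 < rho x n1" "rho x n2 + 2 * ep n2 < qv (B w)"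
        using Rl Rr Rx by auto
      have "R w"
      proof (rule ccontr)
        assume "\<not> R w"
        then have "2 + 2 * ep n1 < rho x n1" using w(1) by (simp add: A_def c)
        moreover have "rho x n1 \<le> 1 + 2 * ep n1" using x(2) unfolding Unit_def by blast
        ultimately show False by linarith
      qed
      then show "nm (X \<^bold>\<cdot> x) = 1"
        using Good_subset[OF _ x w] unfolding A_def B_def R_def by auto
    qed
  qed
  then show ?thesis using a b by blast
qed

end

section \<open>The indicator of the complement\<close>

context model
begin

lemma eval_abs:
  assumes "has_ty t \<tau>"
  obtains t' where "has_ty t' (\<sigma> \<^bold>\<rightarrow> \<tau>)" "tm_vars t' \<subseteq> tm_vars t - {(n, \<sigma>)}"
    "\<And>e a. odd_env e \<Longrightarrow> a \<in> elts \<sigma> \<Longrightarrow> eqv \<tau> (ev e t' \<^bold>\<cdot> a) (ev (e((n, \<sigma>) := a)) t)"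
  using abstraction[OF assms, of \<sigma> n] by blast

lemma ev_indep: "tm_vars t \<inter> {(n, \<sigma>)} = {} \<Longrightarrow> ev (e((n, \<sigma>) := a)) t = ev e t"
  by (rule ev_cong) auto

text \<open>\<open>cd 1 b 0\<close> codes \<open>1 - b\<close>, so \<open>f x\<close> is a constant
  sequence of rationals.\<close>

lemma complement_function:
  assumes X: "X \<in> elts T2"
  shows "\<exists>f\<in>elts (T1 \<^bold>\<rightarrow> T1). \<forall>x\<in>elts T1. \<forall>k. fn (f \<^bold>\<cdot> x) k = cd 1 (nm (X \<^bold>\<cdot> x)) 0"
proof -
  let ?t = "rat_real (rat_code \<^bold>1 (X \<^bold>\<cdot> Var 0 T1) \<^bold>0)"
  have ty: "has_ty ?t T1" using elts_has_ty[OF X] by (simp add: rat_code_def pair_def has_ty_apps)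
  obtain t' where t': "has_ty t' (T1 \<^bold>\<rightarrow> T1)" "tm_vars t' \<subseteq> tm_vars ?t - {(0, T1)}"
    "\<And>e a. odd_env e \<Longrightarrow> a \<in> elts T1 \<Longrightarrow> eqv T1 (ev e t' \<^bold>\<cdot> a) (ev (e((0, T1) := a)) ?t)"
    using eval_abs[OF ty, where \<sigma> = T1 and n = 0] by blast
  let ?e = "E (\<lambda>_. 0)" let ?f = "ev ?e t'"
  have f: "?f \<in> elts (T1 \<^bold>\<rightarrow> T1)" using t' by simp
  have "fn (?f \<^bold>\<cdot> x) k = cd 1 (nm (X \<^bold>\<cdot> x)) 0" if x: "x \<in> elts T1" for x k
  proof -
    have "ev (?e((0, T1) := x)) X = X" by (rule ev_elts_id[OF X]) (auto simp: E_def)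
    then have "ev (?e((0, T1) := x)) ?t = rat_real (rat_code \<^bold>1 (X \<^bold>\<cdot> x) \<^bold>0)"
      by (simp add: rat_code_def pair_def)
    moreover have "eqv T1 (?f \<^bold>\<cdot> x) (ev (?e((0, T1) := x)) ?t)" by (rule t'(3)[OF odd_env_E x])
    ultimately have "eqv T1 (?f \<^bold>\<cdot> x) (rat_real (rat_code \<^bold>1 (X \<^bold>\<cdot> x) \<^bold>0))" by (simp only:)
    moreover have c: "rat_code \<^bold>1 (X \<^bold>\<cdot> x) \<^bold>0 \<in> elts T0" "nm (rat_code \<^bold>1 (X \<^bold>\<cdot> x) \<^bold>0) = cd 1 (nm (X \<^bold>\<cdot> x)) 0"
      using X x by (simp_all add: rat_code_def pair_def cd_def pr_def)
    ultimately have "fn (?f \<^bold>\<cdot> x) k = fn (rat_real (rat_code \<^bold>1 (X \<^bold>\<cdot> x) \<^bold>0)) k"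
      using eqv_fn[of "?f \<^bold>\<cdot> x" "rat_real (rat_code \<^bold>1 (X \<^bold>\<cdot> x) \<^bold>0)"] f x by simp
    then show ?thesis using c by simp
  qed
  then show ?thesis using f by blast
qed

lemma open_RM_holds:
  assumes ub: "\<And>f. f \<in> elts (T1 \<^bold>\<rightarrow> T1) \<Longrightarrow> IsFun f \<Longrightarrow> Usc f \<Longrightarrow> Baire1 f"
    and X: "X \<in> elts T2" "IsSet X" "Open X"
  shows "\<exists>a\<in>elts T1. \<exists>b\<in>elts T1. Code a b X"
proof -
  obtain f where f: "f \<in> elts (T1 \<^bold>\<rightarrow> T1)" "\<And>x k. x \<in> elts T1 \<Longrightarrow> fn (f \<^bold>\<cdot> x) k = cd 1 (nm (X \<^bold>\<cdot> x)) 0"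
    using complement_function[OF X(1)] by blast
  have rho: "rho (f \<^bold>\<cdot> x) k = 1 - qn (nm (X \<^bold>\<cdot> x))" if "x \<in> elts T1" for x k
    using f(2)[OF that] by (simp add: rho_def)
  have X01: "nm (X \<^bold>\<cdot> x) = 0 \<or> nm (X \<^bold>\<cdot> x) = 1" if "x \<in> elts T1" "Unit x" for x
    using X(2) that unfolding IsSet_def by blast
  have fR: "Real (f \<^bold>\<cdot> x)" if "x \<in> elts T1" for x
    unfolding Real_def using rho[OF that] f(2)[OF that] by simp
  have "IsFun f" unfolding IsFun_def
  proof (intro conjI ballI impI)
    fix x y assume "x \<in> elts T1" "Unit x" "y \<in> elts T1" "Unit y" "Req x y"
    moreover from this have "nm (X \<^bold>\<cdot> x) = nm (X \<^bold>\<cdot> y)" using X(2) unfolding IsSet_def by blast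
    ultimately show "Req (f \<^bold>\<cdot> x) (f \<^bold>\<cdot> y)"
      unfolding Req_def using rho f(2) by (simp add: less_imp_le)
  qed (use fR in auto)
  moreover have "Usc f" unfolding Usc_def
  proof (intro ballI impI allI)
    fix c k assume c: "c \<in> elts T1" "Unit c"
    \<comment> \<open>The inequality can fail only if \<open>c\<close> is in \<open>X\<close> and
      \<open>x\<close> is not, which openness prevents near \<open>c\<close>.\<close>
    have L: "Lpe (f \<^bold>\<cdot> x) (f \<^bold>\<cdot> c) k" if "x \<in> elts T1" "nm (X \<^bold>\<cdot> c) = 1 \<longrightarrow> nm (X \<^bold>\<cdot> x) = 1" "Unit x" for x
    proof (rule LpeI[of _ _ "k + 1 + 1"])
      have "2 * ep (k + 1 + 1) < ep k" using ep_pos[of k] by simp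
      moreover have "qn (nm (X \<^bold>\<cdot> c)) \<le> qn (nm (X \<^bold>\<cdot> x))" using that X01[OF c] X01[of x] by auto
      ultimately show "rho (f \<^bold>\<cdot> x) (k + 1 + 1) + 2 * ep (k + 1 + 1) < rho (f \<^bold>\<cdot> c) (k + 1 + 1) + ep k"
        unfolding rho[OF that(1)] rho[OF c(1)] by linarith
    qed (use fR that c in auto)
    show "\<exists>M. \<forall>x\<in>elts T1. Unit x \<longrightarrow> \<not> Req x c \<longrightarrow> Near x c M \<longrightarrow> Lpe (f \<^bold>\<cdot> x) (f \<^bold>\<cdot> c) k"
    proof (cases "nm (X \<^bold>\<cdot> c) = 1")
      case True
      then obtain M where "\<And>y. y \<in> elts T1 \<Longrightarrow> Unit y \<Longrightarrow> Near c y M \<Longrightarrow> nm (X \<^bold>\<cdot> y) = 1"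
        using X(3) c unfolding Open_def by blast
      then show ?thesis using L Near_sym by blast
    next
      case False
      then show ?thesis using L by blast
    qed
  qed
  ultimately have "Baire1 f" using ub f(1) by blast
  then obtain F where F: "F \<in> elts (T0 \<^bold>\<rightarrow> T1 \<^bold>\<rightarrow> T1)" "\<And>n. n \<in> elts T0 \<Longrightarrow> IsFun (F \<^bold>\<cdot> n) \<and> Cont (F \<^bold>\<cdot> n)"
     "\<And>x. x \<in> elts T1 \<Longrightarrow> Unit x \<Longrightarrow> Conv F x (f \<^bold>\<cdot> x)"
    unfolding Baire1_def by blast
  interpret open_indicator f F X
    by unfold_locales (use F fR rho X in auto)
  show ?thesis by (rule ex_Code)
qed

section \<open>The Baire category theorem\<close>

lemma seq_nm:
  assumes "X \<in> elts (T0 \<^bold>\<rightarrow> T1 \<^bold>\<rightarrow> T0)" "n \<in> elts T0" "x \<in> elts T1"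
  shows "nm (X \<^bold>\<cdot> n \<^bold>\<cdot> x) = nm (X \<^bold>\<cdot> tn (nm n) \<^bold>\<cdot> x)"
proof -
  have "eqv T2 (X \<^bold>\<cdot> n) (X \<^bold>\<cdot> tn (nm n))" by (rule nm_cong) (use assms in auto)
  then show ?thesis using assms(3) by simp
qed

lemma rep_seq:
  assumes X: "X \<in> elts (T0 \<^bold>\<rightarrow> T1 \<^bold>\<rightarrow> T0)" and x: "x \<in> elts T1" and "rep h"
  shows "rep (\<lambda>v. nm (X \<^bold>\<cdot> tn (h v) \<^bold>\<cdot> x))"
proof -
  obtain p where p: "has_ty p T0" "\<And>v. nm (ev (E v) p) = h v" using assms(3) unfolding rep_def by blast
  have id: "ev (E v) X = X" "ev (E v) x = x" for v using X x by simp_all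
  have "nm (ev (E v) (X \<^bold>\<cdot> p \<^bold>\<cdot> x)) = nm (X \<^bold>\<cdot> tn (h v) \<^bold>\<cdot> x)" for v
    using seq_nm[OF X, of "ev (E v) p" x] x p id by simp
  moreover have "has_ty (X \<^bold>\<cdot> p \<^bold>\<cdot> x) T0" using p elts_has_ty[OF X] elts_has_ty[OF x] by (simp add: has_ty_apps)
  ultimately show ?thesis unfolding rep_def by blast
qed

text \<open>\<open>D\<close> is the denominator minus one: it doubles the denominator at each \<open>n\<close> with \<open>x \<in> X n\<close>, so
  that \<open>f x\<close> is \<open>2 ^ (- n)\<close> for the least \<open>n\<close> with \<open>x \<notin> X n\<close> if there is one, and 0 otherwise.\<close>

lemma rank_function:
  assumes X: "X \<in> elts (T0 \<^bold>\<rightarrow> T1 \<^bold>\<rightarrow> T0)"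
  shows "\<exists>f\<in>elts (T1 \<^bold>\<rightarrow> T1). \<forall>x\<in>elts T1. \<exists>D. rep (\<lambda>v. D (v 0)) \<and> D 0 = 0 \<and>
    (\<forall>k. D (k + 1) = D k + nm (X \<^bold>\<cdot> tn k \<^bold>\<cdot> x) * (D k + 1)) \<and> (\<forall>k. fn (f \<^bold>\<cdot> x) k = cd 1 0 (D k))"
proof -
  \<comment> \<open>All indices are even and thus differ from the variables in \<open>X\<close>.
    Abstraction runs from the inside out: \<open>d\<close> and \<open>n\<close> for the recursion
    step, then the approximation index \<open>k\<close>, then the real \<open>x\<close>.\<close>
  let ?n = "Var 0 T0" and ?d = "Var 2 T0" and ?k = "Var 4 T0" and ?x = "Var 0 T1"
  let ?t1 = "?d \<^bold>+ X \<^bold>\<cdot> ?n \<^bold>\<cdot> ?x \<^bold>* (?d \<^bold>+ \<^bold>1)"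
  have Xo: "odd n" if "(n, \<sigma>) \<in> tm_vars X" for n \<sigma> using X that by (auto simp: elts_def)
  have ty1: "has_ty ?t1 T0" using elts_has_ty[OF X] by (simp add: has_ty_apps)
  obtain s1 where s1: "has_ty s1 T1" "tm_vars s1 \<subseteq> tm_vars ?t1 - {(2, T0)}"
    "\<And>e a. odd_env e \<Longrightarrow> a \<in> elts T0 \<Longrightarrow> eqv T0 (ev e s1 \<^bold>\<cdot> a) (ev (e((2, T0) := a)) ?t1)"
    using eval_abs[OF ty1, where \<sigma> = T0 and n = 2] by blast
  obtain s2 where s2: "has_ty s2 (T0 \<^bold>\<rightarrow> T1)" "tm_vars s2 \<subseteq> tm_vars s1 - {(0, T0)}"
    "\<And>e a. odd_env e \<Longrightarrow> a \<in> elts T0 \<Longrightarrow> eqv T1 (ev e s2 \<^bold>\<cdot> a) (ev (e((0, T0) := a)) s1)"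
    using eval_abs[OF s1(1), where \<sigma> = T0 and n = 0] by blast
  let ?t2 = "rat_code \<^bold>1 \<^bold>0 (Cst R0 \<^bold>\<cdot> s2 \<^bold>\<cdot> \<^bold>0 \<^bold>\<cdot> ?k)"
  have tyR: "has_ty (Cst R0 \<^bold>\<cdot> s2 \<^bold>\<cdot> \<^bold>0 \<^bold>\<cdot> ?k) T0"
    by (rule has_ty.intros(3)[OF has_ty.intros(3)[OF has_ty.intros(3)]]) (use s2 in auto)
  then have ty2: "has_ty ?t2 T0" by (simp add: rat_code_def pair_def)
  obtain s3 where s3: "has_ty s3 T1" "tm_vars s3 \<subseteq> tm_vars ?t2 - {(4, T0)}"
    "\<And>e a. odd_env e \<Longrightarrow> a \<in> elts T0 \<Longrightarrow> eqv T0 (ev e s3 \<^bold>\<cdot> a) (ev (e((4, T0) := a)) ?t2)"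
    using eval_abs[OF ty2, where \<sigma> = T0 and n = 4] by blast
  obtain s4 where s4: "has_ty s4 (T1 \<^bold>\<rightarrow> T1)" "tm_vars s4 \<subseteq> tm_vars s3 - {(0, T1)}"
    "\<And>e a. odd_env e \<Longrightarrow> a \<in> elts T1 \<Longrightarrow> eqv T1 (ev e s4 \<^bold>\<cdot> a) (ev (e((0, T1) := a)) s3)"
    using eval_abs[OF s3(1), where \<sigma> = T1 and n = 0] by blast
  let ?e = "E (\<lambda>_. 0)"
  let ?f = "ev ?e s4"
  have f: "?f \<in> elts (T1 \<^bold>\<rightarrow> T1)" using s4 by simp
  have "\<exists>D. rep (\<lambda>v. D (v 0)) \<and> D 0 = 0 \<and> (\<forall>k. D (k + 1) = D k + nm (X \<^bold>\<cdot> tn k \<^bold>\<cdot> x) * (D k + 1)) \<and>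
      (\<forall>k. fn (?f \<^bold>\<cdot> x) k = cd 1 0 (D k))" if x: "x \<in> elts T1" for x
  proof -
    let ?ex = "?e((0, T1) := x)"
    have o: "odd_env ?ex" using x by simp
    let ?g = "ev ?ex s2"
    have g: "?g \<in> elts (T0 \<^bold>\<rightarrow> T0 \<^bold>\<rightarrow> T0)" using s2(1) o by simp
    have fn2: "fn2 ?g n d = d + nm (X \<^bold>\<cdot> tn n \<^bold>\<cdot> x) * (d + 1)" for n d
    proof -
      let ?en = "?ex((0, T0) := tn n)" and ?ed = "?ex((0, T0) := tn n, (2, T0) := tn d)"
      have "nm (?g \<^bold>\<cdot> tn n \<^bold>\<cdot> tn d) = nm (ev ?en s1 \<^bold>\<cdot> tn d)" using s2(3)[OF o, of "tn n"] by simp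
      also have "\<dots> = nm (ev ?ed ?t1)" using s1(3)[of ?en "tn d"] o by simp
      also have "ev ?ed X = X" by (rule ev_elts_id[OF X]) (auto simp: E_def)
      then have "nm (ev ?ed ?t1) = d + nm (X \<^bold>\<cdot> tn n \<^bold>\<cdot> x) * (d + 1)" using X x by simp
      finally show ?thesis by (simp add: fn2_def)
    qed
    define D where "D k = RR ?g 0 k" for k
    have "fn (?f \<^bold>\<cdot> x) k = cd 1 0 (D k)" for k
    proof -
      have "fn (?f \<^bold>\<cdot> x) k = nm (ev ?ex s3 \<^bold>\<cdot> tn k)" using s4(3)[OF odd_env_E x] by (simp add: fn_def)
      also have "\<dots> = nm (ev (?ex((4, T0) := tn k)) ?t2)" using s3(3)[OF o, of "tn k"] by simp
      also have "ev (?ex((4, T0) := tn k)) s2 = ?g"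
        by (rule ev_indep) (use s1(2) s2(2) Xo[of 4 T0] in auto)
      then have "ev (?ex((4, T0) := tn k)) ?t2 = rat_code \<^bold>1 \<^bold>0 (Cst R0 \<^bold>\<cdot> ?g \<^bold>\<cdot> \<^bold>0 \<^bold>\<cdot> tn k)"
        by (simp add: rat_code_def pair_def)
      also have "nm \<dots> = cd 1 0 (nm (Cst R0 \<^bold>\<cdot> ?g \<^bold>\<cdot> \<^bold>0 \<^bold>\<cdot> tn k))"
        using g by (simp add: rat_code_def pair_def cd_def pr_def)
      also have "nm (Cst R0 \<^bold>\<cdot> ?g \<^bold>\<cdot> \<^bold>0 \<^bold>\<cdot> tn k) = D k"
        using fn2_nm[of "Cst R0 \<^bold>\<cdot> ?g" "\<^bold>0" "tn k"] g by (simp add: D_def RR_def fn2_def)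
      finally show ?thesis .
    qed
    moreover have "rep (\<lambda>v. D (v 0))" unfolding D_def by (rule rep_RR[OF g]) auto
    ultimately show ?thesis using RR_simps[OF g] fn2 by (intro exI[of _ D]) (simp add: D_def)
  qed
  then show ?thesis using f by blast
qed

end

section \<open>The rank function of a decreasing sequence\<close>

locale decreasing_open = model +
  fixes X f :: tm and D :: "tm \<Rightarrow> N \<Rightarrow> N"
  assumes X: "X \<in> elts (T0 \<^bold>\<rightarrow> T1 \<^bold>\<rightarrow> T0)"
    and Xn: "\<And>n. IsSet (X \<^bold>\<cdot> tn n) \<and> Open (X \<^bold>\<cdot> tn n) \<and> Dense (X \<^bold>\<cdot> tn n)"
    and decr: "\<And>n x. x \<in> elts T1 \<Longrightarrow> Unit x \<Longrightarrow> nm (X \<^bold>\<cdot> tn (n + 1) \<^bold>\<cdot> x) = 1 \<Longrightarrow> nm (X \<^bold>\<cdot> tn n \<^bold>\<cdot> x) = 1"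
    and f: "f \<in> elts (T1 \<^bold>\<rightarrow> T1)"
    and D_rep: "\<And>x. x \<in> elts T1 \<Longrightarrow> rep (\<lambda>v. D x (v 0))"
    and D_0: "\<And>x. x \<in> elts T1 \<Longrightarrow> D x 0 = 0"
    and D_Suc: "\<And>x k. x \<in> elts T1 \<Longrightarrow> D x (k + 1) = D x k + nm (X \<^bold>\<cdot> tn k \<^bold>\<cdot> x) * (D x k + 1)"
    and f_D: "\<And>x k. x \<in> elts T1 \<Longrightarrow> fn (f \<^bold>\<cdot> x) k = cd 1 0 (D x k)"
begin

abbreviation mem :: "tm \<Rightarrow> N \<Rightarrow> N" where "mem x n \<equiv> nm (X \<^bold>\<cdot> tn n \<^bold>\<cdot> x)"
abbreviation V :: "tm \<Rightarrow> N \<Rightarrow> Q" where "V x k \<equiv> rho (f \<^bold>\<cdot> x) k"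

lemma V_def: "x \<in> elts T1 \<Longrightarrow> V x k = 1 / (qn (D x k) + 1)"
  by (simp add: rho_def f_D)

lemma mem_01: "x \<in> elts T1 \<Longrightarrow> Unit x \<Longrightarrow> mem x n = 0 \<or> mem x n = 1"
  using Xn unfolding IsSet_def by blast

lemma rep_mem: "x \<in> elts T1 \<Longrightarrow> rep h \<Longrightarrow> rep (\<lambda>v. mem x (h v))"
  by (rule rep_seq[OF X])

lemma repq_V: assumes "x \<in> elts T1" "rep h" shows "repq (\<lambda>v. V x (h v))"
proof -
  have "rep (\<lambda>v. D x (h v))" by (rule rep_comp[OF D_rep[OF assms(1)] assms(2)])
  then show ?thesis unfolding V_def[OF assms(1)] repq_def
    by (intro exI[of _ "\<lambda>_. 1"] exI[of _ "\<lambda>_. 0"] exI[of _ "\<lambda>v. D x (h v)"]) simp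
qed

lemma V_pos: "x \<in> elts T1 \<Longrightarrow> 0 < V x k"
  by (simp add: V_def qn_Suc_pos)

lemma V_0: "x \<in> elts T1 \<Longrightarrow> V x 0 = 1"
  by (simp add: V_def D_0)

lemma V_Suc:
  assumes "x \<in> elts T1"
  shows "mem x k = 0 \<Longrightarrow> V x (k + 1) = V x k" "mem x k = 1 \<Longrightarrow> V x (k + 1) = V x k / 2"
proof -
  have "0 < qn (D x k) + 1" by (rule qn_Suc_pos)
  then have "1 / (qn (D x k) + (qn (D x k) + 1) + 1) = 1 / (qn (D x k) + 1) / 2" by (simp add: divide_simps)
  then show "mem x k = 1 \<Longrightarrow> V x (k + 1) = V x k / 2" using assms by (simp add: V_def D_Suc)
qed (simp add: V_def D_Suc assms)

context
  fixes x assumes x: "x \<in> elts T1" "Unit x"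
begin

lemma mem_mono: "mem x (n + k) = 1 \<Longrightarrow> mem x n = 1"
proof -
  have "mem x (n + k) = 1 \<longrightarrow> mem x n = 1"
  proof (rule ard_induct[of "\<lambda>k. mem x (n + k) = 1 \<longrightarrow> mem x n = 1"])
    show "ard (\<lambda>v. mem x (n + v 0) = 1 \<longrightarrow> mem x n = 1)" by (intro ard_intros rep_mem x)
    fix k assume "mem x (n + k) = 1 \<longrightarrow> mem x n = 1"
    then show "mem x (n + (k + 1)) = 1 \<longrightarrow> mem x n = 1" using decr[OF x, of "n + k"] by (simp add: add.assoc)
  qed simp
  then show "mem x (n + k) = 1 \<Longrightarrow> mem x n = 1" by blast
qed

lemma V_stays: assumes "mem x n = 0" shows "V x (n + k) = V x n"
proof -
  \<comment> \<open>Equality of rationals is split into two inequalities, for which characteristic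
    terms are available.\<close>
  have "V x (n + k) \<le> V x n \<and> V x n \<le> V x (n + k)"
  proof (rule ard_induct[of "\<lambda>k. V x (n + k) \<le> V x n \<and> V x n \<le> V x (n + k)"])
    show "ard (\<lambda>v. V x (n + v 0) \<le> V x n \<and> V x n \<le> V x (n + v 0))" by (intro ard_intros repq_V x)
    fix k assume IH: "V x (n + k) \<le> V x n \<and> V x n \<le> V x (n + k)"
    have "mem x (n + k) = 0" using mem_01[OF x, of "n + k"] mem_mono[of n k] assms by auto
    then show "V x (n + (k + 1)) \<le> V x n \<and> V x n \<le> V x (n + (k + 1))"
      using IH V_Suc(1)[OF x(1), of "n + k"] by (simp add: add.assoc)
  qed simp
  then show ?thesis by simp
qed

text \<open>The sets decrease, so all earlier ones contain \<open>x\<close> as well, and every step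
  up to \<open>k\<close> has halved the value.\<close>

lemma V_halves: "mem x k = 1 \<Longrightarrow> V x (k + 1) = ep (k + 1)"
proof -
  have "mem x k = 1 \<longrightarrow> V x (k + 1) \<le> ep (k + 1) \<and> ep (k + 1) \<le> V x (k + 1)"
  proof (rule ard_induct[of "\<lambda>k. mem x k = 1 \<longrightarrow> V x (k + 1) \<le> ep (k + 1) \<and> ep (k + 1) \<le> V x (k + 1)"])
    show "ard (\<lambda>v. mem x (v 0) = 1 \<longrightarrow> V x (v 0 + 1) \<le> ep (v 0 + 1) \<and> ep (v 0 + 1) \<le> V x (v 0 + 1))"
      by (intro ard_intros repq_V rep_mem x)
    show "mem x 0 = 1 \<longrightarrow> V x (0 + 1) \<le> ep (0 + 1) \<and> ep (0 + 1) \<le> V x (0 + 1)"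
      using V_Suc(2)[OF x(1), of 0] V_0[OF x(1)] unfolding ep_simps by simp
    fix k assume "mem x k = 1 \<longrightarrow> V x (k + 1) \<le> ep (k + 1) \<and> ep (k + 1) \<le> V x (k + 1)"
    moreover have "V x (k + 1 + 1) = V x (k + 1) / 2" "mem x k = 1" if "mem x (k + 1) = 1"
      using V_Suc(2)[OF x(1) that] decr[OF x that] by blast+
    ultimately show "mem x (k + 1) = 1 \<longrightarrow> V x (k + 1 + 1) \<le> ep (k + 1 + 1) \<and> ep (k + 1 + 1) \<le> V x (k + 1 + 1)"
      unfolding ep_simps(2)[of "k + 1"] by linarith
  qed
  then show "mem x k = 1 \<Longrightarrow> V x (k + 1) = ep (k + 1)" by simp
qed

lemma V_le: "V x (n + k) \<le> V x n"
proof (rule ard_induct[of "\<lambda>k. V x (n + k) \<le> V x n"])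
  show "ard (\<lambda>v. V x (n + v 0) \<le> V x n)" by (intro ard_intros repq_V x)
  fix k assume "V x (n + k) \<le> V x n"
  then show "V x (n + (k + 1)) \<le> V x n"
    using V_Suc[OF x(1), of "n + k"] mem_01[OF x, of "n + k"] V_pos[OF x(1), of "n + k"] by (auto simp: add.assoc)
qed simp

lemma V_ge: "ep k \<le> V x k"
proof (rule ard_induct[of "\<lambda>k. ep k \<le> V x k"])
  show "ard (\<lambda>v. ep (v 0) \<le> V x (v 0))" by (intro ard_intros repq_V x)
  fix k assume "ep k \<le> V x k"
  then show "ep (k + 1) \<le> V x (k + 1)"
    using V_Suc[OF x(1), of k] mem_01[OF x, of k] ep_pos[of k] unfolding ep_simps by linarith
qed (simp add: V_0 x)

text \<open>The values are positive and do not increase. Either the sequence has stopped before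
  \<open>n\<close>, or it has been halved \<open>n\<close> times and equals \<open>ep n\<close>,
  which bounds any further drop.\<close>

lemma f_real: "Real (f \<^bold>\<cdot> x)"
  unfolding Real_def
proof (intro allI conjI)
  fix n i
  show "isq (fn (f \<^bold>\<cdot> x) n)" "isq (fn (f \<^bold>\<cdot> x) (n + i))" by (simp_all add: f_D x)
  show "V x (n + i) < V x n + ep n" using V_le[of n i] ep_pos[of n] by linarith
  show "V x n < V x (n + i) + ep n"
  proof (cases "n = 0")
    case True
    then show ?thesis using V_pos[OF x(1), of i] V_0[OF x(1)] by simp
  next
    case False
    then obtain m where m: "n = m + 1" by (metis N_le_iff N_less_iff N_pos_iff add.commute add_0)
    consider "mem x m = 0" | "mem x m = 1" using mem_01[OF x] by blast
    then show ?thesis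
    proof cases
      case 1
      have "V x n = V x m" "V x (n + i) = V x m"
        using V_stays[OF 1, of 1] V_stays[OF 1, of "1 + i"] by (simp_all add: m add.assoc)
      then show ?thesis by simp
    next
      case 2
      then show ?thesis using V_halves[OF 2] V_pos[OF x(1), of "n + i"] by (simp add: m)
    qed
  qed
qed

text \<open>On \<open>X n\<close> the function is at most half of the lower bound that
  \<open>f_outside\<close> gives off \<open>X n\<close>. This gap by a factor 2 is what the
  approximating functions can detect.\<close>

lemma f_inside: assumes "mem x n = 1" shows "Le (f \<^bold>\<cdot> x) (ep (n + 1))"
  unfolding Le_def
proof
  fix j
  show "V x j \<le> ep (n + 1) + ep j"
  proof (cases "n + 1 \<le> j")
    case True
    then obtain i where "j = n + 1 + i" using N_le_iff by metis
    then have "V x j \<le> V x (n + 1)" using V_le by simp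
    then show ?thesis using V_halves[OF assms] ep_pos[of j] by linarith
  next
    case False
    then obtain i where "n + 1 = j + i" using N_le_iff by (metis linear)
    then show ?thesis using f_real V_halves[OF assms] unfolding Real_def by (metis add.commute less_imp_le)
  qed
qed

lemma f_outside: assumes "mem x n = 0" shows "ep n \<le> V x j"
proof (cases "n \<le> j")
  case True
  then obtain i where "j = n + i" using N_le_iff by metis
  then show ?thesis using V_stays[OF assms] V_ge[of n] by simp
next
  case False
  then have "ep n \<le> ep j" by (simp add: ep_mono)
  also have "\<dots> \<le> V x j" using False N_le_iff V_ge V_le by (metis linear order_trans)
  finally show ?thesis using False N_le_iff V_ge V_le by (metis linear order_trans)
qed

lemma V_le_1: "V x j \<le> 1"
  using V_le[of 0 j] V_0[OF x(1)] by simp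

text \<open>A least number principle. The conclusion does not mention \<open>k\<close>, so
  arithmetical induction on \<open>k\<close> proves it.\<close>

lemma first_outside:
  assumes "mem x k = 0"
  shows "\<exists>m. mem x m = 0 \<and> (m = 0 \<or> (\<exists>m'. m = m' + 1 \<and> mem x m' = 1))"
proof -
  let ?C = "\<exists>m. mem x m = 0 \<and> (m = 0 \<or> (\<exists>m'. m = m' + 1 \<and> mem x m' = 1))"
  have "mem x k = 0 \<longrightarrow> ?C"
  proof (rule ard_induct[of "\<lambda>k. mem x k = 0 \<longrightarrow> ?C"])
    show "ard (\<lambda>v. mem x (v 0) = 0 \<longrightarrow> ?C)" by (rule ard_imp[OF _ ard_const]) (intro ard_intros rep_mem x)
    fix k assume "mem x k = 0 \<longrightarrow> ?C"
    then show "mem x (k + 1) = 0 \<longrightarrow> ?C" using mem_01[OF x, of k] by blast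
  qed blast
  then show ?thesis using assms by blast
qed

end

lemma f_fun: "IsFun f"
  unfolding IsFun_def
proof (intro conjI ballI impI)
  fix x y assume x: "x \<in> elts T1" "Unit x" and y: "y \<in> elts T1" "Unit y" and xy: "Req x y"
  have mem: "mem x k = mem y k" for k using Xn x y xy unfolding IsSet_def by blast
  have "D x k = D y k" for k
  proof (rule ard_induct[of "\<lambda>k. D x k = D y k"])
    show "ard (\<lambda>v. D x (v 0) = D y (v 0))" by (intro ard_eq D_rep x y)
  qed (use D_0 D_Suc x y mem in auto)
  then show "Req (f \<^bold>\<cdot> x) (f \<^bold>\<cdot> y)" unfolding Req_def using x y by (simp add: f_D V_def less_imp_le)
qed (rule f_real)

text \<open>For precision \<open>k\<close> it matters whether \<open>c\<close> is in
  \<open>X k\<close>. If so, nearby values are at most \<open>2 ^ (- k - 1)\<close>. Otherwise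
  \<open>c\<close> leaves the sequence at some \<open>m\<close>. Points near \<open>c\<close> still
  lie in the set before \<open>m\<close>, so their values are at most \<open>2 ^ (- m)\<close>, a
  lower bound of \<open>f c\<close>; for \<open>m = 0\<close>, the value at \<open>c\<close> is the
  maximum 1.\<close>

lemma f_usc: "Usc f"
  unfolding Usc_def
proof (intro ballI impI allI)
  fix c k assume c: "c \<in> elts T1" "Unit c"
  have op: "\<exists>M. \<forall>x\<in>elts T1. Unit x \<longrightarrow> Near x c M \<longrightarrow> mem x n = 1" if "mem c n = 1" for n
    using Xn c that Near_sym unfolding Open_def by meson
  consider "mem c k = 1" | m where "mem c m = 0" "m = 0" | m m' where "mem c m = 0" "m = m' + 1" "mem c m' = 1"
    using mem_01[OF c, of k] first_outside[OF c, of k] by blast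
  then show "\<exists>M. \<forall>x\<in>elts T1. Unit x \<longrightarrow> \<not> Req x c \<longrightarrow> Near x c M \<longrightarrow> Lpe (f \<^bold>\<cdot> x) (f \<^bold>\<cdot> c) k"
  proof cases
    case 1
    then obtain M where M: "\<forall>x\<in>elts T1. Unit x \<longrightarrow> Near x c M \<longrightarrow> mem x k = 1" using op by blast
    have "Lpe (f \<^bold>\<cdot> x) (f \<^bold>\<cdot> c) k" if x: "x \<in> elts T1" "Unit x" "Near x c M" for x
    proof (rule LpeI[OF f_real[OF x(1,2)] f_real[OF c], of "k + 1 + 1 + 1"])
      have "mem x k = 1" using M x by blast
      from f_inside[OF x(1,2) this]
      have "V x (k + 1 + 1 + 1) \<le> ep (k + 1) + ep (k + 1 + 1 + 1)" unfolding Le_def by blast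
      then show "V x (k + 1 + 1 + 1) + 2 * ep (k + 1 + 1 + 1) < V c (k + 1 + 1 + 1) + ep k"
        using V_pos[OF c(1), of "k + 1 + 1 + 1"] ep_pos[of k] unfolding ep_simps by linarith
    qed
    then show ?thesis by blast
  next
    case 2
    have "Lpe (f \<^bold>\<cdot> x) (f \<^bold>\<cdot> c) k" if x: "x \<in> elts T1" "Unit x" for x
    proof (rule LpeI[OF f_real[OF x] f_real[OF c], of "k + 1 + 1"])
      have "V c (k + 1 + 1) = 1" using V_stays[OF c, of 0 "k + 1 + 1"] 2 V_0[OF c(1)] by simp
      then show "V x (k + 1 + 1) + 2 * ep (k + 1 + 1) < V c (k + 1 + 1) + ep k"
        using V_le_1[OF x, of "k + 1 + 1"] ep_pos[of k] unfolding ep_simps by linarith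
    qed
    then show ?thesis by blast
  next
    case 3
    then obtain M where M: "\<forall>x\<in>elts T1. Unit x \<longrightarrow> Near x c M \<longrightarrow> mem x m' = 1" using op by blast
    have "Lpe (f \<^bold>\<cdot> x) (f \<^bold>\<cdot> c) k" if x: "x \<in> elts T1" "Unit x" "Near x c M" for x
    proof (rule LpeI[OF f_real[OF x(1,2)] f_real[OF c], of "k + 1 + 1"])
      have "mem x m' = 1" using M x by blast
      from f_inside[OF x(1,2) this]
      have "V x (k + 1 + 1) \<le> ep m + ep (k + 1 + 1)" using 3(2) unfolding Le_def by blast
      then show "V x (k + 1 + 1) + 2 * ep (k + 1 + 1) < V c (k + 1 + 1) + ep k"
        using f_outside[OF c 3(1), of "k + 1 + 1"] ep_pos[of k] unfolding ep_simps by linarith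
    qed
    then show ?thesis by blast
  qed
qed

end

section \<open>Nested intervals with small approximants\<close>

locale decreasing_open_approx = decreasing_open + approximation
begin

text \<open>3/4 lies strictly between 1/2 and 1: late \<open>F m\<close> fall below
  \<open>3 / 4 * ep i\<close> at a point of \<open>X i\<close> and stay above it at a point off
  \<open>X i\<close>.\<close>

definition Stage :: "N \<Rightarrow> Q \<Rightarrow> Q \<Rightarrow> bool" where
  "Stage i a b \<longleftrightarrow> 0 \<le> a \<and> b \<le> 1 \<and> a < b \<and> b - a < ep i \<and>
     (\<exists>m. i \<le> m \<and> (\<forall>r. okr r \<longrightarrow> a \<le> qv r \<longrightarrow> qv r \<le> b \<longrightarrow> LeF F m r (3 / 4 * ep i)))"

text \<open>Density gives a point \<open>y\<close> of \<open>X i\<close> close to the midpoint. A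
  late \<open>F m\<close> is small at \<open>y\<close>, hence by continuity on a small interval
  around it.\<close>

lemma Stage_step:
  assumes ab: "0 \<le> a" "b \<le> 1" "a < b"
  shows "\<exists>a' b'. a \<le> a' \<and> b' \<le> b \<and> Stage i a' b'"
proof -
  obtain r0 where r0: "isq r0" "qv r0 = (a + b) / 2" using qv_surj by blast
  then have ok: "okr r0" using ab unfolding okr_def by (simp add: field_simps)
  obtain K where K: "ep K < (b - a) / 4" using ep_archimedean[of "(b - a) / 4"] ab by auto
  have "Dense (X \<^bold>\<cdot> tn i)" using Xn by blast
  then obtain y where y: "y \<in> elts T1" "Unit y" "Near (rat_real (tn r0)) y K" "mem y i = 1"
    using okr_unit[OF ok] rat_real_elts[OF tn(1)] unfolding Dense_def by blast
  note R = Unit_Real[OF y(2)]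
  \<comment> \<open>The bound is 1/2 + 1/8 of \<open>ep i\<close>; what is left up to 3/4 pays for
    the passage from \<open>y\<close> to its neighbourhood.\<close>
  obtain M0 where M0: "\<And>m. M0 \<le> m \<Longrightarrow> Le (F \<^bold>\<cdot> tn m \<^bold>\<cdot> y) (ep (i + 1) + ep (i + 1 + 1 + 1))"
    using conv_below[OF y(1,2) f_inside[OF y(1,2,4)]] by blast
  define m where "m = max M0 i"
  have "Le (F \<^bold>\<cdot> tn m \<^bold>\<cdot> y) (ep (i + 1) + ep (i + 1 + 1 + 1))" by (rule M0) (simp add: m_def)
  moreover have "ep (i + 1) + ep (i + 1 + 1 + 1) < 3 / 4 * ep i" unfolding ep_simps using ep_pos[of i] by linarith
  ultimately obtain M where
    M: "\<And>r n. okr r \<Longrightarrow> qv r + 2 * ep n < rho y n + ep M \<Longrightarrow> rho y n + 2 * ep n < qv r + ep M \<Longrightarrow>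
       LeF F m r (3 / 4 * ep i)"
    using neighbourhood_Le[OF Fm y(1,2)] unfolding LeF_iff by blast
  obtain n4 where n4: "ep n4 < (b - a) / 16" using ep_archimedean[of "(b - a) / 16"] ab by auto
  \<comment> \<open>The three bounds keep \<open>rho y n\<close> between \<open>a\<close> and
    \<open>b\<close>, the new interval within the radius \<open>ep M\<close> of continuity, and its
    length below \<open>ep i\<close>.\<close>
  define n where "n = max n4 (max (M + 1 + 1 + 1) (i + 1 + 1))"
  have "n4 \<le> n" "M + 1 + 1 + 1 \<le> n" "i + 1 + 1 \<le> n"
    unfolding n_def by (rule max.cobounded1 max.coboundedI2 order.refl)+
  from this[THEN ep_mono] have e: "ep n \<le> ep n4" "ep n \<le> ep M / 8" "ep n \<le> ep i / 4" by simp_all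
  have "rho y n < qv r0 + ep K + 2 * ep n" "qv r0 < rho y n + ep K + 2 * ep n"
    using NearD[OF y(3) Unit_Real[OF okr_unit[OF ok]] R, of n] by simp_all
  then have in_ab: "a < rho y n" "rho y n < b" using r0(2) K n4 e(1) ab(3) by (simp_all add: field_simps)
  define a' b' where "a' = max a (rho y n - ep n)" and "b' = min b (rho y n + ep n)"
  have "Stage i a' b'" unfolding Stage_def
  proof (intro conjI exI[of _ m] allI impI)
    show "0 \<le> a'" "b' \<le> 1" using ab by (auto simp: a'_def b'_def)
    show "a' < b'" 
      unfolding a'_def b'_def max_less_iff_conj min_less_iff_conj
      using in_ab ab ep_pos[of n] by (intro conjI; linarith)
    have "rho y n - ep n \<le> a'" "b' \<le> rho y n + ep n" by (simp_all add: a'_def b'_def)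
    then show "b' - a' < ep i" using e(3) ep_pos[of i] by linarith
    show "i \<le> m" by (simp add: m_def)
    fix r assume r: "okr r" "a' \<le> qv r" "qv r \<le> b'"
    show "LeF F m r (3 / 4 * ep i)"
      by (rule M[OF r(1), of n])
        (use r(2,3) \<open>rho y n - ep n \<le> a'\<close> \<open>b' \<le> rho y n + ep n\<close> e(2) ep_pos[of M] in linarith)+
  qed
  moreover have "a \<le> a'" "b' \<le> b" by (simp_all add: a'_def b'_def)
  ultimately show ?thesis by blast
qed

text \<open>At the common point, arbitrarily late \<open>F m\<close> are at most
  \<open>3 / 4 * ep n\<close>, whatever \<open>n\<close> is. If the point were off
  \<open>X n\<close>, the limit would be at least \<open>ep n\<close> and finally all
  \<open>F m\<close> would exceed that bound.\<close>

lemma intersection_nonempty: "\<exists>x\<in>elts T1. Unit x \<and> (\<forall>n. mem x n = 1)"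
proof -
  obtain a0 b0 where S0: "Stage 0 a0 b0" using Stage_step[of 0 1 0] by auto
  have "ard (\<lambda>v. Stage (v 0) (qv (v 1)) (qv (v 2)))"
    unfolding Stage_def okr_def LeF_def by (intro ard_intros rep_FF F)
  moreover have "\<And>i p q. Stage i p q \<Longrightarrow> p \<le> q \<and> q - p < ep i" unfolding Stage_def by auto
  moreover have "\<And>i p q. Stage i p q \<Longrightarrow> \<exists>p' q'. p \<le> p' \<and> q' \<le> q \<and> Stage (i + 1) p' q'"
    using Stage_step unfolding Stage_def by blast
  ultimately have "\<exists>x\<in>elts T1. Real x \<and> (\<forall>i. \<exists>p q. Stage i p q \<and> (\<forall>n\<ge>i. p \<le> rho x n \<and> rho x n \<le> q))"
    by (rule nested_intervals[where P = Stage, OF _ S0])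
  then obtain x where x: "x \<in> elts T1" "Real x"
    "\<And>i. \<exists>p q. Stage i p q \<and> (\<forall>n\<ge>i. p \<le> rho x n \<and> rho x n \<le> q)" by blast
  have r01: "0 \<le> rho x n" "rho x n \<le> 1" for n
    using x(3)[of n] unfolding Stage_def by (meson order.refl order_trans)+
  then have U: "Unit x" unfolding Unit_def using x(2) ep_pos by (simp add: add_increasing2 less_imp_le add_increasing)
  have low: "\<exists>m\<ge>i. Le (F \<^bold>\<cdot> tn m \<^bold>\<cdot> x) (3 / 4 * ep i)" for i
  proof -
    obtain p q where pq: "Stage i p q" "\<And>n. i \<le> n \<Longrightarrow> p \<le> rho x n \<and> rho x n \<le> q" using x(3) by blast
    then obtain m where m: "i \<le> m" "\<And>r. okr r \<Longrightarrow> p \<le> qv r \<Longrightarrow> qv r \<le> q \<Longrightarrow> LeF F m r (3 / 4 * ep i)"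
      unfolding Stage_def by blast
    have "Le (F \<^bold>\<cdot> tn m \<^bold>\<cdot> x) (3 / 4 * ep i)"
      by (rule transfer_Le[OF Fm x(1) U, of p q _ _ i]) (use m pq(2) r01 in \<open>auto simp: LeF_iff clamp_def\<close>)
    then show ?thesis using m(1) by blast
  qed
  have "mem x n = 1" for n
  proof (rule ccontr)
    assume "mem x n \<noteq> 1"
    then have "mem x n = 0" using mem_01[OF x(1) U] by blast
    from conv_above[OF x(1) U f_outside[OF x(1) U this], of "3 / 4 * ep n"] ep_pos[of n]
    obtain M where M: "\<And>m. M \<le> m \<Longrightarrow> \<not> Le (F \<^bold>\<cdot> tn m \<^bold>\<cdot> x) (3 / 4 * ep n)" by auto
    \<comment> \<open>\<open>max n M\<close> makes \<open>m\<close> late enough for \<open>M\<close>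
      and the bound small enough for \<open>n\<close>.\<close>
    obtain m where m: "max n M \<le> m" "Le (F \<^bold>\<cdot> tn m \<^bold>\<cdot> x) (3 / 4 * ep (max n M))" using low by blast
    have "3 / 4 * ep (max n M) \<le> 3 / 4 * ep n" using ep_mono[of n "max n M"] by simp
    then have "Le (F \<^bold>\<cdot> tn m \<^bold>\<cdot> x) (3 / 4 * ep n)" using m(2) unfolding Le_def by (meson add_right_mono order_trans)
    then show False using M[of m] m(1) by simp
  qed
  then show ?thesis using x(1) U by blast
qed

end

lemma (in model) BCT_holds:
  assumes ub: "\<And>f. f \<in> elts (T1 \<^bold>\<rightarrow> T1) \<Longrightarrow> IsFun f \<Longrightarrow> Usc f \<Longrightarrow> Baire1 f"
    and X: "X \<in> elts (T0 \<^bold>\<rightarrow> T1 \<^bold>\<rightarrow> T0)"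
    and Xn: "\<And>n. n \<in> elts T0 \<Longrightarrow> IsSet (X \<^bold>\<cdot> n) \<and> Open (X \<^bold>\<cdot> n) \<and> Dense (X \<^bold>\<cdot> n)"
    and decr: "\<And>n x. n \<in> elts T0 \<Longrightarrow> x \<in> elts T1 \<Longrightarrow> Unit x \<Longrightarrow> nm (X \<^bold>\<cdot> (n \<^bold>+ \<^bold>1) \<^bold>\<cdot> x) = 1 \<Longrightarrow> nm (X \<^bold>\<cdot> n \<^bold>\<cdot> x) = 1"
  shows "\<exists>x\<in>elts T1. Unit x \<and> (\<forall>n\<in>elts T0. nm (X \<^bold>\<cdot> n \<^bold>\<cdot> x) = 1)"
proof -
  obtain f where f: "f \<in> elts (T1 \<^bold>\<rightarrow> T1)" "\<forall>x\<in>elts T1. \<exists>D. rep (\<lambda>v. D (v 0)) \<and> D 0 = 0 \<and>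
    (\<forall>k. D (k + 1) = D k + nm (X \<^bold>\<cdot> tn k \<^bold>\<cdot> x) * (D k + 1)) \<and> (\<forall>k. fn (f \<^bold>\<cdot> x) k = cd 1 0 (D k))"
    using rank_function[OF X] by blast
  obtain D where D: "\<forall>x\<in>elts T1. rep (\<lambda>v. D x (v 0)) \<and> D x 0 = 0 \<and>
    (\<forall>k. D x (k + 1) = D x k + nm (X \<^bold>\<cdot> tn k \<^bold>\<cdot> x) * (D x k + 1)) \<and> (\<forall>k. fn (f \<^bold>\<cdot> x) k = cd 1 0 (D x k))"
    using bchoice[OF f(2)] by blast
  have decr': "nm (X \<^bold>\<cdot> tn n \<^bold>\<cdot> x) = 1" if "x \<in> elts T1" "Unit x" "nm (X \<^bold>\<cdot> tn (n + 1) \<^bold>\<cdot> x) = 1" for n x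
    using decr[of "tn n" x] seq_nm[OF X, of "tn n \<^bold>+ \<^bold>1" x] that by simp
  interpret decreasing_open X f D
    by unfold_locales (use X Xn decr' f(1) D in auto)
  have "Baire1 f" using ub f(1) f_fun f_usc by blast
  then obtain F where F: "F \<in> elts (T0 \<^bold>\<rightarrow> T1 \<^bold>\<rightarrow> T1)" "\<And>n. n \<in> elts T0 \<Longrightarrow> IsFun (F \<^bold>\<cdot> n) \<and> Cont (F \<^bold>\<cdot> n)"
     "\<And>x. x \<in> elts T1 \<Longrightarrow> Unit x \<Longrightarrow> Conv F x (f \<^bold>\<cdot> x)"
    unfolding Baire1_def by blast
  interpret decreasing_open_approx X f D F
    by unfold_locales (use F f_real in auto)
  obtain x where x: "x \<in> elts T1" "Unit x" "\<forall>n. nm (X \<^bold>\<cdot> tn n \<^bold>\<cdot> x) = 1" using intersection_nonempty by blast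
  have "nm (X \<^bold>\<cdot> n \<^bold>\<cdot> x) = 1" if "n \<in> elts T0" for n
    by (rule trans[OF seq_nm[OF X that x(1)]]) (use x(3) in blast)
  then show ?thesis using x(1,2) by blast
qed

text \<open>The type \<open>N\<close> belongs to the chosen \<open>TM\<close>, so an arbitrary
  countermodel is first exchanged for it.\<close>

lemma no_counter: "\<not> counter T"
proof
  assume "counter T"
  then have "counter TM" unfolding TM_def by (rule someI)
  then interpret model by unfold_locales (simp add: mdl_def)
  have c: "sat TM oenv0 (sentence usc_baire1)" "\<not> (sat TM oenv0 (sentence BCT) \<and> sat TM oenv0 (sentence open_RM))"
    using \<open>counter TM\<close> odd_oenv0 unfolding counter_def by blast+
  have ub: "f \<in> elts (T1 \<^bold>\<rightarrow> T1) \<Longrightarrow> IsFun f \<Longrightarrow> Usc f \<Longrightarrow> Baire1 f" for f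
    using c(1) usc_baire1_sem[OF odd_oenv0] by blast
  have "sat TM oenv0 (sentence open_RM)"
    unfolding open_RM_sem[OF odd_oenv0] using open_RM_holds[OF ub] by blast
  moreover have "sat TM oenv0 (sentence BCT)"
    unfolding BCT_sem[OF odd_oenv0] using BCT_holds[OF ub] by blast
  ultimately show False using c(2) by blast
qed

section \<open>Well-formed sentences\<close>

definition fits :: "(nat \<times> ty) set \<Rightarrow> scheme \<Rightarrow> nat \<Rightarrow> bool" where
  "fits S F n \<longleftrightarrow> wff (F n) \<and> fv (F n) \<subseteq> S"

lemma fits_connectives [simp]:
  "fits S (s \<^bold>= t) n \<longleftrightarrow> has_ty s T0 \<and> has_ty t T0 \<and> tm_vars s \<subseteq> S \<and> tm_vars t \<subseteq> S"
  "fits S (s \<^bold>< t) n \<longleftrightarrow> has_ty s T0 \<and> has_ty t T0 \<and> tm_vars s \<subseteq> S \<and> tm_vars t \<subseteq> S"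
  "fits S (F \<^bold>\<longrightarrow> G) n \<longleftrightarrow> fits S F n \<and> fits S G n"
  "fits S (\<^bold>\<not> F) n \<longleftrightarrow> fits S F n"
  "fits S (F \<^bold>\<and> G) n \<longleftrightarrow> fits S F n \<and> fits S G n"
  "fits S (F \<^bold>\<or> G) n \<longleftrightarrow> fits S F n \<and> fits S G n"
  "fits S (F \<^bold>\<longleftrightarrow> G) n \<longleftrightarrow> fits S F n \<and> fits S G n"
  by (auto simp: fits_def s_eq_def s_less_def s_imp_def s_neg_def s_conj_def s_disj_def s_iff_def)

lemma fits_quantifiers [simp]:
  "fits S (s_all \<sigma> H) n \<longleftrightarrow> fits (insert (n, \<sigma>) S) (H (Var n \<sigma>)) (Suc n)"
  "fits S (s_ex \<sigma> H) n \<longleftrightarrow> fits (insert (n, \<sigma>) S) (H (Var n \<sigma>)) (Suc n)"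
  "fits S (s_all0 H) n \<longleftrightarrow> fits (insert (n, T0) S) (H (Var n T0)) (Suc n)"
  "fits S (s_all1 H) n \<longleftrightarrow> fits (insert (n, T1) S) (H (Var n T1)) (Suc n)"
  "fits S (s_ex0 H) n \<longleftrightarrow> fits (insert (n, T0) S) (H (Var n T0)) (Suc n)"
  "fits S (s_ex1 H) n \<longleftrightarrow> fits (insert (n, T1) S) (H (Var n T1)) (Suc n)"
  by (auto simp: fits_def s_all_def s_ex_def s_all0_def s_all1_def s_ex0_def s_ex1_def)

lemma fits_ex_rat [simp]:
  "fits S (ex_rat c G) n \<longleftrightarrow> has_ty c T0 \<and> tm_vars c \<subseteq> insert (Suc (Suc n), T0) (insert (Suc n, T0) (insert (n, T0) S)) \<and>
     fits (insert (Suc (Suc n), T0) (insert (Suc n, T0) (insert (n, T0) S)))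
       (G (Var n T0, Var (Suc n) T0, Var (Suc (Suc n)) T0 \<^bold>+ \<^bold>1)) (Suc (Suc (Suc n)))"
  by (simp add: ex_rat_def rat_code_def pair_def has_ty_apps)

lemma tm_vars_pow2 [simp]: "tm_vars (pow2 t) = tm_vars t"
  by (simp add: pow2_def double_step_def)

lemma tm_vars_rat_real [simp]: "tm_vars (rat_real c) = tm_vars c"
  by (simp add: rat_real_def)

lemma fits_is_real: "has_ty x T1 \<Longrightarrow> tm_vars x \<subseteq> S \<Longrightarrow> fits S (is_real x) n"
  by (simp add: is_real_def eps_def has_ty_apps subset_insertI2)

lemma fits_relations:
  assumes "has_ty x T1" "tm_vars x \<subseteq> S" "has_ty y T1" "tm_vars y \<subseteq> S"
  shows "fits S (x \<^bold>=\<^sub>\<real> y) n" "fits S (x \<^bold><\<^sub>\<real> y) n" "fits S (x \<^bold>\<le>\<^sub>\<real> y) n"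
    "has_ty k T0 \<Longrightarrow> tm_vars k \<subseteq> S \<Longrightarrow> fits S (less_plus_eps x y k) n"
    "has_ty k T0 \<Longrightarrow> tm_vars k \<subseteq> S \<Longrightarrow> fits S (near x y k) n"
  using assms by (simp_all add: near_def less_plus_eps_def real_eq_def real_less_def real_le_def
    eps_def eps2_def qle_def has_ty_apps subset_insertI2)

lemma fits_in_unit: "has_ty x T1 \<Longrightarrow> tm_vars x \<subseteq> S \<Longrightarrow> fits S (in_unit x) n"
  by (simp add: in_unit_def fits_is_real fits_relations rat_code_def pair_def)

lemma fits_unit_quantifiers [simp]:
  "fits S (all_unit H) n \<longleftrightarrow> fits (insert (n, T1) S) (H (Var n T1)) (Suc n)"
  "fits S (ex_unit H) n \<longleftrightarrow> fits (insert (n, T1) S) (H (Var n T1)) (Suc n)"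
  by (simp_all add: all_unit_def ex_unit_def fits_in_unit)

lemma fits_sentences: "fits {} usc_baire1 0" "fits {} BCT 0" "fits {} open_RM 0"
  by (simp_all add: usc_baire1_def BCT_def open_RM_def is_fun_def upper_semicontinuous_def limsup_le_def
    baire1_def continuous_def converges_def is_set_def open_set_def dense_set_def mem_def RM_code_def
    fits_is_real fits_relations has_ty_apps subset_insertI2)

theorem corollary2p8:
  shows "(ACA0_omega \<turnstile> sentence (usc_baire1 \<^bold>\<longrightarrow> BCT)) \<and>
         (ACA0_omega \<turnstile> sentence (usc_baire1 \<^bold>\<longrightarrow> open_RM))"
proof -
  have "ACA0_omega \<turnstile> sentence (usc_baire1 \<^bold>\<longrightarrow> F)" if F: "F = BCT \<or> F = open_RM" for F
  proof (rule ccontr)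
    let ?\<phi> = "sentence (usc_baire1 \<^bold>\<longrightarrow> F)"
    assume "\<not> ACA0_omega \<turnstile> ?\<phi>"
    moreover have "fits {} (usc_baire1 \<^bold>\<longrightarrow> F) 0" using F fits_sentences by auto
    ultimately obtain T where T: "henkin ACA0_omega T" "\<And>e. odd_env e \<Longrightarrow> \<not> sat T e ?\<phi>"
      using completeness[of ?\<phi> ACA0_omega] unfolding proves_def fits_def sentence_def by auto
    have "sat T e (sentence usc_baire1)" "\<not> sat T e (sentence F)" if "odd_env e" for e
      using T(2)[OF that] by (simp_all add: sentence_def s_imp_def)
    then have "counter T" unfolding counter_def using T(1) F by blast
    then show False using no_counter by blast
  qed
  then show ?thesis by blast
qed

end
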